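(* For every $v\in(v_{\min},\infty)$, the pair $(\mathcal E_v,D_v)$ is a regular local irreducible Dirichlet form on $L^2(F,\mu)$. It has an associated resistance metric, and the topology induced by this metric is the existing topology on $F$.
   Context: **Self-similar sets.** A self-similar structure $\mathcal S=(F,(\psi_i)_{1\le i\le N})$ is a compact metric space $F$ with continuous injections $\psi_i:F\to F$ such that $F=\bigcup_i\psi_i(F)$ and, for some $\delta>0$, every $\psi_i$ is Lipschitz with constant $1-\delta$. Let $I=\{1,\dots,N\}$, $\mathbb W_n=I^n$, $\mathbb W=I^{\mathbb N}$, $\sigma$ the left shift, $\psi_w=\psi_{w_1}\circ\cdots\circ\psi_{w_n}$ and $A_w=\psi_w(A)$ for $w\in\mathbb W_n$. For $w\in\mathbb W$, $\pi(w)$ is the unique point of $\bigcap_n\psi_{w_1\dots w_n}(F)$. Let $B(\mathcal S)=\bigcup_{i\ne j}F_i\cap F_j$, $P(\mathcal S)=\bigcup_{n\ge1}\sigma^n(\pi^{-1}(B(\mathcal S)))$. $\mathcal S$ is a generalized p.c.f.s.s. set if $\pi(P(\mathcal S))$ is finite. $F^n=\{\pi(w):\sigma^nw\in P(\mathcal S)\}$; thus $F^0=\pi(P(\mathcal S))$, $F^{n+1}=\bigcup_i\psi_i(F^n)$ and $F=\overline{\bigcup_nF^n}$. Throughout $F$ is connected. **Measure.** $\theta=(\theta_i)$ with $0<\theta_i<1$, $\sum\theta_i=1$; $\mu$ is the Bernoulli measure on $F$: the image under $\pi$ of the product measure on $\mathbb W$ with weights $\theta$. **Forms on finite sets.** A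 conservative Dirichlet form on a finite set $V$ is $\mathcal E(f,g)=\frac12\sum_{x,y}a(x,y)(f(x)-f(y))(g(x)-g(y))$ with symmetric conductances $a(x,y)\ge0$; $x\ne y$ are joined by an edge iff $a(x,y)>0$; $\mathcal E$ is irreducible if this graph is connected. $\mathbb D_n$ is the set of such forms on $F^n$. Trace: $\mathrm{Tr}(\mathcal E|H)(h,h)=\inf\{\mathcal E(g,g):g|_H=h\}$. Resistance associated with a form $\mathcal E$ with domain $\mathcal D$ (on a finite set or on $F$): $R_{\mathcal E}(x,y)=\left(\inf\{\mathcal E(g,g):g\in\mathcal D,\ g(x)=0,\ g(y)=1\}\right)^{-1}$ for $x\ne y$, $R_{\mathcal E}(x,x)=0$; if this is a metric it is called the resistance metric associated with $(\mathcal E,\mathcal D)$. Fix a resistance vector $r=(r_1,\dots,r_N)$, $r_i>0$; $r_{\max}=\max r_i$. Replication $\mathsf R:\mathbb D_n\to\mathbb D_{n+1}$: $\mathsf R(\mathcal E)(f,g)=\sum_ir_i^{-1}\mathcal E(f\circ\psi_i,g\circ\psi_i)$. Renormalization: $\Lambda(\mathcal E)=\mathrm{Tr}(\mathsf R(\mathcal E)|F^0)$ on $\mathbb D_0$. **One-parameter iterable family.** $\mathbb D=(\mathcal E^{(0)}_v)_{v>0}\subset\mathbb D_0$ is a family of irreducible forms with a fixed edge set on $F^0$, each edge being either a "1-edge" (conductance 1) or a "$v$-edge" (conductance $v$), independently of $v$, with at least one $v$-edge, such that for functions $\rho,\alpha:(0,\infty)\to(0,\infty)$, $\Lambda(\mathcal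 E_v^{(0)})=\rho(v)^{-1}\mathcal E^{(0)}_{\alpha(v)}$ for all $v$. It is iterable if: (i) asymptotically regular: $r_{\max}\sup_{v>u}\rho(v)^{-1}<1$ for some $u\ge0$; (ii) non-vanishing: $\inf_{v>0}\mathrm{diam}(F^0,R_v)>0$, where $R_v$ is the resistance metric of $\mathcal E^{(0)}_v$; (iii) $\alpha(v)\to\infty$ and $\alpha(v)/v\to1/\beta$ as $v\to\infty$ with $\beta>1$. ($\rho,\alpha$ are rational functions.) $\mathbb D$ is assumed iterable. Let $v_{\min}=\max(\{v:\alpha'(v)=0\}\cup\{v:\alpha(v)=v\}\cup\{v:\rho(v)=r_{\max}\}\cup\{0\})$. $\alpha$ is strictly increasing on $(v_{\min},\infty)$ with inverse $\alpha^{-1}:(v_{\min},\infty)\to(v_{\min},\infty)$, $\alpha^{-1}(v)>v$; $\alpha^{-n}$ is its $n$-th iterate; $\rho_n(v)=\prod_{i=1}^n\rho(\alpha^{-i}(v))$. **Limiting forms.** For $v>v_{\min}$, $\mathcal E^{(n)}_v=\rho_n(v)\mathsf R^n(\mathcal E^{(0)}_{\alpha^{-n}(v)})\in\mathbb D_n$; these are nested: $\mathrm{Tr}(\mathcal E_v^{(n)}|F^m)=\mathcal E_v^{(m)}$ for $m\le n$. $D_v=\{f\in C(F):\sup_n\mathcal E^{(n)}_v(f,f)<\infty\}$ and $\mathcal E_v(f,f)=\sup_n\mathcal E^{(n)}_v(f,f)$ for $f\in D_v$ (functions on $F$ are identified with their restrictions to $F^n$; $\mathcal E_v$ is extended to pairs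 by polarization). *)

theory Defs
  imports "HOL-Probability.Probability" "HOL-Computational_Algebra.Polynomial"
begin

section \<open>Self-similar sets\<close>

text \<open>The compact metric space is a compact subset \<open>F\<close> of a metric type, and the maps
  \<open>\<psi> i\<close> matter only on \<open>F\<close> and for \<open>i \<in> {1..N}\<close>.\<close>

definition self_similar_structure ::
    "'a::metric_space set \<Rightarrow> nat \<Rightarrow> (nat \<Rightarrow> 'a \<Rightarrow> 'a) \<Rightarrow> bool" where
  "self_similar_structure F N \<psi> \<longleftrightarrow>
     compact F \<and> F \<noteq> {} \<and>
     (\<forall>i\<in>{1..N}. continuous_on F (\<psi> i) \<and> inj_on (\<psi> i) F) \<and>
     F = (\<Union>i\<in>{1..N}. \<psi> i ` F) \<and>
     (\<exists>\<delta>>0. \<forall>i\<in>{1..N}. (1 - \<delta>)-lipschitz_on F (\<psi> i))"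

text \<open>Infinite words are indexed from 0: the first letter of \<open>w\<close> is \<open>w 0\<close>.\<close>

definition words :: "nat \<Rightarrow> (nat \<Rightarrow> nat) set" where
  "words N = {w. \<forall>k. w k \<in> {1..N}}"

definition shift :: "nat \<Rightarrow> (nat \<Rightarrow> nat) \<Rightarrow> nat \<Rightarrow> nat" where
  "shift n w = (\<lambda>k. w (n + k))"

definition word_map :: "(nat \<Rightarrow> 'a \<Rightarrow> 'a) \<Rightarrow> nat list \<Rightarrow> 'a \<Rightarrow> 'a" where
  "word_map \<psi> l = foldr (\<lambda>i g. \<psi> i \<circ> g) l id"

definition coding :: "'a set \<Rightarrow> (nat \<Rightarrow> 'a \<Rightarrow> 'a) \<Rightarrow> (nat \<Rightarrow> nat) \<Rightarrow> 'a" where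
  "coding F \<psi> w = (THE x. \<forall>n. x \<in> word_map \<psi> (map w [0..<n]) ` F)"

definition overlap_set :: "'a set \<Rightarrow> nat \<Rightarrow> (nat \<Rightarrow> 'a \<Rightarrow> 'a) \<Rightarrow> 'a set" where
  "overlap_set F N \<psi> =
     (\<Union>i\<in>{1..N}. \<Union>j\<in>{1..N} - {i}. \<psi> i ` F \<inter> \<psi> j ` F)"

definition post_critical :: "'a set \<Rightarrow> nat \<Rightarrow> (nat \<Rightarrow> 'a \<Rightarrow> 'a) \<Rightarrow> (nat \<Rightarrow> nat) set" where
  "post_critical F N \<psi> =
     (\<Union>n\<in>{1..}. shift n ` {w \<in> words N. coding F \<psi> w \<in> overlap_set F N \<psi>})"

definition generalized_pcfss :: "'a::metric_space set \<Rightarrow> nat \<Rightarrow> (nat \<Rightarrow> 'a \<Rightarrow> 'a) \<Rightarrow> bool" where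
  "generalized_pcfss F N \<psi> \<longleftrightarrow>
     self_similar_structure F N \<psi> \<and> finite (coding F \<psi> ` post_critical F N \<psi>)"

definition vertices :: "'a set \<Rightarrow> nat \<Rightarrow> (nat \<Rightarrow> 'a \<Rightarrow> 'a) \<Rightarrow> nat \<Rightarrow> 'a set" where
  "vertices F N \<psi> n = coding F \<psi> ` {w \<in> words N. shift n w \<in> post_critical F N \<psi>}"

definition bernoulli_measure ::
    "'a::metric_space set \<Rightarrow> nat \<Rightarrow> (nat \<Rightarrow> 'a \<Rightarrow> 'a) \<Rightarrow> (nat \<Rightarrow> real) \<Rightarrow> 'a measure" where
  "bernoulli_measure F N \<psi> \<theta> =
     distr (Pi\<^sub>M UNIV (\<lambda>_::nat. point_measure {1..N} (\<lambda>i. ennreal (\<theta> i))))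
       (restrict_space borel F) (coding F \<psi>)"


section \<open>Forms on finite sets\<close>

text \<open>A form on \<open>V\<close> is a functional on all functions of the ambient type that depends only on
  the values on \<open>V\<close>.\<close>

type_synonym 'a form = "('a \<Rightarrow> real) \<Rightarrow> ('a \<Rightarrow> real) \<Rightarrow> real"

definition finite_form :: "'a set \<Rightarrow> ('a \<Rightarrow> 'a \<Rightarrow> real) \<Rightarrow> 'a form" where
  "finite_form V a f g = (1/2) * (\<Sum>x\<in>V. \<Sum>y\<in>V. a x y * (f x - f y) * (g x - g y))"

definition edges :: "'a set \<Rightarrow> ('a \<Rightarrow> 'a \<Rightarrow> real) \<Rightarrow> ('a \<times> 'a) set" where
  "edges V a = {(x, y). x \<in> V \<and> y \<in> V \<and> x \<noteq> y \<and> a x y > 0}"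

definition irreducible_conductances :: "'a set \<Rightarrow> ('a \<Rightarrow> 'a \<Rightarrow> real) \<Rightarrow> bool" where
  "irreducible_conductances V a \<longleftrightarrow> (\<forall>x\<in>V. \<forall>y\<in>V. (x, y) \<in> (edges V a)\<^sup>*)"

text \<open>Traces are only needed on the diagonal, which determines a symmetric form.\<close>

definition form_trace :: "'a set \<Rightarrow> 'a form \<Rightarrow> ('a \<Rightarrow> real) \<Rightarrow> real" where
  "form_trace H E h = (INF g\<in>{g. \<forall>x\<in>H. g x = h x}. E g g)"

definition replication ::
    "nat \<Rightarrow> (nat \<Rightarrow> 'a \<Rightarrow> 'a) \<Rightarrow> (nat \<Rightarrow> real) \<Rightarrow> 'a form \<Rightarrow> 'a form" where
  "replication N \<psi> r E f g = (\<Sum>i=1..N. inverse (r i) * E (f \<circ> \<psi> i) (g \<circ> \<psi> i))"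

definition renormalization ::
    "'a set \<Rightarrow> nat \<Rightarrow> (nat \<Rightarrow> 'a \<Rightarrow> 'a) \<Rightarrow> (nat \<Rightarrow> real) \<Rightarrow> 'a form \<Rightarrow> ('a \<Rightarrow> real) \<Rightarrow> real" where
  "renormalization F N \<psi> r E = form_trace (vertices F N \<psi> 0) (replication N \<psi> r E)"

text \<open>The resistance on \<open>X\<close> is extended-valued: it is \<open>\<infinity>\<close> if the infimum is 0, and 0 if no
  admissible function exists.  It is set to 0 off \<open>X\<close>.\<close>

definition resistance :: "'a set \<Rightarrow> 'a form \<Rightarrow> ('a \<Rightarrow> real) set \<Rightarrow> 'a \<Rightarrow> 'a \<Rightarrow> ennreal" where
  "resistance X E D x y =
     (if x \<in> X \<and> y \<in> X \<and> x \<noteq> y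
      then inverse (INF g\<in>{g \<in> D. g x = 0 \<and> g y = 1}. ennreal (E g g))
      else 0)"

definition resistance_dist :: "'a set \<Rightarrow> 'a form \<Rightarrow> ('a \<Rightarrow> real) set \<Rightarrow> 'a \<Rightarrow> 'a \<Rightarrow> real" where
  "resistance_dist X E D x y = enn2real (resistance X E D x y)"

definition has_resistance_metric :: "'a set \<Rightarrow> 'a form \<Rightarrow> ('a \<Rightarrow> real) set \<Rightarrow> bool" where
  "has_resistance_metric X E D \<longleftrightarrow>
     (\<forall>x\<in>X. \<forall>y\<in>X. resistance X E D x y < \<infinity>) \<and> Metric_space X (resistance_dist X E D)"


section \<open>One-parameter iterable families\<close>

text \<open>The 1-edges and the \<open>v\<close>-edges are given as symmetric relations \<open>A\<close> and \<open>B\<close>.\<close>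

definition family_conductance :: "('a \<times> 'a) set \<Rightarrow> ('a \<times> 'a) set \<Rightarrow> real \<Rightarrow> 'a \<Rightarrow> 'a \<Rightarrow> real" where
  "family_conductance A B v x y = (if (x, y) \<in> B then v else if (x, y) \<in> A then 1 else 0)"

definition family_form ::
    "'a set \<Rightarrow> nat \<Rightarrow> (nat \<Rightarrow> 'a \<Rightarrow> 'a) \<Rightarrow> ('a \<times> 'a) set \<Rightarrow> ('a \<times> 'a) set \<Rightarrow> real \<Rightarrow> 'a form" where
  "family_form F N \<psi> A B v = finite_form (vertices F N \<psi> 0) (family_conductance A B v)"

definition one_parameter_family ::
    "'a set \<Rightarrow> nat \<Rightarrow> (nat \<Rightarrow> 'a \<Rightarrow> 'a) \<Rightarrow> (nat \<Rightarrow> real) \<Rightarrow> ('a \<times> 'a) set \<Rightarrow> ('a \<times> 'a) set \<Rightarrow>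
     (real \<Rightarrow> real) \<Rightarrow> (real \<Rightarrow> real) \<Rightarrow> bool" where
  "one_parameter_family F N \<psi> r A B \<rho> \<alpha> \<longleftrightarrow>
     A \<subseteq> vertices F N \<psi> 0 \<times> vertices F N \<psi> 0 - Id \<and> sym A \<and>
     B \<subseteq> vertices F N \<psi> 0 \<times> vertices F N \<psi> 0 - Id \<and> sym B \<and>
     A \<inter> B = {} \<and> B \<noteq> {} \<and>
     (\<forall>v>0. irreducible_conductances (vertices F N \<psi> 0) (family_conductance A B v)) \<and>
     (\<forall>v>0. \<rho> v > 0 \<and> \<alpha> v > 0 \<and>
        (\<forall>h. renormalization F N \<psi> r (family_form F N \<psi> A B v) h =
             inverse (\<rho> v) * family_form F N \<psi> A B (\<alpha> v) h h))"

definition rational_on_positives :: "(real \<Rightarrow> real) \<Rightarrow> bool" where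
  "rational_on_positives f \<longleftrightarrow>
     (\<exists>p q :: real poly. \<forall>v>0. poly q v \<noteq> 0 \<and> f v = poly p v / poly q v)"

definition max_weight :: "nat \<Rightarrow> (nat \<Rightarrow> real) \<Rightarrow> real" where
  "max_weight N r = Max (r ` {1..N})"

definition iterable_family ::
    "'a set \<Rightarrow> nat \<Rightarrow> (nat \<Rightarrow> 'a \<Rightarrow> 'a) \<Rightarrow> (nat \<Rightarrow> real) \<Rightarrow> ('a \<times> 'a) set \<Rightarrow> ('a \<times> 'a) set \<Rightarrow>
     (real \<Rightarrow> real) \<Rightarrow> (real \<Rightarrow> real) \<Rightarrow> bool" where
  "iterable_family F N \<psi> r A B \<rho> \<alpha> \<longleftrightarrow>
     one_parameter_family F N \<psi> r A B \<rho> \<alpha> \<and>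
     rational_on_positives \<rho> \<and> rational_on_positives \<alpha> \<and>
     (\<exists>u\<ge>0. bdd_above ((\<lambda>v. inverse (\<rho> v)) ` {u<..}) \<and>
        max_weight N r * (SUP v\<in>{u<..}. inverse (\<rho> v)) < 1) \<and>
     (INF v\<in>{0<..}. SUP x\<in>vertices F N \<psi> 0. SUP y\<in>vertices F N \<psi> 0.
        resistance (vertices F N \<psi> 0) (family_form F N \<psi> A B v) UNIV x y) > 0 \<and>
     filterlim \<alpha> at_top at_top \<and>
     (\<exists>\<beta>>1. ((\<lambda>v. \<alpha> v / v) \<longlongrightarrow> 1 / \<beta>) at_top)"

definition v_min :: "nat \<Rightarrow> (nat \<Rightarrow> real) \<Rightarrow> (real \<Rightarrow> real) \<Rightarrow> (real \<Rightarrow> real) \<Rightarrow> real" where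
  "v_min N r \<rho> \<alpha> =
     Max ({v. v > 0 \<and> deriv \<alpha> v = 0} \<union> {v. v > 0 \<and> \<alpha> v = v} \<union>
          {v. v > 0 \<and> \<rho> v = max_weight N r} \<union> {0})"


section \<open>Limiting forms\<close>

definition alpha_inv :: "nat \<Rightarrow> (nat \<Rightarrow> real) \<Rightarrow> (real \<Rightarrow> real) \<Rightarrow> (real \<Rightarrow> real) \<Rightarrow> real \<Rightarrow> real" where
  "alpha_inv N r \<rho> \<alpha> = the_inv_into {v_min N r \<rho> \<alpha><..} \<alpha>"

definition rho_prod ::
    "nat \<Rightarrow> (nat \<Rightarrow> real) \<Rightarrow> (real \<Rightarrow> real) \<Rightarrow> (real \<Rightarrow> real) \<Rightarrow> nat \<Rightarrow> real \<Rightarrow> real" where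
  "rho_prod N r \<rho> \<alpha> n v = (\<Prod>i=1..n. \<rho> ((alpha_inv N r \<rho> \<alpha> ^^ i) v))"

definition level_form ::
    "'a set \<Rightarrow> nat \<Rightarrow> (nat \<Rightarrow> 'a \<Rightarrow> 'a) \<Rightarrow> (nat \<Rightarrow> real) \<Rightarrow> ('a \<times> 'a) set \<Rightarrow> ('a \<times> 'a) set \<Rightarrow>
     (real \<Rightarrow> real) \<Rightarrow> (real \<Rightarrow> real) \<Rightarrow> real \<Rightarrow> nat \<Rightarrow> 'a form" where
  "level_form F N \<psi> r A B \<rho> \<alpha> v n f g =
     rho_prod N r \<rho> \<alpha> n v *
     (replication N \<psi> r ^^ n) (family_form F N \<psi> A B ((alpha_inv N r \<rho> \<alpha> ^^ n) v)) f g"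

definition limit_domain ::
    "'a::metric_space set \<Rightarrow> nat \<Rightarrow> (nat \<Rightarrow> 'a \<Rightarrow> 'a) \<Rightarrow> (nat \<Rightarrow> real) \<Rightarrow> ('a \<times> 'a) set \<Rightarrow>
     ('a \<times> 'a) set \<Rightarrow> (real \<Rightarrow> real) \<Rightarrow> (real \<Rightarrow> real) \<Rightarrow> real \<Rightarrow> ('a \<Rightarrow> real) set" where
  "limit_domain F N \<psi> r A B \<rho> \<alpha> v =
     {f. continuous_on F f \<and> bdd_above (range (\<lambda>n. level_form F N \<psi> r A B \<rho> \<alpha> v n f f))}"

definition limit_energy ::
    "'a set \<Rightarrow> nat \<Rightarrow> (nat \<Rightarrow> 'a \<Rightarrow> 'a) \<Rightarrow> (nat \<Rightarrow> real) \<Rightarrow> ('a \<times> 'a) set \<Rightarrow> ('a \<times> 'a) set \<Rightarrow>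
     (real \<Rightarrow> real) \<Rightarrow> (real \<Rightarrow> real) \<Rightarrow> real \<Rightarrow> ('a \<Rightarrow> real) \<Rightarrow> real" where
  "limit_energy F N \<psi> r A B \<rho> \<alpha> v f = (SUP n. level_form F N \<psi> r A B \<rho> \<alpha> v n f f)"

definition limit_form ::
    "'a set \<Rightarrow> nat \<Rightarrow> (nat \<Rightarrow> 'a \<Rightarrow> 'a) \<Rightarrow> (nat \<Rightarrow> real) \<Rightarrow> ('a \<times> 'a) set \<Rightarrow> ('a \<times> 'a) set \<Rightarrow>
     (real \<Rightarrow> real) \<Rightarrow> (real \<Rightarrow> real) \<Rightarrow> real \<Rightarrow> 'a form" where
  "limit_form F N \<psi> r A B \<rho> \<alpha> v f g =
     (limit_energy F N \<psi> r A B \<rho> \<alpha> v (\<lambda>x. f x + g x) -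
      limit_energy F N \<psi> r A B \<rho> \<alpha> v (\<lambda>x. f x - g x)) / 4"


section \<open>Dirichlet forms\<close>

definition L2 :: "'a measure \<Rightarrow> ('a \<Rightarrow> real) set" where
  "L2 M = {f \<in> borel_measurable M. integrable M (\<lambda>x. (f x)\<^sup>2)}"

definition form_one :: "'a measure \<Rightarrow> 'a form \<Rightarrow> 'a form" where
  "form_one M E f g = E f g + (\<integral>x. f x * g x \<partial>M)"

text \<open>Elements of \<open>L\<^sup>2\<close> are classes of functions modulo equality almost everywhere.  The domain
  is given as a linear space \<open>D\<close> of representatives, and the form must not depend on the choice of
  representatives in \<open>D\<close>; membership of a class in the domain reads: some function in \<open>D\<close> is
  almost everywhere equal to it.  The clauses are, in order: \<open>D\<close> is a linear subspace
  of \<open>L\<^sup>2\<close>; \<open>E\<close> is well defined on classes; \<open>E\<close> is a nonnegative symmetric bilinear form;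
  \<open>D\<close> is dense in \<open>L\<^sup>2\<close>; \<open>E\<close> is closed; the unit contraction operates on \<open>E\<close>.\<close>

definition dirichlet_form :: "'a measure \<Rightarrow> 'a form \<Rightarrow> ('a \<Rightarrow> real) set \<Rightarrow> bool" where
  "dirichlet_form M E D \<longleftrightarrow>
     D \<subseteq> L2 M \<and> (\<lambda>_. 0) \<in> D \<and>
     (\<forall>f\<in>D. \<forall>g\<in>D. (\<lambda>x. f x + g x) \<in> D) \<and> (\<forall>c. \<forall>f\<in>D. (\<lambda>x. c * f x) \<in> D) \<and>
     (\<forall>f\<in>D. \<forall>g\<in>D. \<forall>h\<in>D. (AE x in M. f x = g x) \<longrightarrow> E f h = E g h) \<and>
     (\<forall>f\<in>D. \<forall>g\<in>D. E f g = E g f) \<and> (\<forall>f\<in>D. 0 \<le> E f f) \<and>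
     (\<forall>f\<in>D. \<forall>g\<in>D. \<forall>h\<in>D. E (\<lambda>x. f x + g x) h = E f h + E g h) \<and>
     (\<forall>c. \<forall>f\<in>D. \<forall>h\<in>D. E (\<lambda>x. c * f x) h = c * E f h) \<and>
     (\<forall>u\<in>L2 M. \<forall>\<epsilon>>0. \<exists>f\<in>D. (\<integral>x. (u x - f x)\<^sup>2 \<partial>M) < \<epsilon>) \<and>
     (\<forall>u. (\<forall>n. u n \<in> D) \<and>
        (\<forall>\<epsilon>>0. \<exists>n0. \<forall>m\<ge>n0. \<forall>n\<ge>n0.
           form_one M E (\<lambda>x. u m x - u n x) (\<lambda>x. u m x - u n x) < \<epsilon>) \<longrightarrow>
        (\<exists>f\<in>D. (\<lambda>n. form_one M E (\<lambda>x. u n x - f x) (\<lambda>x. u n x - f x)) \<longlonglongrightarrow> 0)) \<and>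
     (\<forall>f\<in>D. \<exists>g\<in>D. (AE x in M. g x = min (max (f x) 0) 1) \<and> E g g \<le> E f f)"

text \<open>The state space is \<open>space M\<close> with its subspace topology.\<close>

definition full_support :: "'a::metric_space measure \<Rightarrow> bool" where
  "full_support M \<longleftrightarrow> (\<forall>U. open U \<and> U \<inter> space M \<noteq> {} \<longrightarrow> emeasure M (U \<inter> space M) > 0)"

definition compactly_supported :: "'a::metric_space set \<Rightarrow> ('a \<Rightarrow> real) set" where
  "compactly_supported X =
     {f. continuous_on X f \<and> (\<exists>K\<subseteq>X. compact K \<and> (\<forall>x\<in>X - K. f x = 0))}"

definition is_core ::
    "'a::metric_space measure \<Rightarrow> 'a form \<Rightarrow> ('a \<Rightarrow> real) set \<Rightarrow> ('a \<Rightarrow> real) set \<Rightarrow> bool" where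
  "is_core M E D C \<longleftrightarrow>
     C \<subseteq> D \<inter> compactly_supported (space M) \<and>
     (\<forall>f\<in>D. \<forall>\<epsilon>>0. \<exists>g\<in>C. form_one M E (\<lambda>x. f x - g x) (\<lambda>x. f x - g x) < \<epsilon>) \<and>
     (\<forall>h\<in>compactly_supported (space M). \<forall>\<epsilon>>0. \<exists>g\<in>C. \<forall>x\<in>space M. \<bar>h x - g x\<bar> < \<epsilon>)"

text \<open>Full support of the reference measure is the usual standing assumption in the theory of
  regular Dirichlet forms; it makes continuous representatives unique.\<close>

definition regular_dirichlet_form ::
    "'a::metric_space measure \<Rightarrow> 'a form \<Rightarrow> ('a \<Rightarrow> real) set \<Rightarrow> bool" where
  "regular_dirichlet_form M E D \<longleftrightarrow>
     dirichlet_form M E D \<and> full_support M \<and> (\<exists>C. is_core M E D C)"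

text \<open>The support of (the class of) \<open>f\<close> is the support of the measure with density \<open>\<bar>f\<bar>\<close>.\<close>

definition ae_support :: "'a::metric_space measure \<Rightarrow> ('a \<Rightarrow> real) \<Rightarrow> 'a set" where
  "ae_support M f =
     {x \<in> space M. \<forall>U. open U \<and> x \<in> U \<longrightarrow> \<not> (AE y in M. y \<in> U \<longrightarrow> f y = 0)}"

definition local_form :: "'a::metric_space measure \<Rightarrow> 'a form \<Rightarrow> ('a \<Rightarrow> real) set \<Rightarrow> bool" where
  "local_form M E D \<longleftrightarrow>
     (\<forall>f\<in>D. \<forall>g\<in>D. compact (ae_support M f) \<and> compact (ae_support M g) \<and>
        ae_support M f \<inter> ae_support M g = {} \<longrightarrow> E f g = 0)"

text \<open>As for finite networks, an irreducible form is conservative and annihilates only constants.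
  The lemma below shows that such a form has no nontrivial invariant sets.\<close>

definition irreducible_form :: "'a measure \<Rightarrow> 'a form \<Rightarrow> ('a \<Rightarrow> real) set \<Rightarrow> bool" where
  "irreducible_form M E D \<longleftrightarrow>
     (\<exists>e\<in>D. (AE x in M. e x = 1) \<and> E e e = 0) \<and>
     (\<forall>f\<in>D. E f f = 0 \<longrightarrow> (\<exists>c. AE x in M. f x = c))"

definition invariant_set :: "'a measure \<Rightarrow> 'a form \<Rightarrow> ('a \<Rightarrow> real) set \<Rightarrow> 'a set \<Rightarrow> bool" where
  "invariant_set M E D S \<longleftrightarrow>
     S \<in> sets M \<and>
     (\<forall>f\<in>D. \<exists>f'\<in>D. AE x in M. f' x = indicator S x * f x) \<and>
     (\<forall>f\<in>D. \<forall>g\<in>D. \<forall>f'\<in>D. \<forall>g'\<in>D.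
        (AE x in M. f' x = indicator S x * f x) \<and> (AE x in M. g' x = indicator S x * g x) \<longrightarrow>
        E f g = E f' g' + E (\<lambda>x. f x - f' x) (\<lambda>x. g x - g' x))"

lemma irreducible_form_invariant_set:
  assumes dir: "dirichlet_form M E D" and irr: "irreducible_form M E D"
    and inv: "invariant_set M E D S"
  shows "emeasure M S = 0 \<or> emeasure M (space M - S) = 0"
proof -
  obtain e where e: "e \<in> D" "AE x in M. e x = 1" "E e e = 0"
    using irr unfolding irreducible_form_def by blast
  have S: "S \<in> sets M" using inv unfolding invariant_set_def by blast
  obtain f where f: "f \<in> D" "AE x in M. f x = indicator S x * e x"
    using inv e(1) unfolding invariant_set_def by blast
  have nonneg: "\<forall>g\<in>D. 0 \<le> E g g"
    using dir unfolding dirichlet_form_def by (elim conjE)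
  have add: "\<forall>g\<in>D. \<forall>h\<in>D. (\<lambda>x. g x + h x) \<in> D"
    using dir unfolding dirichlet_form_def by (elim conjE)
  have scale: "\<forall>c. \<forall>g\<in>D. (\<lambda>x. c * g x) \<in> D"
    using dir unfolding dirichlet_form_def by (elim conjE)
  have "(\<lambda>x. (-1) * f x) \<in> D" using scale f(1) by blast
  from bspec[OF bspec[OF add e(1)] this]
  have "(\<lambda>x. e x - f x) \<in> D" by simp
  then have "0 \<le> E (\<lambda>x. e x - f x) (\<lambda>x. e x - f x)" using nonneg by blast
  moreover have "E e e = E f f + E (\<lambda>x. e x - f x) (\<lambda>x. e x - f x)"
    using inv e(1) f unfolding invariant_set_def by blast
  ultimately have "E f f = 0" using bspec[OF nonneg f(1)] e(3) by linarith
  then obtain c where c: "AE x in M. f x = c"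
    using irr f(1) unfolding irreducible_form_def by blast
  have ind: "AE x in M. indicator S x = c"
    using c f(2) e(2) by eventually_elim auto
  show ?thesis
  proof (cases "c = 1")
    case True
    have "AE x in M. x \<notin> space M - S"
      using ind by eventually_elim (use True in \<open>auto simp: indicator_def split: if_splits\<close>)
    then have "space M - S \<in> null_sets M" using S by (simp add: AE_iff_null_sets)
    then show ?thesis by auto
  next
    case False
    have "AE x in M. x \<notin> S"
      using ind by eventually_elim (use False in \<open>auto simp: indicator_def split: if_splits\<close>)
    then have "S \<in> null_sets M" using S by (simp add: AE_iff_null_sets)
    then show ?thesis by auto
  qed
qed

end

theory Submission
  imports Defs
begin

text \<open>Why the limit form is a resistance form for the given topology.

  The level forms increase with the level, because the renormalization equation makes each of them the
  trace of the next one.  Hence the limit form is the limit of the bilinear level forms and inherits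
  bilinearity, positivity and the contraction property from finite networks.  Two quantitative facts
  carry the rest.

  The first is an oscillation bound.  On a half-line beyond \<open>v_min\<close> the factors \<open>r i / \<rho> w\<close> are
  bounded by a constant smaller than 1 (\<open>uniform_contraction\<close>), so the energy of a function controls its oscillation on a
  cell of length \<open>n\<close> with a factor that decays geometrically in \<open>n\<close>; going from a base point down
  through the cells gives a geometric series (\<open>oscillation\<close>, \<open>cell_oscillation\<close>).  Conductances do
  not decrease with the parameter and the inverse of \<open>\<alpha>\<close> increases parameters, so all constants can be
  chosen uniformly for the parameters that occur at the different levels.  Since distinct cells of equal
  length meet only in vertices, functions of bounded energy are equicontinuous (\<open>modulus\<close>).

  The second is harmonic extension.  Truncation decreases energy, so the infimum in the trace is
  attained by a function whose values lie between the extreme boundary values (\<open>trace_minimizer\<close>).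
  Applied in all cells and iterated, this extends any function on the vertices of level \<open>n\<close> to all
  vertices without increasing its energy and with a maximum principle on every \<open>n\<close>-cell
  (\<open>harmonic_extension\<close>).  By equicontinuity the extension is continuous, and therefore the domain is
  uniformly dense in the continuous functions (\<open>limit_dense\<close>).

  The rest no longer refers to the self-similar structure.  Density gives regularity
  and density in the space of square integrable functions.  The oscillation bound makes Cauchy
  sequences for the form norm uniformly convergent, hence the form closed, and shows that functions of
  energy 0 are constant.  Edges become short, which gives locality.  The resistance is finite and
  positive; it satisfies the triangle inequality because cutting a function at a height splits its
  energy (\<open>R_triangle\<close>).  It is small at small distances by equicontinuity, and bounded below away from
  the diagonal because the domain separates points from closed sets, so it induces the given
  topology.\<close>

section \<open>Forms on finite sets\<close>

lemma finite_form_cong: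
  assumes "\<And>x. x \<in> V \<Longrightarrow> f x = f' x" "\<And>x. x \<in> V \<Longrightarrow> g x = g' x"
  shows "finite_form V a f g = finite_form V a f' g'"
  unfolding finite_form_def using assms by (simp cong: sum.cong)

lemma finite_form_commute: "finite_form V a f g = finite_form V a g f"
  unfolding finite_form_def by (simp add: ac_simps)

lemma finite_form_add: "finite_form V a (\<lambda>x. f x + g x) h = finite_form V a f h + finite_form V a g h"
  unfolding finite_form_def by (simp add: algebra_simps sum.distrib sum_subtractf)

lemma finite_form_scale: "finite_form V a (\<lambda>x. c * f x) h = c * finite_form V a f h"
  unfolding finite_form_def by (simp add: algebra_simps sum_distrib_left sum_subtractf)

lemma finite_form_nonneg:
  assumes "\<And>x y. 0 \<le> a x y" shows "0 \<le> finite_form V a f f"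
  unfolding finite_form_def
  unfolding mult.assoc
  by (intro mult_nonneg_nonneg[of "1/2"] sum_nonneg mult_nonneg_nonneg[OF assms zero_le_square]) simp

text \<open>Normal contractions decrease the energy edge by edge.\<close>

lemma finite_form_contraction:
  assumes a: "\<And>x y. 0 \<le> a x y"
    and "\<And>x y. x \<in> V \<Longrightarrow> y \<in> V \<Longrightarrow> \<bar>g x - g y\<bar> \<le> \<bar>f x - f y\<bar>"
  shows "finite_form V a g g \<le> finite_form V a f f"
proof -
  have "a x y * (g x - g y) * (g x - g y) \<le> a x y * (f x - f y) * (f x - f y)"
    if "x \<in> V" "y \<in> V" for x y
  proof -
    have "(g x - g y) * (g x - g y) \<le> (f x - f y) * (f x - f y)"
      using power_mono[OF assms(2)[OF that], of 2] by (simp add: power2_eq_square)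
    then show ?thesis using a[of x y] by (simp add: mult.assoc mult_left_mono)
  qed
  then show ?thesis unfolding finite_form_def by (intro mult_left_mono sum_mono) auto
qed

text \<open>Cutting a function at a height \<open>t\<close> splits every increment into two parts of equal sign, so
  that the mixed energy of the two parts is nonnegative.\<close>

lemma finite_form_cut:
  assumes a: "\<And>x y. 0 \<le> a x y"
  shows "finite_form V a (\<lambda>x. min (f x) t) (\<lambda>x. min (f x) t) +
    finite_form V a (\<lambda>x. max (f x) t) (\<lambda>x. max (f x) t) \<le> finite_form V a f f"
proof -
  have *: "(min p t - min q t)\<^sup>2 + (max p t - max q t)\<^sup>2 \<le> (p - q)\<^sup>2" for p q :: real
  proof -
    define d e where "d = min p t - min q t" and "e = max p t - max q t"
    have "0 \<le> d * e" unfolding d_def e_def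
      by (cases p q rule: linorder_cases)
        (auto simp: min_def max_def mult_nonneg_nonneg mult_nonpos_nonpos)
    moreover have "p - q = d + e"
      by (auto simp: d_def e_def min_def max_def)
    ultimately show ?thesis unfolding d_def[symmetric] e_def[symmetric] by (simp add: power2_sum)
  qed
  have "a x y * (min (f x) t - min (f y) t) * (min (f x) t - min (f y) t) +
      a x y * (max (f x) t - max (f y) t) * (max (f x) t - max (f y) t)
      \<le> a x y * (f x - f y) * (f x - f y)" for x y
    using mult_left_mono[OF *[of "f x" "f y"] a[of x y]]
    by (simp add: power2_eq_square algebra_simps)
  then show ?thesis unfolding finite_form_def distrib_left[symmetric] sum.distrib[symmetric]
    by (intro mult_left_mono sum_mono) auto
qed

lemma finite_form_parallelogram:
  "finite_form V a (\<lambda>x. f x + g x) (\<lambda>x. f x + g x) + finite_form V a (\<lambda>x. f x - g x) (\<lambda>x. f x - g x)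
    = 2 * finite_form V a f f + 2 * finite_form V a g g"
  unfolding finite_form_def
  by (simp add: algebra_simps sum.distrib sum_subtractf sum_distrib_left)

lemma finite_form_polarization:
  "finite_form V a f g =
    (finite_form V a (\<lambda>x. f x + g x) (\<lambda>x. f x + g x)
     - finite_form V a (\<lambda>x. f x - g x) (\<lambda>x. f x - g x)) / 4"
  unfolding finite_form_def
  by (simp add: algebra_simps sum.distrib sum_subtractf sum_distrib_left)

lemma finite_form_tendsto:
  assumes "\<And>x. x \<in> V \<Longrightarrow> (\<lambda>k. f k x) \<longlonglongrightarrow> g x"
  shows "(\<lambda>k. finite_form V a (f k) (f k)) \<longlonglongrightarrow> finite_form V a g g"
  unfolding finite_form_def by (intro tendsto_intros assms)

section \<open>Limits of nested forms\<close>

text \<open>The finite forms are given by their conductances.  Compatibility under traces enters only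
  through its consequence that the energy of a fixed function increases with the level.\<close>

locale nested_forms =
  fixes F :: "'a::metric_space set" and V :: "nat \<Rightarrow> 'a set" and b :: "nat \<Rightarrow> 'a \<Rightarrow> 'a \<Rightarrow> real"
  assumes compact_F: "compact F" and V_sub: "V n \<subseteq> F"
    and b_nonneg: "0 \<le> b n x y"
    and energy_Suc: "finite_form (V n) (b n) f f \<le> finite_form (V (Suc n)) (b (Suc n)) f f"
begin

definition Q :: "nat \<Rightarrow> 'a form" where "Q n = finite_form (V n) (b n)"

definition dom :: "('a \<Rightarrow> real) set" where
  "dom = {f. continuous_on F f \<and> bdd_above (range (\<lambda>n. Q n f f))}"

definition energy :: "('a \<Rightarrow> real) \<Rightarrow> real" where "energy f = (SUP n. Q n f f)"

definition lim_form :: "'a form" where "lim_form f g = (energy (\<lambda>x. f x + g x) - energy (\<lambda>x. f x - g x)) / 4"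

lemma Q_nonneg: "0 \<le> Q n f f"
  unfolding Q_def by (rule finite_form_nonneg[OF b_nonneg])

lemma incseq_Q: "incseq (\<lambda>n. Q n f f)"
  unfolding Q_def by (intro incseq_SucI energy_Suc)

lemma dom_continuous: "f \<in> dom \<Longrightarrow> continuous_on F f" by (simp add: dom_def)

lemma Q_le_energy: "f \<in> dom \<Longrightarrow> Q n f f \<le> energy f"
  unfolding energy_def by (rule cSUP_upper) (auto simp: dom_def)

lemma energy_le: "(\<And>n. Q n f f \<le> c) \<Longrightarrow> energy f \<le> c"
  unfolding energy_def by (rule cSUP_least) auto

lemma domI: "continuous_on F f \<Longrightarrow> (\<And>n. Q n f f \<le> c) \<Longrightarrow> f \<in> dom"
  unfolding dom_def by (auto intro!: bdd_aboveI)

lemma energy_nonneg: "f \<in> dom \<Longrightarrow> 0 \<le> energy f"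
  using Q_le_energy[of f 0] Q_nonneg[of 0 f] by linarith

lemma Q_tendsto_energy: "f \<in> dom \<Longrightarrow> (\<lambda>n. Q n f f) \<longlonglongrightarrow> energy f"
  unfolding energy_def by (rule LIMSEQ_incseq_SUP[OF _ incseq_Q]) (simp add: dom_def)

lemma dom_scale: assumes "f \<in> dom" shows "(\<lambda>x. c * f x) \<in> dom"
proof (rule domI)
  show "continuous_on F (\<lambda>x. c * f x)" using dom_continuous[OF assms] by (intro continuous_intros)
  fix n
  have "Q n (\<lambda>x. c * f x) (\<lambda>x. c * f x) = c * c * Q n f f"
    unfolding Q_def
    by (subst finite_form_scale, subst finite_form_commute, subst finite_form_scale) simp
  also have "\<dots> \<le> c * c * energy f" using Q_le_energy[OF assms] by (intro mult_left_mono) auto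
  finally show "Q n (\<lambda>x. c * f x) (\<lambda>x. c * f x) \<le> c * c * energy f" .
qed

text \<open>By the parallelogram identity, the energy of a sum is at most twice the sum of the energies.\<close>

lemma dom_add: assumes "f \<in> dom" "g \<in> dom" shows "(\<lambda>x. f x + g x) \<in> dom"
proof (rule domI)
  show "continuous_on F (\<lambda>x. f x + g x)"
    using dom_continuous assms by (intro continuous_intros) auto
  fix n
  have "Q n (\<lambda>x. f x + g x) (\<lambda>x. f x + g x) + Q n (\<lambda>x. f x - g x) (\<lambda>x. f x - g x)
      = 2 * Q n f f + 2 * Q n g g"
    unfolding Q_def by (rule finite_form_parallelogram)
  then show "Q n (\<lambda>x. f x + g x) (\<lambda>x. f x + g x) \<le> 2 * energy f + 2 * energy g"
    using Q_nonneg[of n "\<lambda>x. f x - g x"] Q_le_energy[OF assms(1), of n] Q_le_energy[OF assms(2), of n]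
    by linarith
qed

lemma dom_const: "(\<lambda>_. c) \<in> dom" and energy_const: "energy (\<lambda>_. c) = 0"
proof -
  have Q: "Q n (\<lambda>_. c) (\<lambda>_. c) = 0" for n unfolding Q_def finite_form_def by simp
  show "(\<lambda>_. c) \<in> dom" by (rule domI[where c=0]) (auto simp: Q)
  show "energy (\<lambda>_. c) = 0" unfolding energy_def by (simp add: Q)
qed

lemma dom_diff: assumes "f \<in> dom" "g \<in> dom" shows "(\<lambda>x. f x - g x) \<in> dom"
  using dom_add[OF assms(1) dom_scale[OF assms(2), of "-1"]] by simp

text \<open>On the domain the limit form is the limit of the bilinear forms \<open>Q n\<close>, from which it inherits
  its algebraic properties.\<close>

lemma Q_tendsto_lim_form: assumes "f \<in> dom" "g \<in> dom" shows "(\<lambda>n. Q n f g) \<longlonglongrightarrow> lim_form f g"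
proof -
  have "(\<lambda>n. (Q n (\<lambda>x. f x + g x) (\<lambda>x. f x + g x) - Q n (\<lambda>x. f x - g x) (\<lambda>x. f x - g x)) / 4)
      \<longlonglongrightarrow> lim_form f g"
    unfolding lim_form_def by (intro tendsto_intros Q_tendsto_energy dom_add dom_diff assms) simp
  then show ?thesis unfolding Q_def finite_form_polarization[symmetric] .
qed

lemma lim_form_diag: assumes "f \<in> dom" shows "lim_form f f = energy f"
  using LIMSEQ_unique[OF Q_tendsto_lim_form[OF assms assms] Q_tendsto_energy[OF assms]] .

lemma lim_form_commute: assumes "f \<in> dom" "g \<in> dom" shows "lim_form f g = lim_form g f"
  using LIMSEQ_unique[OF Q_tendsto_lim_form[OF assms]] Q_tendsto_lim_form[OF assms(2,1)]
  by (simp add: Q_def finite_form_commute)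

lemma lim_form_add: assumes "f \<in> dom" "g \<in> dom" "h \<in> dom"
  shows "lim_form (\<lambda>x. f x + g x) h = lim_form f h + lim_form g h"
proof (rule LIMSEQ_unique[OF Q_tendsto_lim_form])
  have "(\<lambda>n. Q n f h + Q n g h) \<longlonglongrightarrow> lim_form f h + lim_form g h" by (intro tendsto_intros Q_tendsto_lim_form assms)
  then show "(\<lambda>n. Q n (\<lambda>x. f x + g x) h) \<longlonglongrightarrow> lim_form f h + lim_form g h"
    by (simp add: Q_def finite_form_add)
qed (intro dom_add assms)+

lemma lim_form_scale: assumes "f \<in> dom" "h \<in> dom"
  shows "lim_form (\<lambda>x. c * f x) h = c * lim_form f h"
proof (rule LIMSEQ_unique[OF Q_tendsto_lim_form])
  have "(\<lambda>n. c * Q n f h) \<longlonglongrightarrow> c * lim_form f h" by (intro tendsto_intros Q_tendsto_lim_form assms)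
  then show "(\<lambda>n. Q n (\<lambda>x. c * f x) h) \<longlonglongrightarrow> c * lim_form f h"
    by (simp add: Q_def finite_form_scale)
qed (intro dom_scale assms)+

lemma energy_scale: assumes "f \<in> dom" shows "energy (\<lambda>x. c * f x) = c\<^sup>2 * energy f"
  using lim_form_scale[OF assms dom_scale[OF assms], of c c] lim_form_scale[OF assms assms, of c]
    lim_form_commute[OF assms dom_scale[OF assms], of c] lim_form_diag[OF assms] lim_form_diag[OF dom_scale[OF assms]]
  by (simp add: power2_eq_square)

lemma energy_cong: assumes "\<And>x. x \<in> F \<Longrightarrow> f x = g x" shows "energy f = energy g"
proof -
  have "Q n f f = Q n g g" for n
    unfolding Q_def by (rule finite_form_cong) (use assms V_sub[of n] in auto)
  then show ?thesis by (simp add: energy_def)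
qed

lemma energy_add_const: "energy (\<lambda>x. f x + c) = energy f"
  by (simp add: energy_def Q_def finite_form_def)

lemma dom_add_const: "f \<in> dom \<Longrightarrow> (\<lambda>x. f x + c) \<in> dom"
  using dom_add[OF _ dom_const] .

lemma contraction_dom:
  assumes "f \<in> dom" "continuous_on F g"
    and "\<And>x y. x \<in> F \<Longrightarrow> y \<in> F \<Longrightarrow> \<bar>g x - g y\<bar> \<le> \<bar>f x - f y\<bar>"
  shows "g \<in> dom" "energy g \<le> energy f"
proof -
  have "Q n g g \<le> energy f" for n
  proof -
    have "Q n g g \<le> Q n f f" unfolding Q_def
      by (rule finite_form_contraction[OF b_nonneg]) (use assms(3) V_sub[of n] in auto)
    with Q_le_energy[OF assms(1), of n] show ?thesis by linarith
  qed
  then show "g \<in> dom" "energy g \<le> energy f" using domI[OF assms(2)] energy_le by blast+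
qed

lemma min_dom: assumes "f \<in> dom" shows "(\<lambda>x. min (f x) t) \<in> dom"
proof (rule contraction_dom(1)[OF assms])
  show "continuous_on F (\<lambda>x. min (f x) t)"
    using dom_continuous[OF assms] by (intro continuous_intros)
qed (auto simp: min_def)

lemma max_dom: assumes "f \<in> dom" shows "(\<lambda>x. max (f x) t) \<in> dom"
proof (rule contraction_dom(1)[OF assms])
  show "continuous_on F (\<lambda>x. max (f x) t)"
    using dom_continuous[OF assms] by (intro continuous_intros)
qed (auto simp: max_def)

lemma energy_cut:
  assumes "f \<in> dom"
  shows "energy (\<lambda>x. min (f x) t) + energy (\<lambda>x. max (f x) t) \<le> energy f"
proof (rule LIMSEQ_le)
  show "(\<lambda>n. Q n (\<lambda>x. min (f x) t) (\<lambda>x. min (f x) t) +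
        Q n (\<lambda>x. max (f x) t) (\<lambda>x. max (f x) t))
      \<longlonglongrightarrow> energy (\<lambda>x. min (f x) t) + energy (\<lambda>x. max (f x) t)"
    by (rule tendsto_add[OF Q_tendsto_energy[OF min_dom[OF assms]] Q_tendsto_energy[OF max_dom[OF assms]]])
  show "(\<lambda>n. Q n f f) \<longlonglongrightarrow> energy f" by (rule Q_tendsto_energy[OF assms])
  show "\<exists>N. \<forall>n\<ge>N. Q n (\<lambda>x. min (f x) t) (\<lambda>x. min (f x) t)
      + Q n (\<lambda>x. max (f x) t) (\<lambda>x. max (f x) t) \<le> Q n f f"
    unfolding Q_def by (intro exI allI impI finite_form_cut b_nonneg)
qed

end

text \<open>Three analytic facts turn a limit of nested forms into a resistance form on the given compact
  space: a bound on resistances, smallness of resistances at small distances, and uniform density of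
  the domain.\<close>

locale resistance_limit = nested_forms +
  fixes K :: real
  assumes K_bound: "f \<in> dom \<Longrightarrow> x \<in> F \<Longrightarrow> y \<in> F \<Longrightarrow> (f x - f y)\<^sup>2 \<le> K * energy f"
    and equicontinuous: "0 < \<epsilon> \<Longrightarrow>
      \<exists>\<delta>>0. \<forall>x\<in>F. \<forall>y\<in>F. dist x y < \<delta> \<longrightarrow> (\<forall>f\<in>dom. (f x - f y)\<^sup>2 \<le> \<epsilon> * energy f)"
    and dense: "continuous_on F h \<Longrightarrow> 0 < \<epsilon> \<Longrightarrow> \<exists>g\<in>dom. \<forall>x\<in>F. \<bar>h x - g x\<bar> < \<epsilon>"
begin

subsection \<open>The resistance metric\<close>

text \<open>A uniform approximation from the domain to a cone with apex \<open>x\<close> does the separation.  The cone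
  has height 1, so an error below a quarter leaves differences above a half, and doubling the
  function normalizes them.\<close>

lemma separating_function:
  assumes "x \<in> F" "0 < \<epsilon>"
  shows "\<exists>f\<in>dom. \<forall>y\<in>F. \<epsilon> \<le> dist x y \<longrightarrow> 1 \<le> (f x - f y)\<^sup>2"
proof -
  have "continuous_on F (\<lambda>y. max 0 (1 - dist x y / \<epsilon>))"
    using assms by (intro continuous_intros) auto
  from dense[OF this, of "1/4"] obtain g where g: "g \<in> dom"
      "\<And>y. y \<in> F \<Longrightarrow> \<bar>max 0 (1 - dist x y / \<epsilon>) - g y\<bar> < 1/4" by auto
  have "1 \<le> (2 * g x - 2 * g y)\<^sup>2" if y: "y \<in> F" "\<epsilon> \<le> dist x y" for y
  proof -
    have "1 - dist x y / \<epsilon> \<le> 0" using y(2) assms(2) by (simp add: field_simps)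
    then have "g y < 1/4" using g(2)[OF y(1)] by auto
    moreover have "g x > 3/4" using g(2)[OF assms(1)] by (simp add: abs_if split: if_splits)
    ultimately have "1 \<le> 2 * g x - 2 * g y" by linarith
    from power_mono[OF this, of 2] show ?thesis by simp
  qed
  then show ?thesis by (intro bexI[OF _ dom_scale[OF g(1), of 2]]) auto
qed

abbreviation R :: "'a \<Rightarrow> 'a \<Rightarrow> real" where "R \<equiv> resistance_dist F lim_form dom"

text \<open>The resistance between \<open>x\<close> and \<open>y\<close> is the least constant in the inequality
  \<open>(f x - f y)\<^sup>2 \<le> R * energy f\<close>: affine rescaling turns any \<open>f\<close> with \<open>f x \<noteq> f y\<close> into a
  competitor for the infimum.\<close>

lemma resistance_characterization:
  assumes x: "x \<in> F" and y: "y \<in> F"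
  shows resistance_finite: "resistance F lim_form dom x y < \<infinity>"
    and resistance_bound: "f \<in> dom \<Longrightarrow> (f x - f y)\<^sup>2 \<le> R x y * energy f"
    and resistance_least: "\<lbrakk>0 \<le> S; \<And>f. f \<in> dom \<Longrightarrow> (f x - f y)\<^sup>2 \<le> S * energy f\<rbrakk> \<Longrightarrow> R x y \<le> S"
proof -
  have "resistance F lim_form dom x y < \<infinity> \<and> (\<forall>f\<in>dom. (f x - f y)\<^sup>2 \<le> R x y * energy f) \<and>
      (\<forall>S\<ge>0. (\<forall>f\<in>dom. (f x - f y)\<^sup>2 \<le> S * energy f) \<longrightarrow> R x y \<le> S)"
  proof (cases "x = y")
    case True
    then show ?thesis by (simp add: resistance_dist_def resistance_def)
  next
    case False
    define adm where "adm = {g \<in> dom. g x = 0 \<and> g y = 1}"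
    define I where "I = (INF g\<in>adm. ennreal (lim_form g g))"
    have I_le: "I \<le> ennreal (energy f / (f y - f x)\<^sup>2)" if f: "f \<in> dom" "f x \<noteq> f y" for f
    proof -
      let ?g = "\<lambda>z. (1 / (f y - f x)) * (f z + (- f x))"
      have d: "?g \<in> dom" by (intro dom_scale dom_add_const f)
      have "lim_form ?g ?g = energy f / (f y - f x)\<^sup>2"
        unfolding lim_form_diag[OF d] energy_scale[OF dom_add_const[OF f(1)]] energy_add_const
        by (simp add: power_divide)
      moreover have "?g \<in> adm" unfolding adm_def using d f(2) by auto
      ultimately show ?thesis unfolding I_def by (metis (mono_tags, lifting) INF_lower)
    qed
    have le_I: "ennreal (1 / S) \<le> I"
      if S: "0 \<le> S" "\<forall>f\<in>dom. (f x - f y)\<^sup>2 \<le> S * energy f" for S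
      unfolding I_def
    proof (rule INF_greatest)
      fix g assume "g \<in> adm"
      then have g: "g \<in> dom" "1 \<le> S * energy g" using S(2) unfolding adm_def by force+
      then have "0 < S" using S(1) by (cases "S = 0") auto
      then show "ennreal (1 / S) \<le> ennreal (lim_form g g)"
        unfolding lim_form_diag[OF g(1)] using g(2) by (intro ennreal_leI) (simp add: field_simps)
    qed
    obtain f where f: "f \<in> dom" "1 \<le> (f x - f y)\<^sup>2"
      using separating_function[OF x, of "dist x y"] False y by auto
    have fne: "f x \<noteq> f y" using f(2) by auto
    have "0 < K" 
    proof -
      have "1 \<le> K * energy f" using K_bound[OF f(1) x y] f(2) by linarith
      then show ?thesis using energy_nonneg[OF f(1)] by (smt (verit) mult_nonpos_nonneg)
    qed
    then have "ennreal (1 / K) \<le> I" "0 < ennreal (1/K)" using le_I[of K] K_bound x y by auto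
    then have I0: "0 < I" by (rule less_le_trans[rotated])
    have "I < \<infinity>" using I_le[OF f(1) fne] by (rule le_less_trans) simp
    with I0 obtain i where i: "I = ennreal i" "0 < i"
      by (cases I) (auto simp: top_ennreal_def[symmetric])
    have res: "resistance F lim_form dom x y = ennreal (1 / i)"
      using x y False i inverse_ennreal[of i]
      unfolding resistance_def I_def[symmetric] adm_def[symmetric]
      by (simp add: adm_def[symmetric] I_def[symmetric] inverse_eq_divide)
    have R: "R x y = 1 / i" unfolding resistance_dist_def res using i(2) by simp
    have "(f x - f y)\<^sup>2 \<le> R x y * energy f" if "f \<in> dom" for f
    proof (cases "f x = f y")
      case True then show ?thesis using R i(2) energy_nonneg[OF that] by simp
    next
      case False
      have "i \<le> energy f / (f y - f x)\<^sup>2"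
        using I_le[OF that False] i energy_nonneg[OF that] by (simp add: ennreal_le_iff)
      moreover have "0 < (f y - f x)\<^sup>2" using False by simp
      ultimately show ?thesis unfolding R using i(2)
        by (simp add: field_simps power2_commute)
    qed
    moreover have "R x y \<le> S" if S: "0 \<le> S" "\<forall>f\<in>dom. (f x - f y)\<^sup>2 \<le> S * energy f" for S
    proof -
      have "1 / S \<le> i" using le_I[OF S] i by (simp add: ennreal_le_iff)
      moreover have "S \<noteq> 0" using S(2) f by force
      ultimately show ?thesis unfolding R using i(2) S(1) by (simp add: field_simps)
    qed
    ultimately show ?thesis using res by auto
  qed
  then show "resistance F lim_form dom x y < \<infinity>"
    "f \<in> dom \<Longrightarrow> (f x - f y)\<^sup>2 \<le> R x y * energy f"
    "\<lbrakk>0 \<le> S; \<And>f. f \<in> dom \<Longrightarrow> (f x - f y)\<^sup>2 \<le> S * energy f\<rbrakk> \<Longrightarrow> R x y \<le> S" by blast+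
qed

lemma R_nonneg: "0 \<le> R x y" by (simp add: resistance_dist_def)

lemma R_refl: "R x x = 0" by (simp add: resistance_dist_def resistance_def)

lemma R_commute: assumes x: "x \<in> F" and y: "y \<in> F" shows "R x y = R y x"
proof -
  have "R x' y' \<le> R y' x'" if "x' \<in> F" "y' \<in> F" for x' y'
  proof (rule resistance_least[OF that R_nonneg])
    fix f assume "f \<in> dom"
    from resistance_bound[OF that(2,1) this]
    show "(f x' - f y')\<^sup>2 \<le> R y' x' * energy f" by (metis power2_commute)
  qed
  then show ?thesis using x y by (simp add: antisym)
qed

text \<open>Cutting \<open>f\<close> at the height \<open>f y\<close> gives one function that climbs from \<open>x\<close> to \<open>y\<close> and one that
  climbs from \<open>y\<close> to \<open>z\<close>, and their energies add up to at most that of \<open>f\<close>.\<close>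

lemma R_triangle:
  assumes x: "x \<in> F" and y: "y \<in> F" and z: "z \<in> F"
  shows "R x z \<le> R x y + R y z"
proof (rule resistance_least[OF x z])
  show "0 \<le> R x y + R y z" using R_nonneg by (simp add: add_nonneg_nonneg)
  have *: "(f x' - f z')\<^sup>2 \<le> (R x' y + R y z') * energy f"
    if f: "f \<in> dom" and le: "f x' \<le> f z'" and x': "x' \<in> F" and z': "z' \<in> F" for f x' z'
  proof -
    let ?t = "f y"
    have E: "0 \<le> energy f" by (rule energy_nonneg[OF f])
    consider "f y < f x'" | "f z' < f y" | "f x' \<le> f y" "f y \<le> f z'" by linarith
    then show ?thesis
    proof cases
      case 1
      then have "\<bar>f x' - f z'\<bar> \<le> \<bar>f y - f z'\<bar>" using le by linarith
      then have "(f x' - f z')\<^sup>2 \<le> (f y - f z')\<^sup>2" by (rule abs_le_square_iff[THEN iffD1])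
      also have "\<dots> \<le> R y z' * energy f" using resistance_bound y z' f by blast
      also have "\<dots> \<le> (R x' y + R y z') * energy f" using E R_nonneg by (intro mult_right_mono) auto
      finally show ?thesis .
    next
      case 2
      then have "\<bar>f x' - f z'\<bar> \<le> \<bar>f x' - f y\<bar>" using le by linarith
      then have "(f x' - f z')\<^sup>2 \<le> (f x' - f y)\<^sup>2" by (rule abs_le_square_iff[THEN iffD1])
      also have "\<dots> \<le> R x' y * energy f" using resistance_bound y x' f by blast
      also have "\<dots> \<le> (R x' y + R y z') * energy f" using E R_nonneg by (intro mult_right_mono) auto
      finally show ?thesis .
    next
      case 3
      define p q where "p = f y - f x'" and "q = f z' - f y"
      define e1 e2 where "e1 = energy (\<lambda>w. min (f w) ?t)" and "e2 = energy (\<lambda>w. max (f w) ?t)"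
      have p: "p\<^sup>2 \<le> R x' y * e1"
        using resistance_bound[OF x' y min_dom[OF f, of ?t]] 3
        by (simp add: p_def e1_def min_def power2_commute)
      have q: "q\<^sup>2 \<le> R y z' * e2"
        using resistance_bound[OF y z' max_dom[OF f, of ?t]] 3
        by (simp add: q_def e2_def max_def power2_commute)
      have e: "0 \<le> e1" "0 \<le> e2" "e1 + e2 \<le> energy f"
        using energy_nonneg min_dom max_dom f energy_cut[OF f, of ?t] by (auto simp: e1_def e2_def)
      have pq: "p * q \<le> (R x' y * e2 + R y z' * e1) / 2"
      proof -
        have "(p * q)\<^sup>2 \<le> (R x' y * e1) * (R y z' * e2)"
          unfolding power_mult_distrib by (rule mult_mono[OF p q]) (auto simp: R_nonneg e)
        also have "\<dots> = (R x' y * e2) * (R y z' * e1)" by simp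
        also have "\<dots> \<le> ((R x' y * e2 + R y z' * e1) / 2)\<^sup>2"
          using sum_squares_bound[of "R x' y * e2" "R y z' * e1"]
          by (simp add: power2_eq_square field_simps)
        finally show ?thesis by (rule power2_le_imp_le) (auto simp: R_nonneg e)
      qed
      have "(f x' - f z')\<^sup>2 = p\<^sup>2 + q\<^sup>2 + 2 * (p * q)"
        by (simp add: p_def q_def power2_eq_square algebra_simps)
      also have "\<dots> \<le> (R x' y + R y z') * (e1 + e2)"
        using p q pq by (simp add: algebra_simps)
      also have "\<dots> \<le> (R x' y + R y z') * energy f"
        using e(3) R_nonneg by (intro mult_left_mono) (auto simp: add_nonneg_nonneg)
      finally show ?thesis .
    qed
  qed
  show "(f x - f z)\<^sup>2 \<le> (R x y + R y z) * energy f" if f: "f \<in> dom" for f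
  proof (cases "f x \<le> f z")
    case True then show ?thesis using *[OF f _ x z] by blast
  next
    case False
    then show ?thesis using *[OF f _ z x] R_commute x y z
      by (simp add: power2_commute add.commute)
  qed
qed

text \<open>A function of finite energy that separates \<open>x\<close> from the complement of a ball bounds from below the
  resistance between \<open>x\<close> and that complement.\<close>

lemma R_small_imp_close:
  assumes "x \<in> F" "0 < \<epsilon>"
  shows "\<exists>\<eta>>0. \<forall>y\<in>F. R x y < \<eta> \<longrightarrow> dist x y < \<epsilon>"
proof -
  obtain f where f: "f \<in> dom" "\<And>y. y \<in> F \<Longrightarrow> \<epsilon> \<le> dist x y \<Longrightarrow> 1 \<le> (f x - f y)\<^sup>2"
    using separating_function[OF assms] by metis
  have E: "0 \<le> energy f" by (rule energy_nonneg[OF f(1)])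
  have "dist x y < \<epsilon>" if y: "y \<in> F" and R: "R x y < 1 / (energy f + 1)" for y
  proof (rule ccontr)
    assume "\<not> dist x y < \<epsilon>"
    then have "1 \<le> (f x - f y)\<^sup>2" using f(2) y by auto
    also have "\<dots> \<le> R x y * energy f" by (rule resistance_bound[OF assms(1) y f(1)])
    also have "\<dots> \<le> 1 / (energy f + 1) * energy f" using R E by (intro mult_right_mono) auto
    also have "\<dots> < 1" using E by (simp add: field_simps)
    finally show False by simp
  qed
  then show ?thesis using E by (intro exI[of _ "1 / (energy f + 1)"]) auto
qed

lemma close_imp_R_small:
  assumes "0 < \<epsilon>"
  shows "\<exists>\<delta>>0. \<forall>x\<in>F. \<forall>y\<in>F. dist x y < \<delta> \<longrightarrow> R x y < \<epsilon>"
proof -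
  obtain \<delta> where "0 < \<delta>" and
    \<delta>: "\<And>x y f. \<lbrakk>x\<in>F; y\<in>F; dist x y < \<delta>; f \<in> dom\<rbrakk> \<Longrightarrow> (f x - f y)\<^sup>2 \<le> \<epsilon>/2 * energy f"
    using equicontinuous[of "\<epsilon>/2"] assms by auto
  moreover have "R x y < \<epsilon>" if "x \<in> F" "y \<in> F" "dist x y < \<delta>" for x y
    using resistance_least[OF that(1,2), of "\<epsilon>/2"] \<delta>[OF that] assms by auto
  ultimately show ?thesis by blast
qed

lemma Metric_space_R: "Metric_space F R"
proof
  show "R x y = 0 \<longleftrightarrow> x = y" if "x \<in> F" "y \<in> F" for x y
  proof
    assume 0: "R x y = 0"
    show "x = y"
    proof (rule ccontr)
      assume "x \<noteq> y"
      then show False using R_small_imp_close[OF that(1), of "dist x y"] that 0 by auto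
    qed
  qed (simp add: R_refl)
  show "R x y = R y x" for x y
  proof (cases "x \<in> F \<and> y \<in> F")
    case True then show ?thesis using R_commute by blast
  next
    case False then show ?thesis by (auto simp: resistance_dist_def resistance_def)
  qed
qed (use R_nonneg R_triangle in auto)

lemma has_resistance_metric: "has_resistance_metric F lim_form dom"
  unfolding has_resistance_metric_def using Metric_space_R resistance_finite by blast

text \<open>Small resistance forces small distance and conversely, so the balls of the two metrics define
  the same neighbourhoods.\<close>

lemma resistance_topology: "Metric_space.mtopology F R = top_of_set F"
proof -
  interpret R: Metric_space F R by (rule Metric_space_R)
  show ?thesis unfolding topology_eq
  proof
    fix S
    have ball: "R.mball x r \<subseteq> S \<longleftrightarrow> (\<forall>y\<in>F. R x y < r \<longrightarrow> y \<in> S)" if "x \<in> F" for x r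
      using that unfolding R.mball_def by blast
    have "openin R.mtopology S \<longleftrightarrow>
        S \<subseteq> F \<and> (\<forall>x\<in>S. \<exists>r>0. \<forall>y\<in>F. R x y < r \<longrightarrow> y \<in> S)"
      unfolding R.openin_mtopology Ball_def[of S]
      by (intro conj_cong refl all_cong ex_cong1 imp_cong) (rule ball, blast)
    also have "\<dots> \<longleftrightarrow> S \<subseteq> F \<and> (\<forall>x\<in>S. \<exists>r>0. \<forall>y\<in>F. dist y x < r \<longrightarrow> y \<in> S)"
    proof (intro conj_cong refl ball_cong iffI)
      fix x assume S: "S \<subseteq> F" "x \<in> S"
      assume "\<exists>r>0. \<forall>y\<in>F. R x y < r \<longrightarrow> y \<in> S"
      then obtain r where r: "0 < r" "\<And>y. y \<in> F \<Longrightarrow> R x y < r \<Longrightarrow> y \<in> S" by blast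
      then show "\<exists>r>0. \<forall>y\<in>F. dist y x < r \<longrightarrow> y \<in> S"
        using close_imp_R_small[OF r(1)] S by (metis dist_commute in_mono)
    next
      fix x assume S: "S \<subseteq> F" "x \<in> S"
      assume "\<exists>r>0. \<forall>y\<in>F. dist y x < r \<longrightarrow> y \<in> S"
      then obtain r where r: "0 < r" "\<And>y. y \<in> F \<Longrightarrow> dist y x < r \<Longrightarrow> y \<in> S" by blast
      then show "\<exists>r>0. \<forall>y\<in>F. R x y < r \<longrightarrow> y \<in> S"
        using R_small_imp_close[OF _ r(1), of x] S by (metis dist_commute in_mono)
    qed
    also have "\<dots> \<longleftrightarrow> openin (top_of_set F) S" by (simp add: openin_euclidean_subtopology_iff)
    finally show "openin R.mtopology S = openin (top_of_set F) S" .
  qed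
qed

end

section \<open>The limit form as a Dirichlet form\<close>

text \<open>The distance to the closed set is continuous and positive on the compact set, hence attains a
  positive minimum.\<close>

lemma compact_closed_separated:
  fixes S T :: "'b::metric_space set"
  assumes "compact S" "closed T" "S \<inter> T = {}"
  shows "\<exists>d>0. \<forall>x\<in>S. \<forall>y\<in>T. d \<le> dist x y"
proof (cases "S = {} \<or> T = {}")
  case True
  then show ?thesis by (intro exI[of _ 1]) auto
next
  case False
  have "continuous_on S (\<lambda>x. infdist x T)" by (intro continuous_intros)
  then obtain a where a: "a \<in> S" "\<And>x. x \<in> S \<Longrightarrow> infdist a T \<le> infdist x T"
    using continuous_attains_inf[OF assms(1)] False by metis
  have "infdist a T \<noteq> 0" using in_closed_iff_infdist_zero[OF assms(2)] False a(1) assms(3) by auto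
  then have "0 < infdist a T" using infdist_nonneg[of a T] by linarith
  moreover have "infdist a T \<le> dist x y" if "x \<in> S" "y \<in> T" for x y
    using a(2)[OF that(1)] infdist_le[OF that(2), of x] by linarith
  ultimately show ?thesis by blast
qed

text \<open>The reference measure enters through full support, which identifies a continuous function with
  its class modulo equality almost everywhere.  Locality comes from edges that become short.\<close>

locale dirichlet_limit = resistance_limit +
  fixes \<mu> :: "'a measure"
  assumes sets_\<mu>: "sets \<mu> = sets (restrict_space borel F)"
    and prob_\<mu>: "prob_space \<mu>" and full_\<mu>: "full_support \<mu>"
    and short_edges: "0 < \<epsilon> \<Longrightarrow> \<exists>n0. \<forall>n\<ge>n0. \<forall>x y. b n x y \<noteq> 0 \<longrightarrow> dist x y < \<epsilon>"
begin

sublocale prob_space \<mu> by (rule prob_\<mu>)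

lemma space_\<mu>: "space \<mu> = F"
  using sets_eq_imp_space_eq[OF sets_\<mu>] by (simp add: space_restrict_space)

lemma continuous_measurable: "continuous_on F f \<Longrightarrow> (f :: 'a \<Rightarrow> real) \<in> borel_measurable \<mu>"
  unfolding measurable_cong_sets[OF sets_\<mu> refl] by (rule borel_measurable_continuous_on_restrict)

lemma continuous_integrable:
  assumes "continuous_on F (f :: 'a \<Rightarrow> real)" shows "integrable \<mu> f"
proof -
  obtain B where "\<forall>y\<in>f ` F. norm y \<le> B"
    using compact_imp_bounded[OF compact_continuous_image[OF assms compact_F]]
    unfolding bounded_iff by blast
  then show ?thesis
    by (intro integrable_const_bound[of f B] continuous_measurable assms AE_I2) (auto simp: space_\<mu>)
qed

lemma dom_L2: "dom \<subseteq> L2 \<mu>"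
  unfolding L2_def
  by (auto intro!: continuous_measurable continuous_integrable continuous_on_power dest: dom_continuous)

text \<open>The set where a continuous function differs from 0 is relatively open, and a nonempty relatively
  open set has positive measure.\<close>

lemma continuous_AE_zero:
  assumes f: "continuous_on F (f :: 'a \<Rightarrow> real)" and U: "open U"
    and ae: "AE y in \<mu>. y \<in> U \<longrightarrow> f y = 0" and x: "x \<in> U" "x \<in> F"
  shows "f x = 0"
proof (rule ccontr)
  assume "f x \<noteq> 0"
  have "openin (top_of_set F) (F \<inter> f -` (- {0}))"
    by (rule continuous_openin_preimage_gen[OF f]) auto
  then obtain W where W: "open W" "F \<inter> f -` (- {0}) = F \<inter> W" unfolding openin_open by blast
  have "x \<in> (U \<inter> W) \<inter> space \<mu>" using W(2) x \<open>f x \<noteq> 0\<close> by (auto simp: space_\<mu>)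
  then have "0 < emeasure \<mu> ((U \<inter> W) \<inter> space \<mu>)"
    using full_\<mu> U W(1) unfolding full_support_def by blast
  moreover have "AE y in \<mu>. y \<notin> (U \<inter> W) \<inter> space \<mu>"
    using ae by eventually_elim (use W(2) in \<open>auto simp: space_\<mu>\<close>)
  moreover have "(U \<inter> W) \<inter> space \<mu> \<in> sets \<mu>"
    unfolding sets_\<mu> sets_restrict_space space_\<mu> using U W(1) by (auto simp: Int_commute)
  ultimately show False by (simp add: AE_iff_null_sets null_setsD1)
qed

lemma continuous_AE_eq:
  assumes "continuous_on F (f :: 'a \<Rightarrow> real)" "continuous_on F g" "AE x in \<mu>. f x = g x" "x \<in> F"
  shows "f x = g x"
  using continuous_AE_zero[of "\<lambda>x. f x - g x" UNIV x] assms by (auto intro!: continuous_intros)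

subsection \<open>Density in the space of square integrable functions\<close>

lemma L2_add: assumes "u \<in> L2 \<mu>" "w \<in> L2 \<mu>" shows "(\<lambda>x. u x + w x) \<in> L2 \<mu>"
proof -
  have [measurable]: "u \<in> borel_measurable \<mu>" "w \<in> borel_measurable \<mu>"
    using assms by (auto simp: L2_def)
  have "integrable \<mu> (\<lambda>x. 2 * (u x)\<^sup>2 + 2 * (w x)\<^sup>2)" using assms by (auto simp: L2_def)
  then have "integrable \<mu> (\<lambda>x. (u x + w x)\<^sup>2)"
  proof (rule Bochner_Integration.integrable_bound)
    have "(p + q)\<^sup>2 \<le> 2 * p\<^sup>2 + 2 * q\<^sup>2" for p q :: real
      using sum_squares_bound[of p q] by (simp add: power2_sum)
    then show "AE x in \<mu>. norm ((u x + w x)\<^sup>2) \<le> norm (2 * (u x)\<^sup>2 + 2 * (w x)\<^sup>2)" by simp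
  qed measurable
  then show ?thesis by (simp add: L2_def)
qed

lemma L2_scale: "u \<in> L2 \<mu> \<Longrightarrow> (\<lambda>x. c * u x) \<in> L2 \<mu>"
  by (auto simp: L2_def power_mult_distrib)

lemma L2_diff: assumes "u \<in> L2 \<mu>" "w \<in> L2 \<mu>" shows "(\<lambda>x. u x - w x) \<in> L2 \<mu>"
  using L2_add[OF assms(1) L2_scale[OF assms(2), of "-1"]] by simp

text \<open>The closure of the domain in the space of square integrable functions.\<close>

definition approximable :: "('a \<Rightarrow> real) \<Rightarrow> bool" where
  "approximable u \<longleftrightarrow> u \<in> L2 \<mu> \<and> (\<forall>\<epsilon>>0. \<exists>f\<in>dom. (\<integral>x. (u x - f x)\<^sup>2 \<partial>\<mu>) < \<epsilon>)"

lemma integral_square_sum_le: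
  assumes "u \<in> L2 \<mu>" "w \<in> L2 \<mu>"
  shows "(\<integral>x. (u x + w x)\<^sup>2 \<partial>\<mu>) \<le> 2 * (\<integral>x. (u x)\<^sup>2 \<partial>\<mu>) + 2 * (\<integral>x. (w x)\<^sup>2 \<partial>\<mu>)"
proof -
  have i: "integrable \<mu> (\<lambda>x. (u x)\<^sup>2)" "integrable \<mu> (\<lambda>x. (w x)\<^sup>2)"
    using assms by (auto simp: L2_def)
  have "(\<integral>x. (u x + w x)\<^sup>2 \<partial>\<mu>) \<le> (\<integral>x. 2 * (u x)\<^sup>2 + 2 * (w x)\<^sup>2 \<partial>\<mu>)"
  proof (rule integral_mono)
    show "(u x + w x)\<^sup>2 \<le> 2 * (u x)\<^sup>2 + 2 * (w x)\<^sup>2" for x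
      using sum_squares_bound[of "u x" "w x"] by (simp add: power2_sum)
  qed (use L2_add[OF assms] i in \<open>auto simp: L2_def\<close>)
  also have "\<dots> = 2 * (\<integral>x. (u x)\<^sup>2 \<partial>\<mu>) + 2 * (\<integral>x. (w x)\<^sup>2 \<partial>\<mu>)" using i by simp
  finally show ?thesis .
qed

lemma approximable_closed:
  assumes u: "u \<in> L2 \<mu>"
    and w: "\<And>\<epsilon>. 0 < \<epsilon> \<Longrightarrow> \<exists>w. approximable w \<and> (\<integral>x. (u x - w x)\<^sup>2 \<partial>\<mu>) < \<epsilon>"
  shows "approximable u"
  unfolding approximable_def
proof (intro conjI u allI impI)
  fix \<epsilon> :: real assume "0 < \<epsilon>"
  then obtain w where w: "approximable w" "(\<integral>x. (u x - w x)\<^sup>2 \<partial>\<mu>) < \<epsilon>/4"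
    using w[of "\<epsilon>/4"] by auto
  then obtain f where f: "f \<in> dom" "(\<integral>x. (w x - f x)\<^sup>2 \<partial>\<mu>) < \<epsilon>/4"
    using \<open>0 < \<epsilon>\<close> unfolding approximable_def by (metis zero_less_divide_iff zero_less_numeral)
  have wL: "w \<in> L2 \<mu>" using w(1) by (simp add: approximable_def)
  have "(\<integral>x. (u x - f x)\<^sup>2 \<partial>\<mu>) = (\<integral>x. ((u x - w x) + (w x - f x))\<^sup>2 \<partial>\<mu>)" by simp
  also have "\<dots> \<le> 2 * (\<integral>x. (u x - w x)\<^sup>2 \<partial>\<mu>) + 2 * (\<integral>x. (w x - f x)\<^sup>2 \<partial>\<mu>)"
    using f(1) dom_L2 by (intro integral_square_sum_le L2_diff u wL) auto
  also have "\<dots> < \<epsilon>" using w(2) f(2) by linarith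
  finally show "\<exists>f\<in>dom. (\<integral>x. (u x - f x)\<^sup>2 \<partial>\<mu>) < \<epsilon>" using f(1) by blast
qed

lemma approximable_limit:
  assumes u: "u \<in> L2 \<mu>" and w: "\<And>n. approximable (w n)" and g: "integrable \<mu> g"
    and lim: "\<And>x. x \<in> F \<Longrightarrow> (\<lambda>n. w n x) \<longlonglongrightarrow> u x"
    and bound: "\<And>n x. x \<in> F \<Longrightarrow> (u x - w n x)\<^sup>2 \<le> g x"
  shows "approximable u"
proof (rule approximable_closed[OF u])
  fix \<epsilon> :: real assume \<epsilon>: "0 < \<epsilon>"
  have [measurable]: "u \<in> borel_measurable \<mu>" "w n \<in> borel_measurable \<mu>" for n
    using u w by (auto simp: L2_def approximable_def)
  have "(\<lambda>n. \<integral>x. (u x - w n x)\<^sup>2 \<partial>\<mu>) \<longlonglongrightarrow> (\<integral>x. 0 \<partial>\<mu>)"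
  proof (rule integral_dominated_convergence[OF _ _ g])
    show "AE x in \<mu>. (\<lambda>n. (u x - w n x)\<^sup>2) \<longlonglongrightarrow> 0"
    proof (rule AE_I2)
      fix x assume "x \<in> space \<mu>"
      then have "(\<lambda>n. (u x - w n x)\<^sup>2) \<longlonglongrightarrow> (u x - u x)\<^sup>2"
        by (intro tendsto_intros lim) (simp add: space_\<mu>)
      then show "(\<lambda>n. (u x - w n x)\<^sup>2) \<longlonglongrightarrow> 0" by simp
    qed
  qed (use bound in \<open>auto simp: space_\<mu>\<close>)
  then have "eventually (\<lambda>n. (\<integral>x. (u x - w n x)\<^sup>2 \<partial>\<mu>) < \<epsilon>) sequentially"
    using \<epsilon> by (intro order_tendstoD(2)[where y=0]) auto
  then show "\<exists>w. approximable w \<and> (\<integral>x. (u x - w x)\<^sup>2 \<partial>\<mu>) < \<epsilon>"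
    using w by (auto simp: eventually_sequentially)
qed

lemma approximable_add:
  assumes "approximable u" "approximable w" shows "approximable (\<lambda>x. u x + w x)"
  unfolding approximable_def
proof (intro conjI allI impI)
  show "(\<lambda>x. u x + w x) \<in> L2 \<mu>" using assms L2_add by (simp add: approximable_def)
  fix \<epsilon> :: real assume "0 < \<epsilon>"
  then have "0 < \<epsilon>/4" by simp
  with assms obtain f g where f: "f \<in> dom" "(\<integral>x. (u x - f x)\<^sup>2 \<partial>\<mu>) < \<epsilon>/4"
    and g: "g \<in> dom" "(\<integral>x. (w x - g x)\<^sup>2 \<partial>\<mu>) < \<epsilon>/4"
    unfolding approximable_def by meson
  have "(\<integral>x. ((u x - f x) + (w x - g x))\<^sup>2 \<partial>\<mu>)
      \<le> 2 * (\<integral>x. (u x - f x)\<^sup>2 \<partial>\<mu>) + 2 * (\<integral>x. (w x - g x)\<^sup>2 \<partial>\<mu>)"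
    using f(1) g(1) dom_L2 assms
    by (intro integral_square_sum_le L2_diff) (auto simp: approximable_def)
  also have "\<dots> < \<epsilon>" using f(2) g(2) by linarith
  finally show "\<exists>f\<in>dom. (\<integral>x. (u x + w x - f x)\<^sup>2 \<partial>\<mu>) < \<epsilon>"
    by (intro bexI[OF _ dom_add[OF f(1) g(1)]]) (simp add: algebra_simps)
qed

lemma approximable_scale:
  assumes "approximable u" shows "approximable (\<lambda>x. c * u x)"
  unfolding approximable_def
proof (intro conjI allI impI)
  show "(\<lambda>x. c * u x) \<in> L2 \<mu>" using assms L2_scale by (simp add: approximable_def)
  fix \<epsilon> :: real assume \<epsilon>: "0 < \<epsilon>"
  have c: "0 < c\<^sup>2 + 1" by (simp add: add_nonneg_pos)
  then have "0 < \<epsilon> / (c\<^sup>2 + 1)" using \<epsilon> by simp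
  with assms obtain f where f: "f \<in> dom" "(\<integral>x. (u x - f x)\<^sup>2 \<partial>\<mu>) < \<epsilon> / (c\<^sup>2 + 1)"
    unfolding approximable_def by meson
  have "(\<integral>x. (c * u x - c * f x)\<^sup>2 \<partial>\<mu>) = c\<^sup>2 * (\<integral>x. (u x - f x)\<^sup>2 \<partial>\<mu>)"
    by (simp flip: right_diff_distrib add: power_mult_distrib)
  also have "\<dots> \<le> (c\<^sup>2 + 1) * (\<integral>x. (u x - f x)\<^sup>2 \<partial>\<mu>)"
    by (intro mult_right_mono integral_nonneg_AE) auto
  also have "\<dots> < \<epsilon>" using f(2) c by (simp add: field_simps)
  finally show "\<exists>f\<in>dom. (\<integral>x. (c * u x - f x)\<^sup>2 \<partial>\<mu>) < \<epsilon>"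
    by (intro bexI[OF _ dom_scale[OF f(1), of c]])
qed

lemma approximable_continuous:
  assumes h: "continuous_on F h" shows "approximable h"
  unfolding approximable_def
proof (intro conjI allI impI)
  show "h \<in> L2 \<mu>" unfolding L2_def
    using h by (auto intro!: continuous_measurable continuous_integrable continuous_on_power)
  fix \<epsilon> :: real assume \<epsilon>: "0 < \<epsilon>"
  obtain f where f: "f \<in> dom" "\<And>x. x \<in> F \<Longrightarrow> \<bar>h x - f x\<bar> < sqrt (\<epsilon>/2)"
    using dense[OF h, of "sqrt (\<epsilon>/2)"] \<epsilon> by auto
  have "(\<integral>x. (h x - f x)\<^sup>2 \<partial>\<mu>) \<le> (\<integral>x. \<epsilon>/2 \<partial>\<mu>)"
  proof (rule integral_mono)
    show "integrable \<mu> (\<lambda>x. (h x - f x)\<^sup>2)"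
      using h dom_continuous[OF f(1)] by (intro continuous_integrable continuous_intros)
    fix x assume "x \<in> space \<mu>"
    then have "\<bar>h x - f x\<bar> \<le> sqrt (\<epsilon>/2)" using f(2) by (force simp: space_\<mu>)
    from power_mono[OF this, of 2] show "(h x - f x)\<^sup>2 \<le> \<epsilon>/2" using \<epsilon> by simp
  qed simp
  then show "\<exists>f\<in>dom. (\<integral>x. (h x - f x)\<^sup>2 \<partial>\<mu>) < \<epsilon>"
    using f(1) \<epsilon> by (intro bexI[of _ f]) (auto simp: prob_space)
qed

lemma indicator_L2: "S \<in> sets borel \<Longrightarrow> indicator S \<in> L2 \<mu>"
proof -
  assume S: "S \<in> sets borel"
  have m: "(indicator S :: 'a \<Rightarrow> real) \<in> borel_measurable \<mu>"
    unfolding measurable_cong_sets[OF sets_\<mu> refl] using S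
    by (intro measurable_restrict_space1) auto
  then have "integrable \<mu> (\<lambda>x. (indicator S x :: real)\<^sup>2)"
    using borel_measurable_power[OF m, of 2]
    by (intro integrable_const_bound[of _ 1]) (auto simp: indicator_def)
  with m show "indicator S \<in> L2 \<mu>" by (simp add: L2_def)
qed

lemma square_diff_indicator: "0 \<le> (w::real) \<Longrightarrow> w \<le> 1 \<Longrightarrow> (indicator S x - w)\<^sup>2 \<le> 1"
  by (auto simp: indicator_def power_le_one abs_square_le_1)

text \<open>The indicator of an open set is an increasing limit of continuous functions, and the
  approximable indicators form a Dynkin system.\<close>

lemma approximable_indicator:
  assumes "S \<in> sets (borel :: 'a measure)" shows "approximable (indicator S)"
proof -
  have S: "S \<in> sigma_sets UNIV {U :: 'a set. open U}"
    using assms by (simp add: borel_def)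
  have borel: "A \<in> sets (borel :: 'a measure)" if "A \<in> sigma_sets UNIV {U :: 'a set. open U}" for A
    using that by (simp add: borel_def)
  have one: "approximable (\<lambda>_. 1)" by (rule approximable_continuous) simp
  have "Int_stable {U :: 'a set. open U}" by (auto simp: Int_stable_def)
  moreover have "{U :: 'a set. open U} \<subseteq> Pow UNIV" by simp
  ultimately show ?thesis using S
  proof (induction rule: sigma_sets_induct_disjoint)
    case (basic U)
    then have U: "open U" by simp
    \<comment> \<open>The distance to the empty set is 0 by convention, so the whole space needs its own case.\<close>
    show ?case
    proof (cases "U = UNIV")
      case True
      then show ?thesis using one by (simp add: indicator_def[abs_def])
    next
      case False
      let ?w = "\<lambda>n x. min 1 (real n * infdist x (- U))"
      show ?thesis
      proof (rule approximable_limit[where g="\<lambda>_. 1"])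
        show "approximable (?w n)" for n
          by (intro approximable_continuous continuous_intros)
        show "(\<lambda>n. ?w n x) \<longlonglongrightarrow> indicator U x" for x
        proof (cases "x \<in> U")
          case True
          then have "infdist x (- U) \<noteq> 0"
            using in_closed_iff_infdist_zero[of "- U" x] U False by auto
          then have "0 < infdist x (- U)" using infdist_nonneg[of x "- U"] by linarith
          then obtain n0 where "1 < real n0 * infdist x (- U)" using reals_Archimedean3 by blast
          then have "?w n x = 1" if "n \<ge> n0" for n
          proof -
            have "real n0 * infdist x (- U) \<le> real n * infdist x (- U)"
              using that by (intro mult_right_mono infdist_nonneg) auto
            with \<open>1 < real n0 * infdist x (- U)\<close> show ?thesis by simp
          qed
          then show ?thesis using True
            by (intro tendsto_eventually) (auto simp: eventually_sequentially)
        qed (simp add: infdist_zero)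
        show "(indicator U x - ?w n x)\<^sup>2 \<le> 1" for n x
          by (rule square_diff_indicator) (auto simp: infdist_nonneg)
      qed (use indicator_L2 U in auto)
    qed
  next
    case empty
    then show ?case using approximable_scale[OF one, of 0] by simp
  next
    case (compl A)
    have "approximable (\<lambda>x. 1 + (- 1) * indicator A x)"
      by (intro approximable_add one approximable_scale compl.IH)
    also have "(\<lambda>x. 1 + (- 1) * indicator A x) = (indicator (UNIV - A) :: 'a \<Rightarrow> real)"
      by (auto simp: indicator_def)
    finally show ?case .
  next
    case (union A)
    have fin: "approximable (indicator (\<Union>i<n. A i))" for n
    proof (induction n)
      case 0
      then show ?case using approximable_scale[OF one, of 0] by simp
    next
      case (Suc n)
      have "(indicator (\<Union>i<Suc n. A i) :: 'a \<Rightarrow> real)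
          = (\<lambda>x. indicator (\<Union>i<n. A i) x + indicator (A n) x)"
      proof -
        have "A i \<inter> A n = {}" if "i < n" for i
          using union(1) that by (simp add: disjoint_family_on_def)
        then have "(\<Union>i<n. A i) \<inter> A n = {}" by blast
        moreover have "(\<Union>i<Suc n. A i) = (\<Union>i<n. A i) \<union> A n" by (simp add: lessThan_Suc Un_commute)
        ultimately show ?thesis by (intro ext) (simp add: indicator_def of_bool_def disjoint_iff del: UN_iff UN_simps)
      qed
      then show ?case using approximable_add[OF Suc union(3)[of n]] by simp
    qed
    show ?case
    proof (rule approximable_limit[OF indicator_L2 fin, where g="\<lambda>_. 1"])
      show "(\<Union>i. A i) \<in> sets borel" using union(2) borel by blast
      show "(\<lambda>n. indicator (\<Union>i<n. A i) x) \<longlonglongrightarrow> (indicator (\<Union>i. A i) x :: real)" for x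
        by (rule LIMSEQ_indicator_UN)
      show "(indicator (\<Union>i. A i) x - indicator (\<Union>i<n. A i) x)\<^sup>2 \<le> (1::real)" for n x
        by (auto simp: indicator_def)
    qed simp
  qed
qed

lemma approximable_cong:
  assumes "approximable u" "\<And>x. x \<in> F \<Longrightarrow> u x = w x" shows "approximable w"
proof -
  have "w \<in> L2 \<mu>"
    using assms measurable_cong[of \<mu> u w borel]
      Bochner_Integration.integrable_cong[of \<mu> \<mu> "\<lambda>x. (u x)\<^sup>2" "\<lambda>x. (w x)\<^sup>2"]
    by (auto simp: approximable_def L2_def space_\<mu>)
  moreover have "(\<integral>x. (u x - f x)\<^sup>2 \<partial>\<mu>) = (\<integral>x. (w x - f x)\<^sup>2 \<partial>\<mu>)" for f
    using assms(2) by (intro Bochner_Integration.integral_cong) (auto simp: space_\<mu>)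
  ultimately show ?thesis using assms(1) by (simp add: approximable_def)
qed

text \<open>Measurable sets of the subspace are traces of Borel sets, so their indicators are approximable,
  and a simple function is a finite combination of such indicators.\<close>

lemma approximable_simple:
  assumes "simple_function \<mu> (s :: 'a \<Rightarrow> real)" shows "approximable s"
proof -
  have *: "approximable (indicator A)" if A: "A \<in> sets \<mu>" for A
  proof -
    obtain S where S: "S \<in> sets borel" "A = F \<inter> S"
      using A unfolding sets_\<mu> sets_restrict_space by blast
    show ?thesis
      by (rule approximable_cong[OF approximable_indicator[OF S(1)]]) (simp add: S(2) indicator_def)
  qed
  have fin: "finite (s ` space \<mu>)" using assms by (simp add: simple_function_def)
  have "approximable (\<lambda>x. \<Sum>y\<in>Y. y * indicator (s -` {y} \<inter> space \<mu>) x)"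
    if "Y \<subseteq> s ` space \<mu>" for Y
    using finite_subset[OF that fin] that
  proof (induction Y rule: finite_induct)
    case empty
    then show ?case using approximable_continuous[of "\<lambda>_. 0"] by simp
  next
    case (insert y Y)
    have "s -` {y} \<inter> space \<mu> \<in> sets \<mu>" using assms insert.prems by (auto simp: simple_function_def)
    moreover have "Y \<subseteq> s ` space \<mu>" using insert.prems by simp
    ultimately show ?case
      unfolding sum.insert[OF insert.hyps]
      by (intro approximable_add approximable_scale * insert.IH)
  qed
  from this[OF subset_refl] show ?thesis
  proof (rule approximable_cong)
    fix x assume x: "x \<in> F"
    have "(\<Sum>y\<in>s ` space \<mu>. y * indicator (s -` {y} \<inter> space \<mu>) x)
        = (\<Sum>y\<in>s ` space \<mu>. if y = s x then y else 0)"
      using x by (intro sum.cong) (auto simp: indicator_def space_\<mu>)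
    also have "\<dots> = s x" using fin x by (subst sum.delta) (auto simp: space_\<mu>)
    finally show "(\<Sum>y\<in>s ` space \<mu>. y * indicator (s -` {y} \<inter> space \<mu>) x) = s x" .
  qed
qed

text \<open>Simple functions \<open>s i\<close> with \<open>\<bar>s i\<bar> \<le> 2 * \<bar>u\<bar>\<close> converge to \<open>u\<close> pointwise, and the squared error is
  dominated by \<open>9 * u\<^sup>2\<close>.\<close>

lemma approximable_L2: assumes u: "u \<in> L2 \<mu>" shows "approximable u"
proof -
  have um: "u \<in> borel_measurable \<mu>" and u2: "integrable \<mu> (\<lambda>x. (u x)\<^sup>2)"
    using u by (auto simp: L2_def)
  obtain s where s: "\<And>i. simple_function \<mu> (s i)"
      "\<And>x. x \<in> space \<mu> \<Longrightarrow> (\<lambda>i. s i x) \<longlonglongrightarrow> u x"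
      "\<And>i x. x \<in> space \<mu> \<Longrightarrow> dist (s i x) 0 \<le> 2 * dist (u x) 0"
    using borel_measurable_implies_sequence_metric[OF um, of 0] by blast
  show ?thesis
  proof (rule approximable_limit[OF u approximable_simple[OF s(1)], where g="\<lambda>x. 9 * (u x)\<^sup>2"])
    show "integrable \<mu> (\<lambda>x. 9 * (u x)\<^sup>2)" using u2 by simp
    show "(\<lambda>n. s n x) \<longlonglongrightarrow> u x" if "x \<in> F" for x using s(2) that by (simp add: space_\<mu>)
    show "(u x - s n x)\<^sup>2 \<le> 9 * (u x)\<^sup>2" if "x \<in> F" for n x
    proof -
      have "\<bar>s n x\<bar> \<le> 2 * \<bar>u x\<bar>" using s(3)[of x n] that by (simp add: space_\<mu>)
      then have "\<bar>u x - s n x\<bar> \<le> \<bar>3 * u x\<bar>" by linarith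
      from power_mono[OF this, of 2] show ?thesis by (simp add: power_mult_distrib)
    qed
  qed
qed

subsection \<open>Closedness\<close>

text \<open>The resistance bound makes the form norm stronger than the uniform norm.\<close>

lemma uniform_le_form_one:
  assumes f: "f \<in> dom" and p: "p \<in> F"
  shows "(f p)\<^sup>2 \<le> (2 + 2 * \<bar>K\<bar>) * form_one \<mu> lim_form f f"
proof -
  have E: "0 \<le> energy f" by (rule energy_nonneg[OF f])
  have i: "integrable \<mu> (\<lambda>x. (f x)\<^sup>2)" using f dom_L2 by (auto simp: L2_def)
  have "(\<integral>x. (f p)\<^sup>2 \<partial>\<mu>) \<le> (\<integral>x. 2 * (f x)\<^sup>2 + 2 * (\<bar>K\<bar> * energy f) \<partial>\<mu>)"
  proof (rule integral_mono)
    fix x assume "x \<in> space \<mu>"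
    then have x: "x \<in> F" by (simp add: space_\<mu>)
    have "(f p - f x)\<^sup>2 \<le> K * energy f" by (rule K_bound[OF f p x])
    also have "\<dots> \<le> \<bar>K\<bar> * energy f" using E by (intro mult_right_mono) auto
    finally have "(f p - f x)\<^sup>2 \<le> \<bar>K\<bar> * energy f" .
    moreover have "(f p)\<^sup>2 \<le> 2 * (f x)\<^sup>2 + 2 * (f p - f x)\<^sup>2"
      using sum_squares_bound[of "f x" "f p - f x"] power2_sum[of "f x" "f p - f x"] by simp
    ultimately show "(f p)\<^sup>2 \<le> 2 * (f x)\<^sup>2 + 2 * (\<bar>K\<bar> * energy f)" by linarith
  qed (use i in auto)
  also have "\<dots> = 2 * (\<integral>x. (f x)\<^sup>2 \<partial>\<mu>) + 2 * (\<bar>K\<bar> * energy f)" using i by (simp add: prob_space)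
  also have "\<dots> \<le> (2 + 2 * \<bar>K\<bar>) * form_one \<mu> lim_form f f"
  proof -
    have "0 \<le> (\<integral>x. (f x)\<^sup>2 \<partial>\<mu>)" by (intro integral_nonneg_AE) auto
    then have "0 \<le> 2 * energy f + 2 * \<bar>K\<bar> * (\<integral>x. (f x)\<^sup>2 \<partial>\<mu>)" using E by simp
    then show ?thesis unfolding form_one_def lim_form_diag[OF f]
      by (simp add: power2_eq_square algebra_simps)
  qed
  finally show ?thesis by (simp add: prob_space)
qed

text \<open>A Cauchy sequence converges uniformly, so its limit is continuous.  At every level the energy of
  the difference to the limit is a limit of energies of differences within the sequence, which are
  small uniformly in the level.\<close>

lemma closed_form:
  assumes u: "\<And>n. u n \<in> dom"
    and cauchy: "\<forall>\<epsilon>>0. \<exists>n0. \<forall>m\<ge>n0. \<forall>n\<ge>n0.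
      form_one \<mu> lim_form (\<lambda>x. u m x - u n x) (\<lambda>x. u m x - u n x) < \<epsilon>"
  shows "\<exists>f\<in>dom. (\<lambda>n. form_one \<mu> lim_form (\<lambda>x. u n x - f x) (\<lambda>x. u n x - f x)) \<longlonglongrightarrow> 0"
proof -
  define C where "C = 2 + 2 * \<bar>K\<bar>"
  have C: "0 < C" by (simp add: C_def add_pos_nonneg)
  have d: "(\<lambda>x. u m x - u n x) \<in> dom" for m n by (intro dom_diff u)
  have "uniformly_convergent_on F u"
    unfolding uniformly_convergent_eq_Cauchy uniformly_Cauchy_on_def
  proof (intro allI impI)
    fix e :: real assume e: "0 < e"
    then obtain n0 where n0: "\<And>m n. m \<ge> n0 \<Longrightarrow> n \<ge> n0 \<Longrightarrow>
        form_one \<mu> lim_form (\<lambda>x. u m x - u n x) (\<lambda>x. u m x - u n x) < e\<^sup>2 / C"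
      using cauchy C by (metis zero_less_divide_iff zero_less_power)
    have "dist (u m x) (u n x) < e" if "x \<in> F" "m \<ge> n0" "n \<ge> n0" for m n x
    proof -
      have "(u m x - u n x)\<^sup>2 \<le> C * form_one \<mu> lim_form (\<lambda>x. u m x - u n x) (\<lambda>x. u m x - u n x)"
        unfolding C_def by (rule uniform_le_form_one[OF d that(1)])
      also have "\<dots> < e\<^sup>2" using n0[OF that(2,3)] C by (simp add: field_simps)
      finally show ?thesis using e power2_less_imp_less[of "\<bar>u m x - u n x\<bar>" e]
        by (simp add: dist_real_def)
    qed
    then show "\<exists>M. \<forall>x\<in>F. \<forall>m\<ge>M. \<forall>n\<ge>M. dist (u m x) (u n x) < e" by blast
  qed
  then obtain l where l: "uniform_limit F u l sequentially"
    unfolding uniformly_convergent_on_def by blast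
  have l_cont: "continuous_on F l"
    by (rule uniform_limit_theorem[OF _ l]) (use u dom_continuous in auto)
  have lim: "(\<lambda>m. u m x) \<longlonglongrightarrow> l x" if "x \<in> F" for x
    by (rule tendsto_uniform_limitI[OF l that])
  have Q_le: "\<exists>n0. \<forall>n\<ge>n0. \<forall>k. Q k (\<lambda>x. u n x - l x) (\<lambda>x. u n x - l x) \<le> \<epsilon>" if \<epsilon>: "0 < \<epsilon>" for \<epsilon>
  proof -
    obtain n0 where n0: "\<And>m n. m \<ge> n0 \<Longrightarrow> n \<ge> n0 \<Longrightarrow>
        form_one \<mu> lim_form (\<lambda>x. u m x - u n x) (\<lambda>x. u m x - u n x) < \<epsilon>"
      using cauchy \<epsilon> by meson
    have "Q k (\<lambda>x. u n x - l x) (\<lambda>x. u n x - l x) \<le> \<epsilon>" if n: "n \<ge> n0" for n k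
    proof (rule LIMSEQ_le_const2)
      show "(\<lambda>m. Q k (\<lambda>x. u n x - u m x) (\<lambda>x. u n x - u m x))
          \<longlonglongrightarrow> Q k (\<lambda>x. u n x - l x) (\<lambda>x. u n x - l x)"
        unfolding Q_def
        by (rule finite_form_tendsto) (intro tendsto_intros lim, use V_sub in auto)
      have "Q k (\<lambda>x. u n x - u m x) (\<lambda>x. u n x - u m x) \<le> \<epsilon>" if m: "m \<ge> n0" for m
      proof -
        have "0 \<le> (\<integral>x. (u n x - u m x) * (u n x - u m x) \<partial>\<mu>)"
          by (intro integral_nonneg_AE) auto
        then have "energy (\<lambda>x. u n x - u m x) \<le> \<epsilon>"
          using n0[OF n m] unfolding form_one_def lim_form_diag[OF d] by linarith
        with Q_le_energy[OF d] show ?thesis by (rule order_trans)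
      qed
      then show "\<exists>N. \<forall>m\<ge>N. Q k (\<lambda>x. u n x - u m x) (\<lambda>x. u n x - u m x) \<le> \<epsilon>" by blast
    qed
    then show ?thesis by blast
  qed
  obtain n1 where n1: "\<And>k. Q k (\<lambda>x. u n1 x - l x) (\<lambda>x. u n1 x - l x) \<le> 1"
    using Q_le[of 1] by auto
  have "(\<lambda>x. u n1 x - l x) \<in> dom"
    using n1 l_cont dom_continuous[OF u[of n1]] by (intro domI continuous_intros)
  from dom_diff[OF u[of n1] this] have l_dom: "l \<in> dom" by simp
  have dl: "(\<lambda>x. u n x - l x) \<in> dom" for n by (intro dom_diff u l_dom)
  have "(\<lambda>n. energy (\<lambda>x. u n x - l x)) \<longlonglongrightarrow> 0"
  proof (rule LIMSEQ_I)
    fix r :: real assume "0 < r"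
    then obtain n0 where n0: "\<And>n k. n \<ge> n0 \<Longrightarrow> Q k (\<lambda>x. u n x - l x) (\<lambda>x. u n x - l x) \<le> r/2"
      using Q_le[of "r/2"] by auto
    have "norm (energy (\<lambda>x. u n x - l x) - 0) < r" if "n \<ge> n0" for n
      using energy_le[OF n0[OF that]] energy_nonneg[OF dl[of n]] \<open>0 < r\<close> by simp
    then show "\<exists>no. \<forall>n\<ge>no. norm (energy (\<lambda>x. u n x - l x) - 0) < r" by blast
  qed
  moreover have "(\<lambda>n. \<integral>x. (u n x - l x) * (u n x - l x) \<partial>\<mu>) \<longlonglongrightarrow> 0"
  proof (rule LIMSEQ_I)
    fix r :: real assume r: "0 < r"
    from l obtain n0 where n0: "\<And>n x. n \<ge> n0 \<Longrightarrow> x \<in> F \<Longrightarrow> dist (u n x) (l x) < sqrt (r/2)"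
      using r unfolding uniform_limit_iff eventually_sequentially
      by (metis half_gt_zero_iff real_sqrt_gt_zero)
    have "norm ((\<integral>x. (u n x - l x) * (u n x - l x) \<partial>\<mu>) - 0) < r" if n: "n \<ge> n0" for n
    proof -
      have "(\<integral>x. (u n x - l x) * (u n x - l x) \<partial>\<mu>) \<le> (\<integral>x. r/2 \<partial>\<mu>)"
      proof (rule integral_mono)
        show "integrable \<mu> (\<lambda>x. (u n x - l x) * (u n x - l x))"
          using dom_continuous[OF dl[of n]] by (intro continuous_integrable continuous_on_mult)
        fix x assume "x \<in> space \<mu>"
        then have "\<bar>u n x - l x\<bar> \<le> sqrt (r/2)"
          using n0[OF n] by (force simp: space_\<mu> dist_real_def)
        from power_mono[OF this, of 2] show "(u n x - l x) * (u n x - l x) \<le> r/2"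
          using r by (simp add: power2_eq_square)
      qed simp
      moreover have "0 \<le> (\<integral>x. (u n x - l x) * (u n x - l x) \<partial>\<mu>)"
        by (intro integral_nonneg_AE) auto
      ultimately show ?thesis using r by (simp add: prob_space)
    qed
    then show "\<exists>no. \<forall>n\<ge>no. norm ((\<integral>x. (u n x - l x) * (u n x - l x) \<partial>\<mu>) - 0) < r" by blast
  qed
  ultimately have "(\<lambda>n. form_one \<mu> lim_form (\<lambda>x. u n x - l x) (\<lambda>x. u n x - l x)) \<longlonglongrightarrow> 0 + 0"
    unfolding form_one_def lim_form_diag[OF dl] by (rule tendsto_add)
  then show ?thesis using l_dom by auto
qed

subsection \<open>The Dirichlet form\<close>

lemma lim_form_AE_cong:
  assumes "f \<in> dom" "g \<in> dom" "AE x in \<mu>. f x = g x" shows "lim_form f h = lim_form g h"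
proof -
  have "f x = g x" if "x \<in> F" for x
    using continuous_AE_eq assms dom_continuous that by blast
  then show ?thesis unfolding lim_form_def
    by (intro arg_cong2[where f="\<lambda>a b. (a - b) / 4"] energy_cong) auto
qed

lemma dirichlet: "dirichlet_form \<mu> lim_form dom"
  unfolding dirichlet_form_def
proof (intro conjI ballI allI impI)
  show "lim_form f f \<ge> 0" if "f \<in> dom" for f using that by (simp add: lim_form_diag energy_nonneg)
  show "\<exists>f\<in>dom. (\<integral>x. (u x - f x)\<^sup>2 \<partial>\<mu>) < \<epsilon>" if "u \<in> L2 \<mu>" "0 < \<epsilon>" for u \<epsilon>
    using approximable_L2[OF that(1)] that(2) unfolding approximable_def by blast
  show "\<exists>f\<in>dom. (\<lambda>n. form_one \<mu> lim_form (\<lambda>x. u n x - f x) (\<lambda>x. u n x - f x)) \<longlonglongrightarrow> 0"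
    if "(\<forall>n. u n \<in> dom) \<and> (\<forall>\<epsilon>>0. \<exists>n0. \<forall>m\<ge>n0. \<forall>n\<ge>n0.
      form_one \<mu> lim_form (\<lambda>x. u m x - u n x) (\<lambda>x. u m x - u n x) < \<epsilon>)" for u
    using that by (intro closed_form) auto
  show "\<exists>g\<in>dom. (AE x in \<mu>. g x = min (max (f x) 0) 1) \<and> lim_form g g \<le> lim_form f f" if f: "f \<in> dom" for f
  proof -
    have d: "(\<lambda>x. min (max (f x) 0) 1) \<in> dom" by (intro min_dom max_dom f)
    have "energy (\<lambda>x. min (max (f x) 0) 1) \<le> energy f"
      by (rule contraction_dom(2)[OF f dom_continuous[OF d]]) (auto simp: min_def max_def)
    then show ?thesis using d f by (intro bexI[OF _ d]) (auto simp: lim_form_diag)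
  qed
qed (rule dom_L2 dom_const dom_add dom_scale lim_form_AE_cong lim_form_commute lim_form_add lim_form_scale; assumption)+

lemma compactly_supported_iff: "compactly_supported (space \<mu>) = {f. continuous_on F f}"
  unfolding compactly_supported_def space_\<mu> using compact_F by blast

lemma regular: "regular_dirichlet_form \<mu> lim_form dom"
  unfolding regular_dirichlet_form_def
proof (intro conjI dirichlet full_\<mu> exI)
  show "is_core \<mu> lim_form dom dom"
    unfolding is_core_def compactly_supported_iff
  proof (intro conjI ballI allI impI)
    show "dom \<subseteq> dom \<inter> {f. continuous_on F f}" using dom_continuous by auto
    show "\<exists>g\<in>dom. form_one \<mu> lim_form (\<lambda>x. f x - g x) (\<lambda>x. f x - g x) < \<epsilon>"
      if "f \<in> dom" "0 < \<epsilon>" for f \<epsilon>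
      by (rule bexI[OF _ that(1)]) (use that(2) in \<open>simp add: form_one_def lim_form_diag dom_const energy_const\<close>)
    show "\<exists>g\<in>dom. \<forall>x\<in>space \<mu>. \<bar>h x - g x\<bar> < \<epsilon>"
      if "h \<in> {f. continuous_on F f}" "0 < \<epsilon>" for h \<epsilon>
      using dense[of h \<epsilon>] that unfolding space_\<mu> by simp
  qed
qed

lemma irreducible: "irreducible_form \<mu> lim_form dom"
  unfolding irreducible_form_def
proof (intro conjI ballI impI)
  show "\<exists>e\<in>dom. (AE x in \<mu>. e x = 1) \<and> lim_form e e = 0"
    by (rule bexI[OF _ dom_const[of 1]]) (simp add: lim_form_diag dom_const energy_const)
  fix f assume f: "f \<in> dom" "lim_form f f = 0"
  obtain p where p: "p \<in> F" using not_empty space_\<mu> by auto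
  have "f x = f p" if "x \<in> F" for x
    using K_bound[OF f(1) that p] f lim_form_diag[OF f(1)] by simp
  then show "\<exists>c. AE x in \<mu>. f x = c" by (intro exI[of _ "f p"] AE_I2) (simp add: space_\<mu>)
qed

text \<open>Disjoint compact supports have positive distance, so that no short edge sees both functions.\<close>

lemma local: "local_form \<mu> lim_form dom"
  unfolding local_form_def
proof (intro ballI impI)
  fix f g assume f: "f \<in> dom" and g: "g \<in> dom"
  assume "compact (ae_support \<mu> f) \<and> compact (ae_support \<mu> g) \<and> ae_support \<mu> f \<inter> ae_support \<mu> g = {}"
  then obtain d where d: "0 < d" "\<And>x y. x \<in> ae_support \<mu> f \<Longrightarrow> y \<in> ae_support \<mu> g \<Longrightarrow> d \<le> dist x y"
    using compact_closed_separated[of "ae_support \<mu> f" "ae_support \<mu> g"] compact_imp_closed by blast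
  have supp: "x \<in> ae_support \<mu> h" if "h \<in> dom" "x \<in> F" "h x \<noteq> 0" for h x
    using continuous_AE_zero[OF dom_continuous[OF that(1)]] that unfolding ae_support_def space_\<mu>
    by blast
  have far: "d \<le> dist x y" if "x \<in> F" "y \<in> F" "f x \<noteq> 0" "g y \<noteq> 0" for x y
    using d(2) supp f g that by blast
  obtain n0 where n0: "\<And>n x y. n \<ge> n0 \<Longrightarrow> b n x y \<noteq> 0 \<Longrightarrow> dist x y < d"
    using short_edges[OF d(1)] by blast
  have "Q n f g = 0" if n: "n \<ge> n0" for n
  proof -
    have zero: "b n x y * (f x - f y) * (g x - g y) = 0" if xy: "x \<in> V n" "y \<in> V n" for x y
    proof (rule ccontr)
      assume "b n x y * (f x - f y) * (g x - g y) \<noteq> 0"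
      then have ne: "b n x y \<noteq> 0" "f x \<noteq> 0 \<or> f y \<noteq> 0" "g x \<noteq> 0 \<or> g y \<noteq> 0" by auto
      have "dist x y < d" by (rule n0[OF n ne(1)])
      moreover have "x \<in> F" "y \<in> F" using xy V_sub by auto
      ultimately show False
        using far[of x x] far[of x y] far[of y x] far[of y y] ne(2,3) d(1)
        by (auto simp: dist_commute)
    qed
    have "(\<Sum>x\<in>V n. \<Sum>y\<in>V n. b n x y * (f x - f y) * (g x - g y)) = 0"
      by (intro sum.neutral ballI zero)
    then show ?thesis unfolding Q_def finite_form_def by simp
  qed
  then have "(\<lambda>n. Q n f g) \<longlonglongrightarrow> 0"
    by (intro tendsto_eventually) (auto simp: eventually_sequentially)
  with Q_tendsto_lim_form[OF f g] show "lim_form f g = 0" by (rule LIMSEQ_unique)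
qed

end

section \<open>Cells and vertices of a self-similar set\<close>

lemma word_map_simps [simp]:
  "word_map \<psi> [] x = x" "word_map \<psi> (i # l) x = \<psi> i (word_map \<psi> l x)"
  by (simp_all add: word_map_def)

lemma word_map_append: "word_map \<psi> (l @ k) x = word_map \<psi> l (word_map \<psi> k x)"
  by (induction l) auto

lemma shift_shift: "shift m (shift n w) = shift (n + m) w"
  by (simp add: shift_def add.assoc)

lemma shift_0 [simp]: "shift 0 w = w" by (simp add: shift_def)

lemma shift_words: "w \<in> words N \<Longrightarrow> shift n w \<in> words N"
  by (simp add: words_def shift_def)

text \<open>Concatenation of a finite word with an infinite one.\<close>

definition prepend :: "nat list \<Rightarrow> (nat \<Rightarrow> nat) \<Rightarrow> nat \<Rightarrow> nat" where
  "prepend l w = (\<lambda>k. if k < length l then l ! k else w (k - length l))"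

lemma shift_prepend: "shift (length l) (prepend l w) = w"
  by (simp add: shift_def prepend_def)

lemma map_prepend: "map (prepend l w) [0..<length l] = l"
  by (rule nth_equalityI) (auto simp: prepend_def)

lemma prepend_words: "set l \<subseteq> {1..N} \<Longrightarrow> w \<in> words N \<Longrightarrow> prepend l w \<in> words N"
  using nth_mem by (fastforce simp: words_def prepend_def)

locale pcf =
  fixes F :: "'a::metric_space set" and N :: nat and \<psi> :: "nat \<Rightarrow> 'a \<Rightarrow> 'a"
  assumes pcf: "generalized_pcfss F N \<psi>"
begin

abbreviation V :: "nat \<Rightarrow> 'a set" where "V \<equiv> vertices F N \<psi>"
abbreviation wm :: "nat list \<Rightarrow> 'a \<Rightarrow> 'a" where "wm \<equiv> word_map \<psi>"
abbreviation code :: "(nat \<Rightarrow> nat) \<Rightarrow> 'a" where "code \<equiv> coding F \<psi>"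
abbreviation P :: "(nat \<Rightarrow> nat) set" where "P \<equiv> post_critical F N \<psi>"

(* Keeps the alphabet in the form {1..N} in which the definitions state it. *)
declare One_nat_def [simp del]

lemma sss: "self_similar_structure F N \<psi>" using pcf by (simp add: generalized_pcfss_def)

lemma compact_F: "compact F" and F_ne: "F \<noteq> {}"
  and psi_cont: "i \<in> {1..N} \<Longrightarrow> continuous_on F (\<psi> i)"
  and psi_inj: "i \<in> {1..N} \<Longrightarrow> inj_on (\<psi> i) F"
  and F_eq: "F = (\<Union>i\<in>{1..N}. \<psi> i ` F)"
  using sss unfolding self_similar_structure_def by blast+

lemma psi_in: "i \<in> {1..N} \<Longrightarrow> x \<in> F \<Longrightarrow> \<psi> i x \<in> F"
  using equalityD2[OF F_eq] by blast

lemma wm_in: "set l \<subseteq> {1..N} \<Longrightarrow> x \<in> F \<Longrightarrow> wm l x \<in> F"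
  by (induction l) (auto intro: psi_in)

lemma wm_cont: "set l \<subseteq> {1..N} \<Longrightarrow> continuous_on F (wm l)"
proof (induction l)
  case Nil then show ?case by simp
next
  case (Cons i l)
  then have "continuous_on F (\<lambda>x. \<psi> i (wm l x))"
    by (intro continuous_on_compose2[OF psi_cont[of i]]) (auto simp: wm_in)
  then show ?case by simp
qed

lemma compact_cell: "set l \<subseteq> {1..N} \<Longrightarrow> compact (wm l ` F)"
  by (intro compact_continuous_image wm_cont compact_F)

lemma small_cells:
  assumes "0 < \<epsilon>"
  shows "\<exists>n0. \<forall>l. n0 \<le> length l \<longrightarrow> set l \<subseteq> {1..N} \<longrightarrow>
    (\<forall>x\<in>F. \<forall>y\<in>F. dist (wm l x) (wm l y) < \<epsilon>)"
proof -
  obtain \<delta> where \<delta>: "0 < \<delta>" "\<And>i. i \<in> {1..N} \<Longrightarrow> (1 - \<delta>)-lipschitz_on F (\<psi> i)"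
    using sss unfolding self_similar_structure_def by blast
  define c where "c = max 0 (1 - \<delta>)"
  have c: "0 \<le> c" "c < 1" using \<delta>(1) by (auto simp: c_def)
  have wm: "dist (wm l x) (wm l y) \<le> c ^ length l * dist x y"
    if "set l \<subseteq> {1..N}" "x \<in> F" "y \<in> F" for l x y
    using that
  proof (induction l)
    case (Cons i l)
    have "dist (\<psi> i (wm l x)) (\<psi> i (wm l y)) \<le> (1 - \<delta>) * dist (wm l x) (wm l y)"
      using Cons.prems by (intro lipschitz_onD[OF \<delta>(2)] wm_in) auto
    also have "\<dots> \<le> c * (c ^ length l * dist x y)"
      using Cons c by (intro mult_mono) (auto simp: c_def)
    finally show ?case by (simp add: mult.assoc)
  qed simp
  obtain B where B: "\<And>x y. x \<in> F \<Longrightarrow> y \<in> F \<Longrightarrow> dist x y \<le> B"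
    using compact_imp_bounded[OF compact_F] unfolding bounded_two_points by blast
  have B1: "0 < \<bar>B\<bar> + 1" by simp
  obtain n0 where n0: "c ^ n0 < \<epsilon> / (\<bar>B\<bar> + 1)"
    using real_arch_pow_inv[of "\<epsilon> / (\<bar>B\<bar> + 1)" c] c assms B1 by auto
  have "dist (wm l x) (wm l y) < \<epsilon>"
    if "n0 \<le> length l" "set l \<subseteq> {1..N}" "x \<in> F" "y \<in> F" for l x y
  proof -
    have "dist (wm l x) (wm l y) \<le> c ^ length l * dist x y" by (rule wm[OF that(2-4)])
    also have "\<dots> \<le> c ^ n0 * (\<bar>B\<bar> + 1)"
      using B[OF that(3,4)] c that(1) by (intro mult_mono power_decreasing) auto
    also have "\<dots> < \<epsilon>" using n0 B1 by (simp add: field_simps)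
    finally show ?thesis .
  qed
  then show ?thesis by blast
qed

subsection \<open>Coding by infinite words\<close>

lemma prefix_letters: "w \<in> words N \<Longrightarrow> set (map w [0..<n]) \<subseteq> {1..N}"
  by (auto simp: words_def)

text \<open>The cells along an infinite word shrink to a point.\<close>

lemma code_unique:
  assumes w: "w \<in> words N" and x: "\<And>n. x \<in> wm (map w [0..<n]) ` F"
  shows "code w = x"
  unfolding coding_def
proof (rule the_equality)
  fix y assume y: "\<forall>n. y \<in> wm (map w [0..<n]) ` F"
  show "y = x"
  proof (rule ccontr)
    assume "y \<noteq> x"
    then obtain n where n: "\<And>l x' y'. \<lbrakk>n \<le> length l; set l \<subseteq> {1..N}; x' \<in> F; y' \<in> F\<rbrakk>
        \<Longrightarrow> dist (wm l x') (wm l y') < dist y x"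
      using small_cells[of "dist y x"] \<open>y \<noteq> x\<close> by (metis zero_less_dist_iff)
    obtain x' y' where "x' \<in> F" "y' \<in> F"
      "x = wm (map w [0..<n]) x'" "y = wm (map w [0..<n]) y'"
      using x[of n] y[rule_format, of n] by blast
    with n[of "map w [0..<n]" y' x'] prefix_letters[OF w] show False by simp
  qed
qed (use x in blast)

text \<open>The cells along an infinite word form a decreasing sequence of nonempty compact sets.\<close>

lemma code_in_cell: assumes w: "w \<in> words N" shows "code w \<in> wm (map w [0..<n]) ` F"
proof -
  let ?X = "\<lambda>n. wm (map w [0..<n]) ` F"
  have step: "?X (Suc n) \<subseteq> ?X n" for n
    using w by (auto simp: word_map_append words_def intro!: imageI psi_in)
  have anti: "?X n \<subseteq> ?X m" if "m \<le> n" for m n by (rule lift_Suc_antimono_le[of ?X, OF step that])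
  have "F \<inter> (\<Inter>n\<in>UNIV. ?X n) \<noteq> {}"
  proof (rule compact_imp_fip_image[OF compact_F])
    show "closed (?X n)" for n by (intro compact_imp_closed compact_cell prefix_letters w)
    fix J :: "nat set" assume J: "finite J"
    obtain p where p: "p \<in> F" using F_ne by blast
    have "wm (map w [0..<Max (insert 0 J)]) p \<in> ?X n" if "n \<in> J" for n
      using anti[of n "Max (insert 0 J)"] that J p by auto
    moreover have "wm (map w [0..<Max (insert 0 J)]) p \<in> F"
      by (intro wm_in prefix_letters w p)
    ultimately show "F \<inter> (\<Inter>n\<in>J. ?X n) \<noteq> {}" by blast
  qed
  then obtain x where x: "\<And>n. x \<in> ?X n" by blast
  from code_unique[OF w this] x show ?thesis by simp
qed

lemma code_in: "w \<in> words N \<Longrightarrow> code w \<in> F"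
  using code_in_cell[of w 0] by simp

lemma code_Suc: assumes w: "w \<in> words N" shows "code w = \<psi> (w 0) (code (shift 1 w))"
proof (rule code_unique[OF w])
  have w0: "w 0 \<in> {1..N}" using w by (simp add: words_def)
  fix n
  show "\<psi> (w 0) (code (shift 1 w)) \<in> wm (map w [0..<n]) ` F"
  proof (cases n)
    case 0
    then show ?thesis using psi_in[OF w0 code_in[OF shift_words[OF w]]] by simp
  next
    case (Suc m)
    have "map w [0..<n] = w 0 # map (shift 1 w) [0..<m]"
      unfolding Suc map_upt_Suc by (simp add: shift_def One_nat_def)
    then show ?thesis using code_in_cell[OF shift_words[OF w], of 1 m] by auto
  qed
qed

lemma code_shift: "w \<in> words N \<Longrightarrow> code w = wm (map w [0..<n]) (code (shift n w))"
proof (induction n)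
  case (Suc n)
  have "code (shift n w) = \<psi> (w n) (code (shift (Suc n) w))"
    using code_Suc[OF shift_words[OF Suc.prems], of n] by (simp add: shift_shift) (simp add: shift_def One_nat_def)
  with Suc show ?case by (simp add: word_map_append)
qed simp

lemma code_prepend:
  assumes "set l \<subseteq> {1..N}" "w \<in> words N" shows "code (prepend l w) = wm l (code w)"
  using code_shift[OF prepend_words[OF assms], of "length l"]
  by (simp add: map_prepend shift_prepend)

text \<open>Repeatedly choosing a cell that contains the current point, and pulling the point back along the
  corresponding map, reads off the letters of a code.\<close>

lemma code_surj: assumes x: "x \<in> F" shows "\<exists>w\<in>words N. code w = x"
proof -
  have "\<forall>y\<in>F. \<exists>i z. i \<in> {1..N} \<and> z \<in> F \<and> y = \<psi> i z" using equalityD1[OF F_eq] by blast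
  then obtain a s where as: "\<And>y. y \<in> F \<Longrightarrow> a y \<in> {1..N} \<and> s y \<in> F \<and> y = \<psi> (a y) (s y)"
    by metis
  define w where "w = (\<lambda>k. a ((s ^^ k) x))"
  have s: "(s ^^ k) x \<in> F" for k by (induction k) (use x as in auto)
  have w: "w \<in> words N" unfolding words_def w_def using as s by blast
  have "x = wm (map w [0..<n]) ((s ^^ n) x)" for n
  proof (induction n)
    case (Suc n)
    have s_n: "(s ^^ n) x = \<psi> (w n) ((s ^^ Suc n) x)"
      unfolding w_def using as[OF s[of n]] by simp
    have "x = wm (map w [0..<n]) (\<psi> (w n) ((s ^^ Suc n) x))"
      by (rule trans[OF Suc arg_cong[where f="wm (map w [0..<n])", OF s_n]])
    also have "wm (map w [0..<n]) (\<psi> (w n) ((s ^^ Suc n) x)) = wm (map w [0..<Suc n]) ((s ^^ Suc n) x)"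
      by (simp add: word_map_append)
    finally show ?case .
  qed simp
  then have "x \<in> wm (map w [0..<n]) ` F" for n using s by blast
  from code_unique[OF w this] w show ?thesis by blast
qed

subsection \<open>Vertices\<close>

lemma P_words: "P \<subseteq> words N" unfolding post_critical_def by (auto intro: shift_words)

lemma P_shift: "w \<in> P \<Longrightarrow> shift n w \<in> P"
  unfolding post_critical_def by (fastforce simp: shift_shift)

lemma V_0: "V 0 = code ` P"
  unfolding vertices_def using P_words by auto

lemma V_Suc: "V (Suc n) = (\<Union>i\<in>{1..N}. \<psi> i ` V n)"
proof (intro equalityI subsetI)
  fix x assume "x \<in> V (Suc n)"
  then obtain w where w: "w \<in> words N" "shift (Suc n) w \<in> P" "x = code w"
    unfolding vertices_def by blast
  have "code (shift 1 w) \<in> V n"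
    unfolding vertices_def using w shift_words[OF w(1), of 1] by (auto simp: shift_shift One_nat_def)
  moreover have "w 0 \<in> {1..N}" using w(1) by (simp add: words_def)
  ultimately show "x \<in> (\<Union>i\<in>{1..N}. \<psi> i ` V n)" using code_Suc[OF w(1)] w(3) by blast
next
  fix x assume "x \<in> (\<Union>i\<in>{1..N}. \<psi> i ` V n)"
  then obtain i w where i: "i \<in> {1..N}" and w: "w \<in> words N" "shift n w \<in> P" "x = \<psi> i (code w)"
    unfolding vertices_def by blast
  have "code (prepend [i] w) = x" using code_prepend[of "[i]" w] i w by simp
  moreover have "prepend [i] w \<in> words N" using i w by (intro prepend_words) auto
  moreover have "shift (Suc n) (prepend [i] w) = shift n w"
    using shift_prepend[of "[i]" w] shift_shift[of n 1 "prepend [i] w"] by (simp add: One_nat_def)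
  ultimately show "x \<in> V (Suc n)" unfolding vertices_def using w by force
qed

lemma V_sub: "V n \<subseteq> F" unfolding vertices_def by (auto intro: code_in)

lemma finite_V: "finite (V n)"
  by (induction n) (use pcf in \<open>auto simp: V_0 V_Suc generalized_pcfss_def\<close>)

lemma V_mono_Suc: "V n \<subseteq> V (Suc n)"
proof -
  have "shift (Suc n) w \<in> P" if "shift n w \<in> P" for w
    using P_shift[OF that, of 1] by (simp add: shift_shift One_nat_def)
  then show ?thesis unfolding vertices_def by blast
qed

lemma V_mono: "m \<le> n \<Longrightarrow> V m \<subseteq> V n"
  by (rule lift_Suc_mono_le[of V, OF V_mono_Suc])

text \<open>All proper tails of every code of a point in the overlap set are post-critical.  One such code starts
  with \<open>i # l\<close> and goes on with a code of \<open>x\<close>.\<close>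

lemma overlap:
  assumes "i \<in> {1..N}" "set l \<subseteq> {1..N}" "j \<in> {1..N}" "i \<noteq> j" "x \<in> F" "y \<in> F"
    and eq: "\<psi> i (wm l x) = \<psi> j y"
  shows "x \<in> V 0"
proof -
  obtain u where u: "u \<in> words N" "code u = x" using code_surj[OF assms(5)] by blast
  have il: "set (i # l) \<subseteq> {1..N}" using assms by simp
  let ?w = "prepend (i # l) u"
  have "code ?w = \<psi> i (wm l x)" using code_prepend[OF il u(1)] u(2) by simp
  then have "code ?w \<in> \<psi> i ` F \<inter> \<psi> j ` F"
    using assms wm_in[of l x] by (metis IntI image_eqI)
  then have "code ?w \<in> overlap_set F N \<psi>"
    unfolding overlap_set_def using assms(1,3,4) by blast
  then have "shift (length (i # l)) ?w \<in> P"
    unfolding post_critical_def using prepend_words[OF il u(1)]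
    by (intro UN_I[of "length (i # l)"] imageI) auto
  then show ?thesis unfolding V_0 shift_prepend using u(2) by blast
qed

text \<open>Injectivity of the maps strips the common prefix of the two words; at the first letter in which
  they differ the point lies in the overlap set.\<close>

lemma overlap_words:
  assumes "length l = length l'" "l \<noteq> l'" "set l \<subseteq> {1..N}" "set l' \<subseteq> {1..N}"
    "x \<in> F" "y \<in> F" "wm l x = wm l' y"
  shows "x \<in> V 0"
  using assms
proof (induction l l' rule: list_induct2)
  case (Cons i l j l')
  show ?case
  proof (cases "i = j")
    case True
    have "wm l x = wm l' y"
      by (rule inj_onD[OF psi_inj[of i]]) (use Cons.prems True in \<open>auto simp: wm_in\<close>)
    then show ?thesis using Cons True by auto
  next
    case False
    then show ?thesis using Cons.prems by (intro overlap[of i l j x "wm l' y"]) (auto intro: wm_in)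
  qed
qed simp

lemma wm_V: "set l \<subseteq> {1..N} \<Longrightarrow> x \<in> V m \<Longrightarrow> wm l x \<in> V (length l + m)"
  by (induction l) (auto simp: V_Suc)

lemma V_decompose:
  "x \<in> V (n + m) \<Longrightarrow> \<exists>l y. length l = n \<and> set l \<subseteq> {1..N} \<and> y \<in> V m \<and> x = wm l y"
proof (induction n arbitrary: x)
  case 0
  then show ?case by (intro exI[of _ "[]"] exI[of _ x]) simp
next
  case (Suc n)
  then obtain i x' where i: "i \<in> {1..N}" "x' \<in> V (n + m)" "x = \<psi> i x'" by (auto simp: V_Suc)
  then obtain l y where "length l = n" "set l \<subseteq> {1..N}" "y \<in> V m" "x' = wm l y"
    using Suc.IH by blast
  then show ?case using i by (intro exI[of _ "i # l"] exI[of _ y]) simp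
qed

lemma cells_cover:
  assumes "x \<in> F" shows "\<exists>l y. length l = n \<and> set l \<subseteq> {1..N} \<and> y \<in> F \<and> x = wm l y"
proof -
  obtain w where w: "w \<in> words N" "code w = x" using code_surj[OF assms] by blast
  then show ?thesis using code_in_cell[OF w(1), of n] prefix_letters[OF w(1), of n]
    by (metis (no_types, lifting) diff_zero imageE length_map length_upt)
qed

lemma vertices_dense:
  assumes "V 0 \<noteq> {}" "x \<in> F" "0 < \<epsilon>" shows "\<exists>n. \<exists>y\<in>V n. dist y x < \<epsilon>"
proof -
  obtain n where n: "\<And>l x' y'. \<lbrakk>n \<le> length l; set l \<subseteq> {1..N}; x' \<in> F; y' \<in> F\<rbrakk>
      \<Longrightarrow> dist (wm l x') (wm l y') < \<epsilon>"
    using small_cells[OF assms(3)] by blast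
  obtain l x' where l: "length l = n" "set l \<subseteq> {1..N}" "x' \<in> F" "x = wm l x'"
    using cells_cover[OF assms(2)] by blast
  obtain p where p: "p \<in> V 0" using assms(1) by blast
  then have "dist (wm l p) x < \<epsilon>" using n[of l p x'] l V_sub[of 0] by auto
  moreover have "wm l p \<in> V n" using wm_V[OF l(2) p] l(1) by simp
  ultimately show ?thesis by blast
qed

text \<open>Disjoint cells of the same level have positive distance, and there are finitely many of them.\<close>

lemma adjacent_cells:
  "\<exists>\<delta>>0. \<forall>x\<in>F. \<forall>y\<in>F. \<forall>l l'. dist x y < \<delta> \<longrightarrow> length l = n \<longrightarrow> length l' = n \<longrightarrow>
    set l \<subseteq> {1..N} \<longrightarrow> set l' \<subseteq> {1..N} \<longrightarrow> x \<in> wm l ` F \<longrightarrow> y \<in> wm l' ` F \<longrightarrow>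
    wm l ` F \<inter> wm l' ` F \<noteq> {}"
proof -
  define L where "L = {l. set l \<subseteq> {1..N} \<and> length l = n}"
  have "finite L" unfolding L_def by (rule finite_lists_length_eq) simp
  define D where "D = {(l, l') \<in> L \<times> L. wm l ` F \<inter> wm l' ` F = {}}"
  have finD: "finite D" using \<open>finite L\<close> by (auto simp: D_def intro: finite_subset[of _ "L \<times> L"])
  have "\<forall>p\<in>D. \<exists>d>0. \<forall>x\<in>wm (fst p) ` F. \<forall>y\<in>wm (snd p) ` F. d \<le> dist x y"
    by (intro ballI compact_closed_separated compact_imp_closed compact_cell)
      (auto simp: D_def L_def)
  then obtain d where d: "\<And>p. p \<in> D \<Longrightarrow> 0 < d p"
      "\<And>p x y. \<lbrakk>p \<in> D; x \<in> wm (fst p) ` F; y \<in> wm (snd p) ` F\<rbrakk> \<Longrightarrow> d p \<le> dist x y"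
    by metis
  define \<delta> where "\<delta> = Min (insert 1 (d ` D))"
  have "0 < \<delta>" unfolding \<delta>_def using finD d(1) by (subst Min_gr_iff) auto
  moreover have "wm l ` F \<inter> wm l' ` F \<noteq> {}"
    if "dist x y < \<delta>" "length l = n" "length l' = n" "set l \<subseteq> {1..N}" "set l' \<subseteq> {1..N}"
      "x \<in> wm l ` F" "y \<in> wm l' ` F" for x y l l'
  proof
    assume "wm l ` F \<inter> wm l' ` F = {}"
    then have "(l, l') \<in> D" using that by (simp add: D_def L_def)
    moreover from this have "\<delta> \<le> d (l, l')" unfolding \<delta>_def using finD by (intro Min_le) auto
    ultimately show False using d(2)[of "(l, l')" x y] that by auto
  qed
  ultimately show ?thesis by blast
qed

text \<open>Otherwise the union of the cells that are reachable from the first one and the union of the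
  remaining cells would be two disjoint closed nonempty sets that cover \<open>F\<close>.\<close>

lemma cells_connected:
  assumes con: "connected F" and i: "i \<in> {1..N}" and j: "j \<in> {1..N}"
  shows "(i, j) \<in> {(i, j). i \<in> {1..N} \<and> j \<in> {1..N} \<and> \<psi> i ` F \<inter> \<psi> j ` F \<noteq> {}}\<^sup>*"
    (is "_ \<in> ?E\<^sup>*")
proof (rule ccontr)
  assume nj: "(i, j) \<notin> ?E\<^sup>*"
  define S where "S = {k \<in> {1..N}. (i, k) \<in> ?E\<^sup>*}"
  define T where "T = {1..N} - S"
  have iS: "i \<in> S" and jT: "j \<in> T" using i j nj by (auto simp: S_def T_def)
  have cl: "closed (\<Union>k\<in>J. \<psi> k ` F)" if "J \<subseteq> {1..N}" for J
    using that finite_subset[OF that]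
    by (intro closed_UN ballI compact_imp_closed compact_continuous_image psi_cont compact_F) auto
  have "\<psi> k ` F \<inter> \<psi> m ` F = {}" if "k \<in> S" "m \<in> T" for k m
  proof (rule ccontr)
    assume "\<psi> k ` F \<inter> \<psi> m ` F \<noteq> {}"
    then have "(k, m) \<in> ?E" using that by (auto simp: S_def T_def)
    moreover have "(i, k) \<in> ?E\<^sup>*" using that by (simp add: S_def)
    ultimately have "(i, m) \<in> ?E\<^sup>*" by (rule rtrancl_into_rtrancl[rotated])
    then show False using that by (auto simp: S_def T_def)
  qed
  then have disj: "(\<Union>k\<in>S. \<psi> k ` F) \<inter> (\<Union>k\<in>T. \<psi> k ` F) \<inter> F = {}" by blast
  have "{1..N} = S \<union> T" by (auto simp: S_def T_def)
  then have cover: "F \<subseteq> (\<Union>k\<in>S. \<psi> k ` F) \<union> (\<Union>k\<in>T. \<psi> k ` F)"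
    using equalityD1[OF F_eq] by (simp only: UN_Un)
  obtain p where p: "p \<in> F" using F_ne by blast
  have "(\<Union>k\<in>S. \<psi> k ` F) \<inter> F \<noteq> {}" using iS p psi_in[OF i p] by auto
  moreover have "(\<Union>k\<in>T. \<psi> k ` F) \<inter> F \<noteq> {}" using jT p psi_in[OF j p] by auto
  moreover have "closed (\<Union>k\<in>S. \<psi> k ` F)" "closed (\<Union>k\<in>T. \<psi> k ` F)"
    by (auto intro!: cl simp: S_def T_def)
  ultimately show False using connected_closedD[OF con disj cover] by blast
qed

end

subsection \<open>The Bernoulli measure\<close>

locale bernoulli = pcf +
  fixes \<theta> :: "nat \<Rightarrow> real"
  assumes theta_pos: "\<And>i. i \<in> {1..N} \<Longrightarrow> 0 < \<theta> i" and theta_sum: "(\<Sum>i=1..N. \<theta> i) = 1"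
begin

abbreviation letter :: "nat measure" where
  "letter \<equiv> point_measure {1..N} (\<lambda>i. ennreal (\<theta> i))"
abbreviation word_measure :: "(nat \<Rightarrow> nat) measure" where
  "word_measure \<equiv> Pi\<^sub>M UNIV (\<lambda>_::nat. letter)"
abbreviation \<mu> :: "'a measure" where "\<mu> \<equiv> bernoulli_measure F N \<psi> \<theta>"

lemma prob_letter: "prob_space letter"
proof (rule prob_spaceI)
  have "(\<Sum>i=1..N. ennreal (\<theta> i)) = ennreal 1"
    using theta_pos by (subst sum_ennreal) (auto simp: theta_sum less_imp_le)
  then show "emeasure letter (space letter) = 1"
    by (simp add: space_point_measure emeasure_point_measure_finite)
qed

lemma product_letter: "product_prob_space (\<lambda>_::nat. letter)"
  by (rule product_prob_spaceI) (rule prob_letter)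

lemma space_word: "space word_measure = words N"
  by (auto simp: space_PiM space_point_measure words_def PiE_def Pi_def)

definition cylinder :: "nat list \<Rightarrow> (nat \<Rightarrow> nat) set" where
  "cylinder l = {w \<in> words N. map w [0..<length l] = l}"

lemma cylinder_eq: "cylinder l = {w \<in> space word_measure. \<forall>k\<in>{..<length l}. w k \<in> {l ! k}}"
proof -
  have "map w [0..<length l] = l \<longleftrightarrow> (\<forall>k\<in>{..<length l}. w k \<in> {l ! k})" for w
    by (subst list_eq_iff_nth_eq) auto
  then show ?thesis unfolding cylinder_def space_word by simp
qed

lemma cylinder_sets: "cylinder l \<in> sets word_measure"
proof -
  have "{w \<in> space word_measure. w k \<in> {l ! k}} \<in> sets word_measure" for k
    by (rule sets_Collect_single') (auto simp: sets_point_measure space_point_measure)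
  then show ?thesis unfolding cylinder_eq by (intro sets.sets_Collect_finite_All) auto
qed

lemma emeasure_cylinder:
  assumes "set l \<subseteq> {1..N}" shows "0 < emeasure word_measure (cylinder l)"
proof -
  have l: "l ! k \<in> {1..N}" if "k < length l" for k using assms that nth_mem by blast
  have "emeasure word_measure (cylinder l) = (\<Prod>k<length l. emeasure letter {l ! k})"
    unfolding cylinder_eq using l
    by (intro product_prob_space.emeasure_PiM_Collect[OF product_letter]) (auto simp: sets_point_measure)
  also have "\<dots> = (\<Prod>k<length l. ennreal (\<theta> (l ! k)))"
    using l by (intro prod.cong) (auto simp: emeasure_point_measure_finite)
  also have "\<dots> = ennreal (\<Prod>k<length l. \<theta> (l ! k))"
    using l theta_pos by (intro prod_ennreal) (auto intro: less_imp_le)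
  also have "0 < \<dots>" using l theta_pos by (auto intro!: prod_pos)
  finally show ?thesis .
qed

lemma open_contains_cell:
  assumes U: "open U" and w: "w \<in> words N" "code w \<in> U"
  shows "\<exists>n. wm (map w [0..<n]) ` F \<subseteq> U"
proof -
  obtain e where e: "0 < e" "\<And>y. dist y (code w) < e \<Longrightarrow> y \<in> U"
    using U w(2) unfolding open_dist by blast
  obtain n where n: "\<And>l x' y'. \<lbrakk>n \<le> length l; set l \<subseteq> {1..N}; x' \<in> F; y' \<in> F\<rbrakk>
      \<Longrightarrow> dist (wm l x') (wm l y') < e"
    using small_cells[OF e(1)] by blast
  obtain y where y: "y \<in> F" "code w = wm (map w [0..<n]) y" using code_in_cell[OF w(1)] by blast
  have "dist (wm (map w [0..<n]) x) (code w) < e" if "x \<in> F" for x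
    unfolding y(2) by (intro n prefix_letters w y that) simp
  then show ?thesis using e(2) by blast
qed

lemma cylinder_code: "w \<in> cylinder l \<Longrightarrow> code w \<in> wm l ` F"
  using code_in_cell[of w "length l"] by (auto simp: cylinder_def)

text \<open>An open subset of \<open>F\<close> is a union of cells, and its preimage is the union of their cylinders.\<close>

lemma code_measurable: "code \<in> measurable word_measure (restrict_space borel F)"
proof (rule measurable_restrict_space2)
  show "code \<in> space word_measure \<rightarrow> F" unfolding space_word using code_in by blast
  show "code \<in> borel_measurable word_measure"
  proof (rule borel_measurableI)
    fix U :: "'a set" assume U: "open U"
    define L where "L = {l. set l \<subseteq> {1..N} \<and> wm l ` F \<subseteq> U}"
    have "code -` U \<inter> space word_measure = (\<Union>l\<in>L. cylinder l)"
    proof (intro equalityI subsetI)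
      fix w assume "w \<in> code -` U \<inter> space word_measure"
      then have w: "w \<in> words N" "code w \<in> U" by (auto simp: space_word)
      obtain n where "wm (map w [0..<n]) ` F \<subseteq> U" using open_contains_cell[OF U w] by blast
      then have "map w [0..<n] \<in> L" using prefix_letters[OF w(1)] by (simp add: L_def)
      moreover have "w \<in> cylinder (map w [0..<n])" using w(1) by (simp add: cylinder_def)
      ultimately show "w \<in> (\<Union>l\<in>L. cylinder l)" by blast
    next
      fix w assume "w \<in> (\<Union>l\<in>L. cylinder l)"
      then obtain l where l: "l \<in> L" "w \<in> cylinder l" by blast
      then have "code w \<in> U" using cylinder_code[OF l(2)] by (auto simp: L_def)
      moreover have "w \<in> words N" using l(2) by (simp add: cylinder_def)
      ultimately show "w \<in> code -` U \<inter> space word_measure" by (simp add: space_word)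
    qed
    moreover have "(\<Union>l\<in>L. cylinder l) \<in> sets word_measure"
      by (intro sets.countable_UN' countable_subset[OF subset_UNIV[of L]])
        (auto intro: cylinder_sets)
    ultimately show "code -` U \<inter> space word_measure \<in> sets word_measure" by simp
  qed
qed

lemma sets_bernoulli: "sets \<mu> = sets (restrict_space borel F)"
  by (simp add: bernoulli_measure_def)

lemma prob_bernoulli: "prob_space \<mu>"
  unfolding bernoulli_measure_def by (rule prob_space.prob_space_distr[OF prob_space_PiM[OF prob_letter] code_measurable])

text \<open>A nonempty open set contains a cell, and the measure of the cylinder of that cell is a finite
  product of positive weights.\<close>

lemma full_support_bernoulli: "full_support \<mu>"
  unfolding full_support_def
proof (intro allI impI)
  fix U :: "'a set" assume U: "open U \<and> U \<inter> space \<mu> \<noteq> {}"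
  have sp: "space \<mu> = F" by (simp add: bernoulli_measure_def space_restrict_space)
  then obtain x where x: "x \<in> U" "x \<in> F" using U by auto
  obtain w where w: "w \<in> words N" "code w = x" using code_surj[OF x(2)] by blast
  then obtain n where n: "wm (map w [0..<n]) ` F \<subseteq> U" using open_contains_cell[of U w] U x by auto
  let ?l = "map w [0..<n]"
  have UF: "U \<inter> F \<in> sets (restrict_space borel F)"
    using U by (auto simp: sets_restrict_space Int_commute)
  have "0 < emeasure word_measure (cylinder ?l)" by (intro emeasure_cylinder prefix_letters w)
  also have "\<dots> \<le> emeasure word_measure (code -` (U \<inter> F) \<inter> space word_measure)"
  proof (rule emeasure_mono)
    show "cylinder ?l \<subseteq> code -` (U \<inter> F) \<inter> space word_measure"
      using cylinder_code[of _ ?l] n code_in by (auto simp: cylinder_def space_word)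
  qed (rule measurable_sets[OF code_measurable UF])
  also have "\<dots> = emeasure \<mu> (U \<inter> space \<mu>)"
    unfolding sp unfolding bernoulli_measure_def
    by (rule emeasure_distr[OF code_measurable UF, symmetric])
  finally show "0 < emeasure \<mu> (U \<inter> space \<mu>)" .
qed

end

section \<open>The parameter dynamics\<close>

lemma rational_has_derivative:
  assumes "rational_on_positives f" "0 < v"
  shows "(f has_real_derivative deriv f v) (at v)"
proof -
  obtain p q where pq: "\<And>v. 0 < v \<Longrightarrow> poly q v \<noteq> 0 \<and> f v = poly p v / poly q v"
    using assms(1) unfolding rational_on_positives_def by blast
  have "((\<lambda>v. poly p v / poly q v) has_real_derivative
      (poly (pderiv p) v * poly q v - poly p v * poly (pderiv q) v) / (poly q v * poly q v)) (at v)"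
    using pq[OF assms(2)] by (intro DERIV_divide poly_DERIV) auto
  then have "(f has_real_derivative
      (poly (pderiv p) v * poly q v - poly p v * poly (pderiv q) v) / (poly q v * poly q v)) (at v)"
    by (rule has_field_derivative_transform_within_open[of _ _ _ "{0<..}"]) (use pq assms in auto)
  then show ?thesis by (simp add: DERIV_imp_deriv)
qed

lemma rational_deriv:
  assumes "rational_on_positives f" shows "rational_on_positives (deriv f)"
proof -
  obtain p q where pq: "\<And>v. 0 < v \<Longrightarrow> poly q v \<noteq> 0 \<and> f v = poly p v / poly q v"
    using assms(1) unfolding rational_on_positives_def by blast
  have "deriv f v = poly (pderiv p * q - p * pderiv q) v / poly (q * q) v" if v: "0 < v" for v
  proof (rule DERIV_imp_deriv)
    have "((\<lambda>v. poly p v / poly q v) has_real_derivative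
        poly (pderiv p * q - p * pderiv q) v / poly (q * q) v) (at v)"
      using pq[OF v] DERIV_divide[OF poly_DERIV[of p v] poly_DERIV[of q v]] by simp
    then show "(f has_real_derivative poly (pderiv p * q - p * pderiv q) v / poly (q * q) v) (at v)"
      by (rule has_field_derivative_transform_within_open[of _ _ _ "{0<..}"]) (use pq v in auto)
  qed
  then show ?thesis unfolding rational_on_positives_def
    by (intro exI[of _ "pderiv p * q - p * pderiv q"] exI[of _ "q * q"]) (use pq in auto)
qed

lemma rational_diff_poly:
  assumes "rational_on_positives f" shows "rational_on_positives (\<lambda>v. f v - poly s v)"
proof -
  obtain p q where pq: "\<And>v. 0 < v \<Longrightarrow> poly q v \<noteq> 0 \<and> f v = poly p v / poly q v"
    using assms(1) unfolding rational_on_positives_def by blast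
  then show ?thesis unfolding rational_on_positives_def
    by (intro exI[of _ "p - s * q"] exI[of _ q]) (auto simp: field_simps)
qed

lemma rational_zeros:
  assumes "rational_on_positives f" "0 < a" "f a \<noteq> 0" shows "finite {v. v > 0 \<and> f v = 0}"
proof -
  obtain p q where pq: "\<And>v. 0 < v \<Longrightarrow> poly q v \<noteq> 0 \<and> f v = poly p v / poly q v"
    using assms(1) unfolding rational_on_positives_def by blast
  have "p \<noteq> 0" using pq[OF assms(2)] assms(3) by auto
  moreover have "{v. v > 0 \<and> f v = 0} \<subseteq> {v. poly p v = 0}" using pq by auto
  ultimately show ?thesis using poly_roots_finite finite_subset by blast
qed

text \<open>The part of iterability that concerns only the two rational functions of the parameter.\<close>

locale parameter_dynamics =
  fixes N :: nat and r :: "nat \<Rightarrow> real" and \<rho> \<alpha> :: "real \<Rightarrow> real" and \<beta> :: real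
  assumes N_pos: "1 \<le> N" and r_pos: "\<And>i. i \<in> {1..N} \<Longrightarrow> 0 < r i"
    and \<rho>_rational: "rational_on_positives \<rho>" and \<alpha>_rational: "rational_on_positives \<alpha>"
    and \<rho>_pos: "\<And>v. 0 < v \<Longrightarrow> 0 < \<rho> v"
    and regular: "\<exists>u\<ge>0. bdd_above ((\<lambda>v. inverse (\<rho> v)) ` {u<..}) \<and>
        max_weight N r * (SUP v\<in>{u<..}. inverse (\<rho> v)) < 1"
    and \<alpha>_infinity: "filterlim \<alpha> at_top at_top"
    and \<beta>: "1 < \<beta>" "((\<lambda>v. \<alpha> v / v) \<longlongrightarrow> 1 / \<beta>) at_top"
begin

abbreviation "rmax \<equiv> max_weight N r"
abbreviation "vm \<equiv> v_min N r \<rho> \<alpha>"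
abbreviation "ai \<equiv> alpha_inv N r \<rho> \<alpha>"

lemma r_le_rmax: "i \<in> {1..N} \<Longrightarrow> r i \<le> rmax" unfolding max_weight_def by (intro Max_ge) auto

lemma rmax_pos: "0 < rmax"
  using r_pos[of 1] r_le_rmax[of 1] N_pos by (metis atLeastAtMost_iff le_refl less_le_trans)

lemma eventually_regular: "\<exists>s<1. \<exists>u\<ge>0. \<forall>v>u. rmax / \<rho> v \<le> s"
proof -
  obtain u where u: "0 \<le> u" "bdd_above ((\<lambda>v. inverse (\<rho> v)) ` {u<..})"
      "rmax * (SUP v\<in>{u<..}. inverse (\<rho> v)) < 1"
    using regular by blast
  have "rmax / \<rho> v \<le> rmax * (SUP v\<in>{u<..}. inverse (\<rho> v))" if "v > u" for v
    unfolding divide_inverse using that rmax_pos u(2) by (intro mult_left_mono cSUP_upper) auto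
  then show ?thesis using u(1,3) by blast
qed

lemma eventually_below: "\<exists>u>0. \<forall>v>u. \<alpha> v < v"
proof -
  have "eventually (\<lambda>v. \<alpha> v / v < 1) at_top"
    using \<beta> by (intro order_tendstoD(2)[OF \<beta>(2)]) (simp add: field_simps)
  then obtain u where u: "\<And>v. v \<ge> u \<Longrightarrow> \<alpha> v / v < 1" unfolding eventually_at_top_linorder by blast
  have "\<alpha> v < v" if "v > max u 1" for v using u[of v] that by (simp add: field_simps)
  then show ?thesis by (intro exI[of _ "max u 1"]) auto
qed

lemma \<alpha>_large: "\<exists>w>u. c < \<alpha> w"
proof -
  have "eventually (\<lambda>w. c < \<alpha> w \<and> u < w) at_top"
    using \<alpha>_infinity by (intro eventually_conj eventually_gt_at_top) (simp add: filterlim_at_top_dense)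
  then show ?thesis using eventually_happens[of _ "at_top :: real filter"] by fastforce
qed

text \<open>None of the three conditions that define \<open>v_min\<close> holds identically, so each has finitely many
  solutions, and the maximum is a genuine one.\<close>

lemma vm_finite: "finite ({v. v > 0 \<and> deriv \<alpha> v = 0} \<union> {v. v > 0 \<and> \<alpha> v = v} \<union>
    {v. v > 0 \<and> \<rho> v = rmax} \<union> {0})"
proof -
  have "\<exists>a>0. deriv \<alpha> a \<noteq> 0"
  proof (rule ccontr)
    assume "\<not> (\<exists>a>0. deriv \<alpha> a \<noteq> 0)"
    then have "(\<alpha> has_field_derivative 0) (at x within {0<..})" if "x \<in> {0<..}" for x
      using rational_has_derivative[OF \<alpha>_rational, of x] that
      by (auto intro: has_field_derivative_at_within)
    then obtain c where c: "\<And>x. x \<in> {0<..} \<Longrightarrow> \<alpha> x = c"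
      using has_field_derivative_zero_constant[of "{0<..}" \<alpha>] by auto
    obtain w where "w > 0" "c < \<alpha> w" using \<alpha>_large by blast
    then show False using c[of w] by simp
  qed
  then have 1: "finite {v. v > 0 \<and> deriv \<alpha> v = 0}"
    using rational_zeros[OF rational_deriv[OF \<alpha>_rational]] by blast
  obtain u where u: "u > 0" "\<And>v. v > u \<Longrightarrow> \<alpha> v < v" using eventually_below by blast
  have "finite {v. v > 0 \<and> \<alpha> v - poly [:0, 1:] v = 0}"
    using u(1) u(2)[of "u + 1"]
    by (intro rational_zeros[OF rational_diff_poly[OF \<alpha>_rational], of "u + 1"]) auto
  then have 2: "finite {v. v > 0 \<and> \<alpha> v = v}" by simp
  obtain s u where s: "s < 1" "0 \<le> u" "\<And>v. v > u \<Longrightarrow> rmax / \<rho> v \<le> s"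
    using eventually_regular by blast
  have "\<rho> (u + 1) \<noteq> rmax" using s(1) s(3)[of "u + 1"] rmax_pos by auto
  then have "finite {v. v > 0 \<and> \<rho> v - poly [:rmax:] v = 0}"
    using s(2) by (intro rational_zeros[OF rational_diff_poly[OF \<rho>_rational], of "u + 1"]) auto
  then have 3: "finite {v. v > 0 \<and> \<rho> v = rmax}" by simp
  show ?thesis using 1 2 3 by simp
qed

lemma vm_nonneg: "0 \<le> vm" unfolding v_min_def by (rule Max_ge[OF vm_finite]) simp

lemma above_vm:
  assumes "vm < v"
  shows vm_pos: "0 < v" and deriv_nonzero: "deriv \<alpha> v \<noteq> 0" and not_fixed: "\<alpha> v \<noteq> v"
    and \<rho>_not_rmax: "\<rho> v \<noteq> rmax"
proof -
  show v: "0 < v" using vm_nonneg assms by linarith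
  have "v \<notin> {v. v > 0 \<and> deriv \<alpha> v = 0} \<union> {v. v > 0 \<and> \<alpha> v = v} \<union> {v. v > 0 \<and> \<rho> v = rmax} \<union> {0}"
    using Max_ge[OF vm_finite, of v] assms unfolding v_min_def by fastforce
  then show "deriv \<alpha> v \<noteq> 0" "\<alpha> v \<noteq> v" "\<rho> v \<noteq> rmax" using v by auto
qed

lemma continuous_on_above_vm:
  assumes "rational_on_positives f" "vm < a" shows "continuous_on {a..b} f"
proof (intro continuous_at_imp_continuous_on ballI)
  fix x assume "x \<in> {a..b}"
  then have "0 < x" using vm_pos[of x] assms(2) by simp
  then show "isCont f x" using rational_has_derivative[OF assms(1)] DERIV_isCont by blast
qed

text \<open>Since \<open>\<alpha> v / v\<close> tends to \<open>1 / \<beta> < 1\<close>, a point with \<open>\<alpha> v \<ge> v\<close> would be followed by a fixed point.\<close>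

lemma \<alpha>_below: assumes "vm < v" shows "\<alpha> v < v"
proof (rule ccontr)
  assume "\<not> \<alpha> v < v"
  obtain u where u: "u > 0" "\<And>v. v > u \<Longrightarrow> \<alpha> v < v" using eventually_below by blast
  define w where "w = max u v + 1"
  have w: "w > u" "w > v" by (auto simp: w_def)
  have "continuous_on {v..w} (\<lambda>x. \<alpha> x - x)"
    by (intro continuous_intros continuous_on_above_vm \<alpha>_rational assms)
  then obtain x where "v \<le> x" "x \<le> w" "\<alpha> x - x = 0"
    using IVT2'[of "\<lambda>x. \<alpha> x - x" w 0 v] u(2)[OF w(1)] \<open>\<not> \<alpha> v < v\<close> w(2) by auto
  then show False using not_fixed[of x] assms by auto
qed

text \<open>If \<open>\<alpha>\<close> took a value twice, or decreased and then came back on its way to infinity, its derivative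
  would vanish in between.\<close>

lemma \<alpha>_strict_mono: assumes "vm < a" "a < b" shows "\<alpha> a < \<alpha> b"
proof (rule ccontr)
  assume ab: "\<not> \<alpha> a < \<alpha> b"
  obtain c where c: "b < c" "\<alpha> a < \<alpha> c" using \<alpha>_large by blast
  obtain d where d: "b \<le> d" "d \<le> c" "\<alpha> d = \<alpha> a"
    using IVT'[of \<alpha> b "\<alpha> a" c] ab c continuous_on_above_vm[OF \<alpha>_rational, of b c] assms by auto
  have diff: "\<alpha> differentiable (at x)" if "a < x" "x < d" for x
    using rational_has_derivative[OF \<alpha>_rational, of x] vm_pos[of x] that assms
    unfolding real_differentiable_def by fastforce
  obtain z where z: "a < z" "z < d" "(\<alpha> has_real_derivative 0) (at z)"
    using Rolle[of a d \<alpha>] d assms diff continuous_on_above_vm[OF \<alpha>_rational assms(1), of d] by auto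
  show False using deriv_nonzero[of z] DERIV_imp_deriv[OF z(3)] z(1) assms(1) by simp
qed

text \<open>The inverse image of \<open>v\<close> is found to the right of \<open>v\<close>, where \<open>\<alpha>\<close> climbs from a value below \<open>v\<close>
  to infinity.\<close>

lemma ai: assumes "vm < v" shows ai_greater: "v < ai v" and \<alpha>_ai: "\<alpha> (ai v) = v"
proof -
  obtain w where w: "v < w" "v < \<alpha> w" using \<alpha>_large by blast
  obtain x where x: "v \<le> x" "x \<le> w" "\<alpha> x = v"
    using IVT'[of \<alpha> v v w] \<alpha>_below[OF assms] w continuous_on_above_vm[OF \<alpha>_rational assms, of w]
    by auto
  have "inj_on \<alpha> {vm<..}"
    by (rule linorder_inj_onI) (use \<alpha>_strict_mono in \<open>auto simp: less_le\<close>)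
  then have "ai v = x" unfolding alpha_inv_def
    by (rule the_inv_into_f_eq) (use x assms in auto)
  then show "v < ai v" "\<alpha> (ai v) = v" using x not_fixed[OF assms] by (auto simp: less_le)
qed

lemma ai_above_vm: "vm < v \<Longrightarrow> vm < ai v" using ai_greater[of v] by linarith

text \<open>The scaling factors \<open>r i / \<rho> w\<close> stay below a constant smaller than 1 beyond \<open>v\<close>: near
  infinity by asymptotic regularity, and on compact intervals because \<open>\<rho>\<close> never meets \<open>rmax\<close>.\<close>

lemma uniform_contraction:
  assumes v: "vm < v" shows "\<exists>c. 0 < c \<and> c < 1 \<and> (\<forall>w\<ge>v. rmax / \<rho> w \<le> c)"
proof -
  obtain s u where s: "s < 1" "0 \<le> u" "\<And>v. v > u \<Longrightarrow> rmax / \<rho> v \<le> s"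
    using eventually_regular by blast
  define w where "w = max u v + 1"
  have w: "w > u" "w > v" by (auto simp: w_def)
  have big: "rmax < \<rho> x" if "u < x" "0 < x" for x
  proof -
    have "rmax / \<rho> x < 1" using s(1) s(3)[OF that(1)] by linarith
    then show ?thesis using \<rho>_pos[OF that(2)] by (simp add: field_simps)
  qed
  have gt: "rmax < \<rho> x" if "v \<le> x" for x
  proof (rule ccontr)
    assume "\<not> rmax < \<rho> x"
    define y where "y = max u x + 1"
    have y: "u < y" "x < y" "0 < y" using s(2) by (auto simp: y_def)
    have x: "vm < x" using that v by simp
    obtain z where "x \<le> z" "z \<le> y" "\<rho> z = rmax"
      using IVT'[of \<rho> x rmax y] \<open>\<not> rmax < \<rho> x\<close> big[of y] y
        continuous_on_above_vm[OF \<rho>_rational x, of y] by auto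
    then show False using \<rho>_not_rmax[of z] x by auto
  qed
  have "continuous_on {v..w} \<rho>" by (rule continuous_on_above_vm[OF \<rho>_rational v])
  then obtain m where m: "m \<in> {v..w}" "\<And>x. x \<in> {v..w} \<Longrightarrow> \<rho> m \<le> \<rho> x"
    using continuous_attains_inf[of "{v..w}" \<rho>] w(2) by auto
  define c where "c = max s (rmax / \<rho> m)"
  have gm: "rmax < \<rho> m" using gt m(1) by simp
  have "c < 1" using s(1) gm rmax_pos by (simp add: c_def)
  moreover have "0 < c" using gm rmax_pos by (simp add: c_def less_max_iff_disj)
  moreover have "rmax / \<rho> x \<le> c" if x: "v \<le> x" for x
  proof (cases "x \<le> w")
    case True
    then have "rmax / \<rho> x \<le> rmax / \<rho> m"
      using m(2)[of x] x gm rmax_pos by (intro divide_left_mono) auto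
    then show ?thesis by (simp add: c_def)
  next
    case False
    then show ?thesis using s(3)[of x] w(1) by (simp add: c_def)
  qed
  ultimately show ?thesis by blast
qed

end

section \<open>Iterated forms\<close>

lemma finite_form_scale_conductances:
  "finite_form V (\<lambda>x y. c * a x y) f g = c * finite_form V a f g"
  unfolding finite_form_def by (simp add: sum_distrib_left algebra_simps)

lemma edge_le_energy:
  assumes "finite V" "x \<in> V" "y \<in> V" "\<And>x y. 0 \<le> a x y"
  shows "a x y * (f x - f y)\<^sup>2 \<le> 2 * finite_form V a f f"
proof -
  have nn: "0 \<le> a p q * (f p - f q)\<^sup>2" for p q using assms(4) by simp
  have "a x y * (f x - f y)\<^sup>2 \<le> (\<Sum>q\<in>V. a x q * (f x - f q)\<^sup>2)"
    using assms(1,3) nn by (intro member_le_sum[of y V "\<lambda>q. a x q * (f x - f q)\<^sup>2"]) auto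
  also have "\<dots> \<le> (\<Sum>p\<in>V. \<Sum>q\<in>V. a p q * (f p - f q)\<^sup>2)"
    using assms(1,2) nn
    by (intro member_le_sum[of x V "\<lambda>p. \<Sum>q\<in>V. a p q * (f p - f q)\<^sup>2"]) (auto intro: sum_nonneg)
  also have "\<dots> = 2 * finite_form V a f f"
    unfolding finite_form_def by (simp add: power2_eq_square mult.assoc)
  finally show ?thesis .
qed

text \<open>Truncation to the range of the boundary values decreases the energy, so the infimum in the
  trace may be taken over a compact product of intervals.  It is attained there, by a function that
  satisfies the maximum principle.\<close>

lemma trace_minimizer:
  assumes H: "finite H" "H \<noteq> {}" and a: "\<And>x y. 0 \<le> a x y"
  shows "\<exists>g. (\<forall>x\<in>H. g x = h x) \<and> finite_form V a g g = form_trace H (finite_form V a) h \<and>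
    (\<forall>x. \<exists>y\<in>H. \<exists>z\<in>H. h y \<le> g x \<and> g x \<le> h z)"
proof -
  let ?E = "\<lambda>g. finite_form V a g g"
  define m M where "m = Min (h ` H)" and "M = Max (h ` H)"
  have mM: "m \<le> h x" "h x \<le> M" if "x \<in> H" for x
    using H(1) that by (auto simp: m_def M_def)
  have "m \<in> h ` H" "M \<in> h ` H" unfolding m_def M_def using H by (auto intro!: Min_in Max_in)
  then obtain y z where yz: "y \<in> H" "h y = m" "z \<in> H" "h z = M" by blast
  define C where "C = PiE UNIV (\<lambda>x. if x \<in> H then {h x} else {m..M})"
  have C_iff: "g \<in> C \<longleftrightarrow> (\<forall>x\<in>H. g x = h x) \<and> (\<forall>x. x \<notin> H \<longrightarrow> m \<le> g x \<and> g x \<le> M)" for g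
    unfolding C_def by (auto simp: PiE_iff split: if_splits)
  have "compactin (product_topology (\<lambda>_. euclidean) UNIV) C"
    unfolding C_def by (subst compactin_PiE) auto
  then have "compact C" by (simp add: euclidean_product_topology)
  moreover have "C \<noteq> {}"
  proof -
    have "(\<lambda>x. if x \<in> H then h x else m) \<in> C" using mM[OF yz(3)] yz by (auto simp: C_iff)
    then show ?thesis by blast
  qed
  moreover have "continuous_on C ?E"
    unfolding finite_form_def
    by (intro continuous_intros continuous_on_subset[OF continuous_on_product_coordinates subset_UNIV])
  ultimately have "\<exists>g\<in>C. \<forall>g'\<in>C. ?E g \<le> ?E g'" by (rule continuous_attains_inf)
  then obtain g where g: "g \<in> C" "\<And>g'. g' \<in> C \<Longrightarrow> ?E g \<le> ?E g'" by blast
  have gH: "\<forall>x\<in>H. g x = h x" using g(1) by (simp add: C_iff)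
  have min: "?E g \<le> ?E g'" if "\<forall>x\<in>H. g' x = h x" for g'
  proof -
    let ?t = "\<lambda>x. min (max (g' x) m) M"
    have "?t x = h x" if "x \<in> H" for x using mM[OF that] \<open>\<forall>x\<in>H. g' x = h x\<close> that by simp
    then have "?t \<in> C" using mM[OF yz(1)] yz by (auto simp: C_iff)
    then have "?E g \<le> ?E ?t" by (rule g(2))
    also have "?E ?t \<le> ?E g'" by (rule finite_form_contraction[OF a]) (auto simp: min_def max_def)
    finally show ?thesis .
  qed
  have "form_trace H (finite_form V a) h = ?E g"
    unfolding form_trace_def
  proof (rule antisym)
    show "(INF g\<in>{g. \<forall>x\<in>H. g x = h x}. ?E g) \<le> ?E g"
      using gH min by (intro cINF_lower bdd_belowI[of _ "?E g"]) auto
    show "?E g \<le> (INF g\<in>{g. \<forall>x\<in>H. g x = h x}. ?E g)"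
      using gH min by (intro cINF_greatest) auto
  qed
  moreover have "\<exists>y\<in>H. \<exists>z\<in>H. h y \<le> g x \<and> g x \<le> h z" for x
  proof (cases "x \<in> H")
    case True then show ?thesis using gH by (intro bexI[of _ x]) auto
  next
    case False
    then have "h y \<le> g x \<and> g x \<le> h z" using g(1) yz by (simp add: C_iff)
    then show ?thesis using yz by blast
  qed
  ultimately show ?thesis using gH by auto
qed

context pcf
begin

text \<open>An edge between \<open>x\<close> and \<open>y\<close> collects the conductances of all copies \<open>\<psi> i ` W\<close> that contain both
  points, each scaled by \<open>inverse (r i)\<close>.\<close>

definition replicated_conductances ::
    "'a set \<Rightarrow> (nat \<Rightarrow> real) \<Rightarrow> ('a \<Rightarrow> 'a \<Rightarrow> real) \<Rightarrow> 'a \<Rightarrow> 'a \<Rightarrow> real" where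
  "replicated_conductances W r a x y =
    (\<Sum>i\<in>{1..N}. if x \<in> \<psi> i ` W \<and> y \<in> \<psi> i ` W
      then inverse (r i) * a (inv_into W (\<psi> i) x) (inv_into W (\<psi> i) y) else 0)"

lemma replication_finite_form:
  assumes W: "W \<subseteq> F" "finite W"
  shows "replication N \<psi> r (finite_form W a) =
    finite_form (\<Union>i\<in>{1..N}. \<psi> i ` W) (replicated_conductances W r a)"
proof (intro ext)
  fix f g :: "'a \<Rightarrow> real"
  let ?U = "\<Union>i\<in>{1..N}. \<psi> i ` W"
  let ?D = "\<lambda>x y. (f x - f y) * (g x - g y)"
  let ?T = "\<lambda>i x y. inverse (r i) * a (inv_into W (\<psi> i) x) (inv_into W (\<psi> i) y) * ?D x y"
  have finU: "finite ?U" using W(2) by auto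
  have 1: "inverse (r i) * finite_form W a (f \<circ> \<psi> i) (g \<circ> \<psi> i)
      = 1/2 * (\<Sum>x\<in>?U. \<Sum>y\<in>?U. if x \<in> \<psi> i ` W \<and> y \<in> \<psi> i ` W then ?T i x y else 0)"
    if i: "i \<in> {1..N}" for i
  proof -
    have inj: "inj_on (\<psi> i) W" using psi_inj[OF i] W(1) by (rule inj_on_subset)
    have sub: "\<psi> i ` W \<subseteq> ?U" using i by blast
    have "(\<Sum>x\<in>?U. \<Sum>y\<in>?U. if x \<in> \<psi> i ` W \<and> y \<in> \<psi> i ` W then ?T i x y else 0)
        = (\<Sum>x\<in>\<psi> i ` W. \<Sum>y\<in>?U. if x \<in> \<psi> i ` W \<and> y \<in> \<psi> i ` W then ?T i x y else 0)"
      using sub by (intro sum.mono_neutral_right[OF finU]) auto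
    also have "\<dots> = (\<Sum>x\<in>\<psi> i ` W. \<Sum>y\<in>\<psi> i ` W. ?T i x y)"
      using sub by (intro sum.cong refl sum.mono_neutral_cong_right[OF finU]) auto
    also have "\<dots> = (\<Sum>x\<in>W. \<Sum>y\<in>W. ?T i (\<psi> i x) (\<psi> i y))"
      by (simp add: sum.reindex[OF inj])
    also have "\<dots> = (\<Sum>x\<in>W. \<Sum>y\<in>W. inverse (r i) * (a x y * ?D (\<psi> i x) (\<psi> i y)))"
      by (intro sum.cong refl) (simp add: inv_into_f_f[OF inj])
    finally show ?thesis
      unfolding finite_form_def by (simp add: sum_distrib_left mult.assoc)
  qed
  have "replication N \<psi> r (finite_form W a) f g
      = (\<Sum>i\<in>{1..N}. 1/2 * (\<Sum>x\<in>?U. \<Sum>y\<in>?U. if x \<in> \<psi> i ` W \<and> y \<in> \<psi> i ` W then ?T i x y else 0))"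
    unfolding replication_def by (rule sum.cong[OF refl 1])
  also have "\<dots> = 1/2 * (\<Sum>x\<in>?U. \<Sum>y\<in>?U. \<Sum>i\<in>{1..N}.
      if x \<in> \<psi> i ` W \<and> y \<in> \<psi> i ` W then ?T i x y else 0)"
    unfolding sum_distrib_left[symmetric]
    by (subst sum.swap, rule arg_cong[where f="\<lambda>t. 1/2 * t"], rule sum.cong[OF refl], rule sum.swap)
  also have "\<dots> = finite_form ?U (replicated_conductances W r a) f g"
    unfolding finite_form_def replicated_conductances_def sum_distrib_right mult.assoc
    by (intro arg_cong[where f="\<lambda>t. 1/2 * t"] sum.cong refl) simp
  finally show "replication N \<psi> r (finite_form W a) f g
      = finite_form ?U (replicated_conductances W r a) f g" .
qed

end

text \<open>The form of level \<open>n + 1\<close> with parameter \<open>u\<close> consists of scaled copies of the form of level \<open>n\<close>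
  with parameter \<open>ai u > u\<close>.  Inductions on the level therefore treat all parameters at once, and
  constants must be uniform on \<open>{v..}\<close>, a set that \<open>ai\<close> maps into itself.\<close>

locale iterated_forms = pcf F N \<psi> + parameter_dynamics N r \<rho> \<alpha> \<beta>
  for F :: "'a::metric_space set" and N \<psi> r \<rho> \<alpha> \<beta> +
  fixes A B :: "('a \<times> 'a) set" and v :: real
  assumes connected_F: "connected F"
    and family: "one_parameter_family F N \<psi> r A B \<rho> \<alpha>"
    and v: "v_min N r \<rho> \<alpha> < v"
begin

abbreviation cond :: "real \<Rightarrow> 'a \<Rightarrow> 'a \<Rightarrow> real" where "cond \<equiv> family_conductance A B"
abbreviation L :: "real \<Rightarrow> nat \<Rightarrow> 'a form" where "L \<equiv> level_form F N \<psi> r A B \<rho> \<alpha>"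

lemma V0_ne: "V 0 \<noteq> {}"
  using family unfolding one_parameter_family_def by blast

lemma cond_nonneg: "0 < u \<Longrightarrow> 0 \<le> cond u x y"
  by (simp add: family_conductance_def)

lemma renormalization_eq:
  assumes "vm < u"
  shows "form_trace (V 0) (replication N \<psi> r (finite_form (V 0) (cond (ai u)))) h
    = inverse (\<rho> (ai u)) * finite_form (V 0) (cond u) h h"
proof -
  have "renormalization F N \<psi> r (family_form F N \<psi> A B w) h =
      inverse (\<rho> w) * family_form F N \<psi> A B (\<alpha> w) h h" if "0 < w" for w
    using family that unfolding one_parameter_family_def by blast
  from this[of "ai u"] show ?thesis
    using vm_pos[OF ai_above_vm[OF assms]] \<alpha>_ai[OF assms]
    by (simp add: renormalization_def family_form_def)
qed

lemma L_0: "L u 0 = finite_form (V 0) (cond u)"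
  by (intro ext) (simp add: level_form_def rho_prod_def family_form_def)

lemma L_Suc: "L u (Suc n) f g =
  \<rho> (ai u) * (\<Sum>i=1..N. inverse (r i) * L (ai u) n (f \<circ> \<psi> i) (g \<circ> \<psi> i))"
proof -
  define E where "E = (replication N \<psi> r ^^ n) (family_form F N \<psi> A B ((ai ^^ n) (ai u)))"
  have L: "L (ai u) n f' g' = rho_prod N r \<rho> \<alpha> n (ai u) * E f' g'" for f' g'
    by (simp add: level_form_def E_def)
  have "(ai ^^ Suc n) u = (ai ^^ n) (ai u)" by (simp add: funpow_swap1)
  then have "L u (Suc n) f g = rho_prod N r \<rho> \<alpha> (Suc n) u * replication N \<psi> r E f g"
    by (simp add: level_form_def E_def)
  also have "rho_prod N r \<rho> \<alpha> (Suc n) u = \<rho> (ai u) * rho_prod N r \<rho> \<alpha> n (ai u)"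
    unfolding rho_prod_def One_nat_def prod.atLeast1_atMost_eq prod.lessThan_Suc_shift
    by (simp add: funpow_swap1)
  finally show ?thesis by (simp add: L replication_def sum_distrib_left mult_ac)
qed

lemma \<rho>_ai_pos: "vm < u \<Longrightarrow> 0 < \<rho> (ai u)"
  by (intro \<rho>_pos vm_pos ai_above_vm)

text \<open>Replication keeps the form a sum over edges with nonnegative conductances, and each step puts
  the endpoints of an edge into a common cell of the next level.\<close>

lemma L_conductances:
  assumes "vm < u"
  shows "\<exists>b. (\<forall>x y. 0 \<le> b x y) \<and> L u n = finite_form (V n) b \<and>
    (\<forall>x y. b x y \<noteq> 0 \<longrightarrow> (\<exists>l. length l = n \<and> set l \<subseteq> {1..N} \<and> x \<in> wm l ` F \<and> y \<in> wm l ` F))"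
  using assms
proof (induction n arbitrary: u)
  case 0
  have "x \<in> F \<and> y \<in> F" if "cond u x y \<noteq> 0" for x y
  proof -
    have "(x, y) \<in> A \<union> B" using that by (auto simp: family_conductance_def split: if_splits)
    then show ?thesis using family V_sub[of 0] unfolding one_parameter_family_def by blast
  qed
  then show ?case using cond_nonneg[OF vm_pos[OF 0]] L_0 by (intro exI[of _ "cond u"]) auto
next
  case (Suc n)
  obtain b where b: "\<And>x y. 0 \<le> b x y" "L (ai u) n = finite_form (V n) b"
    "\<And>x y. b x y \<noteq> 0 \<Longrightarrow> \<exists>l. length l = n \<and> set l \<subseteq> {1..N} \<and> x \<in> wm l ` F \<and> y \<in> wm l ` F"
    using Suc.IH[OF ai_above_vm[OF Suc.prems]] by blast
  let ?b = "\<lambda>x y. \<rho> (ai u) * replicated_conductances (V n) r b x y"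
  have "L u (Suc n) f g = finite_form (V (Suc n)) ?b f g" for f g
    using fun_cong[OF fun_cong[OF replication_finite_form[OF V_sub finite_V, where r=r and a=b]]]
    by (simp add: L_Suc b(2) V_Suc finite_form_scale_conductances replication_def)
  moreover have "0 \<le> ?b x y" for x y
    unfolding replicated_conductances_def using b(1) \<rho>_ai_pos[OF Suc.prems] r_pos
    by (intro mult_nonneg_nonneg sum_nonneg) (auto simp: less_imp_le)
  moreover have "\<exists>l. length l = Suc n \<and> set l \<subseteq> {1..N} \<and> x \<in> wm l ` F \<and> y \<in> wm l ` F"
    if "?b x y \<noteq> 0" for x y
  proof -
    have "replicated_conductances (V n) r b x y \<noteq> 0" using that by auto
    then obtain i where i: "i \<in> {1..N}" "(if x \<in> \<psi> i ` V n \<and> y \<in> \<psi> i ` V n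
        then inverse (r i) * b (inv_into (V n) (\<psi> i) x) (inv_into (V n) (\<psi> i) y) else 0) \<noteq> 0"
      unfolding replicated_conductances_def by (rule sum.not_neutral_contains_not_neutral)
    then have i: "i \<in> {1..N}" "x \<in> \<psi> i ` V n" "y \<in> \<psi> i ` V n"
        "b (inv_into (V n) (\<psi> i) x) (inv_into (V n) (\<psi> i) y) \<noteq> 0"
      by (auto split: if_splits)
    have "\<psi> i (inv_into (V n) (\<psi> i) x) = x" "\<psi> i (inv_into (V n) (\<psi> i) y) = y"
      using i(2,3) by (simp_all add: f_inv_into_f)
    moreover obtain l where "length l = n" "set l \<subseteq> {1..N}"
        "inv_into (V n) (\<psi> i) x \<in> wm l ` F" "inv_into (V n) (\<psi> i) y \<in> wm l ` F"
      using b(3)[OF i(4)] by blast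
    ultimately show ?thesis using i(1)
      by (intro exI[of _ "i # l"]) (auto simp: image_iff; metis)
  qed
  ultimately show ?case by (intro exI[of _ ?b]) (auto simp: fun_eq_iff)
qed

lemma L_nonneg: "vm < u \<Longrightarrow> 0 \<le> L u n f f"
  using L_conductances[of u n] finite_form_nonneg by metis

lemma L_cong: "vm < u \<Longrightarrow> (\<And>x. x \<in> V n \<Longrightarrow> f x = g x) \<Longrightarrow> L u n f f = L u n g g"
  using L_conductances[of u n] finite_form_cong[of "V n" f g f g] by metis

subsection \<open>Nestedness and harmonic extension\<close>

lemma L_1: "L u (Suc 0) f g = \<rho> (ai u) * replication N \<psi> r (finite_form (V 0) (cond (ai u))) f g"
  by (simp add: L_Suc L_0 replication_def)

text \<open>The renormalization equation with parameter \<open>ai u\<close> says that the trace of the first-level form on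
  the boundary is the boundary form.  The minimizer of the trace is the harmonic extension of \<open>h\<close>, and
  \<open>h\<close> itself is one of its competitors.\<close>

lemma harmonic_one_step:
  assumes u: "vm < u"
  shows "\<exists>g. (\<forall>x\<in>V 0. g x = h x) \<and> L u (Suc 0) g g = L u 0 h h \<and> L u 0 h h \<le> L u (Suc 0) h h \<and>
    (\<forall>x. \<exists>y\<in>V 0. \<exists>z\<in>V 0. h y \<le> g x \<and> g x \<le> h z)"
proof -
  let ?a = "replicated_conductances (V 0) r (cond (ai u))"
  let ?U = "\<Union>i\<in>{1..N}. \<psi> i ` V 0"
  have rep: "replication N \<psi> r (finite_form (V 0) (cond (ai u))) = finite_form ?U ?a"
    by (rule replication_finite_form[OF V_sub finite_V])
  have a: "0 \<le> ?a x y" for x y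
    unfolding replicated_conductances_def using r_pos cond_nonneg[OF vm_pos[OF ai_above_vm[OF u]]]
    by (intro sum_nonneg) (auto simp: less_imp_le)
  have tr: "\<rho> (ai u) * form_trace (V 0) (finite_form ?U ?a) h = L u 0 h h"
    using renormalization_eq[OF u, of h] \<rho>_ai_pos[OF u] by (simp add: rep L_0)
  obtain g where g: "\<forall>x\<in>V 0. g x = h x"
      "finite_form ?U ?a g g = form_trace (V 0) (finite_form ?U ?a) h"
      "\<forall>x. \<exists>y\<in>V 0. \<exists>z\<in>V 0. h y \<le> g x \<and> g x \<le> h z"
    using trace_minimizer[where V="?U" and H="V 0" and a="?a" and h=h, OF finite_V V0_ne a] by blast
  have "form_trace (V 0) (finite_form ?U ?a) h \<le> finite_form ?U ?a h h"
    unfolding form_trace_def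
    by (intro cINF_lower bdd_belowI[of _ 0]) (auto intro: finite_form_nonneg a)
  then have "L u 0 h h \<le> L u (Suc 0) h h"
    unfolding tr[symmetric] L_1 rep using \<rho>_ai_pos[OF u] by simp
  moreover have "L u (Suc 0) g g = L u 0 h h" unfolding L_1 rep g(2) by (rule tr)
  ultimately show ?thesis using g(1,3) by blast
qed

lemma L_mono_Suc: "vm < u \<Longrightarrow> L u n f f \<le> L u (Suc n) f f"
proof (induction n arbitrary: u f)
  case 0
  then show ?case using harmonic_one_step by blast
next
  case (Suc n)
  have step: "inverse (r i) * L (ai u) n (f \<circ> \<psi> i) (f \<circ> \<psi> i)
      \<le> inverse (r i) * L (ai u) (Suc n) (f \<circ> \<psi> i) (f \<circ> \<psi> i)" if "i \<in> {1..N}" for i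
    using Suc.IH[OF ai_above_vm[OF Suc.prems]] r_pos[OF that] by (intro mult_left_mono) auto
  show ?case
    unfolding L_Suc[of u n] L_Suc[of u "Suc n"]
    by (rule mult_left_mono[OF sum_mono[OF step] less_imp_le[OF \<rho>_ai_pos[OF Suc.prems]]])
qed

lemma L_mono: "vm < u \<Longrightarrow> m \<le> n \<Longrightarrow> L u m f f \<le> L u n f f"
  by (rule lift_Suc_mono_le[of "\<lambda>n. L u n f f"]) (rule L_mono_Suc)

text \<open>The one-step extensions on the \<open>n\<close>-cells fit together because different cells meet only in
  points where the values are prescribed.\<close>

lemma harmonic_step:
  "vm < u \<Longrightarrow> \<exists>g. (\<forall>x\<in>V n. g x = h x) \<and> L u (Suc n) g g = L u n h h \<and>
    (\<forall>l x. length l = n \<longrightarrow> set l \<subseteq> {1..N} \<longrightarrow> x \<in> V 1 \<longrightarrow>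
      (\<exists>y\<in>V 0. \<exists>z\<in>V 0. h (wm l y) \<le> g (wm l x) \<and> g (wm l x) \<le> h (wm l z)))"
proof (induction n arbitrary: u h)
  case 0
  then obtain g where "\<forall>x\<in>V 0. g x = h x" "L u (Suc 0) g g = L u 0 h h"
      "\<forall>x. \<exists>y\<in>V 0. \<exists>z\<in>V 0. h y \<le> g x \<and> g x \<le> h z"
    using harmonic_one_step by blast
  then show ?case by (intro exI[of _ g]) auto
next
  case (Suc n)
  have "\<forall>i. \<exists>g. (\<forall>x\<in>V n. g x = (h \<circ> \<psi> i) x) \<and>
      L (ai u) (Suc n) g g = L (ai u) n (h \<circ> \<psi> i) (h \<circ> \<psi> i) \<and>
      (\<forall>l x. length l = n \<longrightarrow> set l \<subseteq> {1..N} \<longrightarrow> x \<in> V 1 \<longrightarrow>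
        (\<exists>y\<in>V 0. \<exists>z\<in>V 0. (h \<circ> \<psi> i) (wm l y) \<le> g (wm l x) \<and> g (wm l x) \<le> (h \<circ> \<psi> i) (wm l z)))"
    using Suc.IH[OF ai_above_vm[OF Suc.prems]] by blast
  then obtain G where G: "\<And>i. (\<forall>x\<in>V n. G i x = (h \<circ> \<psi> i) x) \<and>
      L (ai u) (Suc n) (G i) (G i) = L (ai u) n (h \<circ> \<psi> i) (h \<circ> \<psi> i) \<and>
      (\<forall>l x. length l = n \<longrightarrow> set l \<subseteq> {1..N} \<longrightarrow> x \<in> V 1 \<longrightarrow>
        (\<exists>y\<in>V 0. \<exists>z\<in>V 0. (h \<circ> \<psi> i) (wm l y) \<le> G i (wm l x) \<and>
          G i (wm l x) \<le> (h \<circ> \<psi> i) (wm l z)))"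
    by (rule choice[THEN exE]) blast
  have G_V: "\<And>i x. x \<in> V n \<Longrightarrow> G i x = h (\<psi> i x)"
    and G_L: "\<And>i. L (ai u) (Suc n) (G i) (G i) = L (ai u) n (h \<circ> \<psi> i) (h \<circ> \<psi> i)"
    using G by auto
  have G_bound: "\<exists>y\<in>V 0. \<exists>z\<in>V 0. h (\<psi> i (wm l y)) \<le> G i (wm l x) \<and> G i (wm l x) \<le> h (\<psi> i (wm l z))"
    if "length l = n" "set l \<subseteq> {1..N}" "x \<in> V 1" for i l x
    using G[of i] that unfolding comp_def by blast
  define g where "g x = (SOME t. \<exists>i\<in>{1..N}. \<exists>y\<in>V (Suc n). x = \<psi> i y \<and> t = G i y)" for x
  have consistent: "G i y = G j y'"
    if "i \<in> {1..N}" "j \<in> {1..N}" "y \<in> V (Suc n)" "y' \<in> V (Suc n)" "\<psi> i y = \<psi> j y'" for i j y y'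
  proof -
    have F: "y \<in> F" "y' \<in> F" using that V_sub by blast+
    show ?thesis
    proof (cases "i = j")
      case True
      then have "y = y'" using psi_inj[OF that(1)] that(5) F by (auto dest: inj_onD)
      then show ?thesis using True by simp
    next
      case False
      have "y \<in> V 0" using overlap[of i "[]" j y y'] that False F by simp
      moreover have "y' \<in> V 0" using overlap[of j "[]" i y' y] that False F by simp
      ultimately have "y \<in> V n" "y' \<in> V n" using V_mono[of 0 n] by auto
      then show ?thesis using G_V that(5) by simp
    qed
  qed
  have g: "g (\<psi> i y) = G i y" if "i \<in> {1..N}" "y \<in> V (Suc n)" for i y
  proof -
    have "\<exists>t. \<exists>j\<in>{1..N}. \<exists>y'\<in>V (Suc n). \<psi> i y = \<psi> j y' \<and> t = G j y'" using that by blast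
    from someI_ex[OF this] show ?thesis unfolding g_def using consistent that by metis
  qed
  show ?case
  proof (intro exI[of _ g] conjI ballI allI impI)
    fix x assume "x \<in> V (Suc n)"
    then obtain i y where i: "i \<in> {1..N}" "y \<in> V n" "x = \<psi> i y" unfolding V_Suc by blast
    then show "g x = h x" using g[of i y] G_V[of y i] V_mono_Suc[of n] by auto
  next
    have "L (ai u) (Suc n) (g \<circ> \<psi> i) (g \<circ> \<psi> i) = L (ai u) n (h \<circ> \<psi> i) (h \<circ> \<psi> i)"
      if "i \<in> {1..N}" for i
      using L_cong[OF ai_above_vm[OF Suc.prems], of "Suc n" "g \<circ> \<psi> i" "G i"] g[OF that] G_L by simp
    then show "L u (Suc (Suc n)) g g = L u (Suc n) h h"
      unfolding L_Suc[of u] by (intro arg_cong[where f="\<lambda>t. \<rho> (ai u) * t"] sum.cong refl) simp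
  next
    fix l x assume l: "length l = Suc n" "set l \<subseteq> {1..N}" and x: "x \<in> V 1"
    then obtain i k where k: "l = i # k" "length k = n" "set k \<subseteq> {1..N}" "i \<in> {1..N}"
      by (cases l) auto
    have "wm k x \<in> V (Suc n)" using wm_V[OF k(3) x] k(2) by (simp add: One_nat_def)
    then show "\<exists>y\<in>V 0. \<exists>z\<in>V 0. h (wm l y) \<le> g (wm l x) \<and> g (wm l x) \<le> h (wm l z)"
      using G_bound[OF k(2,3) x, of i] g[OF k(4)] by (simp add: k(1))
  qed
qed

text \<open>Iterating the one-step extension preserves the energy.  Extensions after step \<open>k\<close> keep the
  values on vertices of level \<open>n + k\<close>, so the limit function takes at each vertex the value of the first
  extension that is defined there.  The maximum principle on cells is inherited through all steps.\<close>

lemma harmonic_extension: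
  "\<exists>f. (\<forall>x\<in>V n. f x = h x) \<and> (\<forall>k. L v (n + k) f f = L v n h h) \<and>
    (\<forall>l k x. length l = n \<longrightarrow> set l \<subseteq> {1..N} \<longrightarrow> x \<in> V k \<longrightarrow>
      (\<exists>y\<in>V 0. \<exists>z\<in>V 0. h (wm l y) \<le> f (wm l x) \<and> f (wm l x) \<le> h (wm l z)))"
proof -
  have "\<forall>m g. \<exists>g'. (\<forall>x\<in>V m. g' x = g x) \<and> L v (Suc m) g' g' = L v m g g \<and>
    (\<forall>l x. length l = m \<longrightarrow> set l \<subseteq> {1..N} \<longrightarrow> x \<in> V 1 \<longrightarrow>
      (\<exists>y\<in>V 0. \<exists>z\<in>V 0. g (wm l y) \<le> g' (wm l x) \<and> g' (wm l x) \<le> g (wm l z)))"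
    using harmonic_step[OF v] by blast
  then obtain T where T_V: "\<And>m g x. x \<in> V m \<Longrightarrow> T m g x = g x"
    and T_L: "\<And>m g. L v (Suc m) (T m g) (T m g) = L v m g g"
    and T_bound: "\<And>m g l x. \<lbrakk>length l = m; set l \<subseteq> {1..N}; x \<in> V 1\<rbrakk> \<Longrightarrow>
        \<exists>y\<in>V 0. \<exists>z\<in>V 0. g (wm l y) \<le> T m g (wm l x) \<and> T m g (wm l x) \<le> g (wm l z)"
    by metis
  define H where "H = rec_nat h (\<lambda>k. T (n + k))"
  have H: "H 0 = h" "\<And>k. H (Suc k) = T (n + k) (H k)" by (simp_all add: H_def)
  have agree: "H (k + j) x = H k x" if "x \<in> V (n + k)" for k j x
  proof (induction j)
    case (Suc j)
    have "x \<in> V (n + (k + j))" using that V_mono[of "n + k" "n + (k + j)"] by auto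
    then show ?case using Suc H(2)[of "k + j"] T_V by simp
  qed simp
  define f where "f x = H (LEAST k. x \<in> V (n + k)) x" for x
  have f: "f x = H k x" if "x \<in> V (n + k)" for k x
  proof -
    define m where "m = (LEAST k. x \<in> V (n + k))"
    have "x \<in> V (n + m)" "m \<le> k" unfolding m_def using that by (auto intro: LeastI Least_le)
    then show ?thesis using agree[of x m "k - m"] by (simp add: f_def m_def[symmetric])
  qed
  have H_L: "L v (n + k) (H k) (H k) = L v n h h" for k
    by (induction k) (simp_all add: H T_L)
  have H_bound: "\<exists>y\<in>V 0. \<exists>z\<in>V 0. h (wm l y) \<le> H k (wm l x) \<and> H k (wm l x) \<le> h (wm l z)"
    if "length l = n" "set l \<subseteq> {1..N}" "x \<in> V k" for l k x
    using that(3)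
  proof (induction k arbitrary: x)
    case 0
    then show ?case by (auto simp: H(1))
  next
    case (Suc k)
    then obtain l' x' where l': "length l' = k" "set l' \<subseteq> {1..N}" "x' \<in> V 1" "x = wm l' x'"
      using V_decompose[of x k 1] Suc.prems by (auto simp: One_nat_def)
    have "length (l @ l') = n + k" "set (l @ l') \<subseteq> {1..N}" using l' that by auto
    from T_bound[OF this l'(3), of "H k"] obtain y z where yz: "y \<in> V 0" "z \<in> V 0"
      "H k (wm l (wm l' y)) \<le> H (Suc k) (wm l x)" "H (Suc k) (wm l x) \<le> H k (wm l (wm l' z))"
      by (auto simp: word_map_append H(2) l'(4))
    have "wm l' y \<in> V k" "wm l' z \<in> V k" using wm_V[OF l'(2)] yz(1,2) l'(1) by force+
    then show ?case using Suc.IH[of "wm l' y"] Suc.IH[of "wm l' z"] yz(3,4) by (meson order_trans)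
  qed
  show ?thesis
  proof (intro exI[of _ f] conjI ballI allI impI)
    show "f x = h x" if "x \<in> V n" for x using f[of x 0] that H(1) by simp
    show "L v (n + k) f f = L v n h h" for k
      using L_cong[OF v, of "n + k" f "H k"] f H_L by simp
    show "\<exists>y\<in>V 0. \<exists>z\<in>V 0. h (wm l y) \<le> f (wm l x) \<and> f (wm l x) \<le> h (wm l z)"
      if l: "length l = n" "set l \<subseteq> {1..N}" "x \<in> V k" for l k x
    proof -
      have "wm l x \<in> V (n + k)" using wm_V[OF l(2,3)] l(1) by simp
      then show ?thesis using H_bound[OF l] f by simp
    qed
  qed
qed

subsection \<open>Oscillation bounds\<close>

text \<open>One factor by which the square of the oscillation contracts from a cell to its subcells,
  simultaneously for all parameters \<open>u \<ge> v\<close>.\<close>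

definition contraction :: real where
  "contraction = (SOME c. 0 < c \<and> c < 1 \<and> (\<forall>w\<ge>v. rmax / \<rho> w \<le> c))"

lemma contraction: "0 < contraction" "contraction < 1" "v \<le> w \<Longrightarrow> rmax / \<rho> w \<le> contraction"
  using someI_ex[OF uniform_contraction[OF v]] unfolding contraction_def by blast+

lemma above_v: "v \<le> u \<Longrightarrow> vm < u" "v \<le> u \<Longrightarrow> v \<le> ai u"
  using v ai_greater[of u] by auto

text \<open>The energy of a copy is one summand of the total energy, with weight at least the inverse of
  \<open>contraction\<close>.\<close>

lemma component_energy:
  assumes u: "v \<le> u" and i: "i \<in> {1..N}"
  shows "L (ai u) n (f \<circ> \<psi> i) (f \<circ> \<psi> i) \<le> contraction * L u (Suc n) f f"
proof -
  let ?e = "L (ai u) n (f \<circ> \<psi> i) (f \<circ> \<psi> i)"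
  have vm: "vm < u" by (rule above_v(1)[OF u])
  have nn: "0 \<le> L (ai u) n g g" for g by (intro L_nonneg ai_above_vm vm)
  have "inverse (r i) * ?e \<le> (\<Sum>i=1..N. inverse (r i) * L (ai u) n (f \<circ> \<psi> i) (f \<circ> \<psi> i))"
    using i nn r_pos
    by (intro member_le_sum[of i "{1..N}" "\<lambda>i. inverse (r i) * L (ai u) n (f \<circ> \<psi> i) (f \<circ> \<psi> i)"])
      (auto simp: less_imp_le)
  then have "\<rho> (ai u) * (inverse (r i) * ?e) \<le> L u (Suc n) f f"
    unfolding L_Suc[of u] using \<rho>_ai_pos[OF vm] by (intro mult_left_mono) auto
  then have "?e \<le> r i / \<rho> (ai u) * L u (Suc n) f f"
    using r_pos[OF i] \<rho>_ai_pos[OF vm] by (simp add: field_simps)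
  also have "\<dots> \<le> contraction * L u (Suc n) f f"
  proof (rule mult_right_mono[OF _ L_nonneg[OF vm]])
    have "r i / \<rho> (ai u) \<le> rmax / \<rho> (ai u)"
      using r_le_rmax[OF i] \<rho>_ai_pos[OF vm] by (intro divide_right_mono) auto
    also have "\<dots> \<le> contraction" by (rule contraction(3)[OF above_v(2)[OF u]])
    finally show "r i / \<rho> (ai u) \<le> contraction" .
  qed
  finally show ?thesis .
qed

lemma component_sqrt:
  assumes "v \<le> u" "i \<in> {1..N}"
  shows "sqrt (L (ai u) n (f \<circ> \<psi> i) (f \<circ> \<psi> i)) \<le> sqrt contraction * sqrt (L u (Suc n) f f)"
  using component_energy[OF assms] by (metis real_sqrt_le_mono real_sqrt_mult)

text \<open>For \<open>u \<ge> v\<close> every edge of the boundary graph has conductance at least \<open>min v 1\<close>, and a path of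
  edges whose existence does not depend on \<open>u\<close> joins \<open>x\<close> to \<open>y\<close>.\<close>

lemma pair_bound_0:
  assumes "x \<in> V 0" "y \<in> V 0"
  shows "\<exists>K\<ge>0. \<forall>u\<ge>v. \<forall>f. \<bar>f x - f y\<bar> \<le> K * sqrt (L u 0 f f)"
proof -
  have vp: "0 < v" by (rule vm_pos[OF v])
  have "(x, y) \<in> (edges (V 0) (cond v))\<^sup>*"
    using family assms vp unfolding one_parameter_family_def irreducible_conductances_def by blast
  then show ?thesis
  proof (induction rule: rtrancl_induct)
    case base
    then show ?case by (intro exI[of _ 0]) simp
  next
    case (step y z)
    then obtain K where K: "0 \<le> K" "\<And>u f. v \<le> u \<Longrightarrow> \<bar>f x - f y\<bar> \<le> K * sqrt (L u 0 f f)" by blast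
    define \<kappa> where "\<kappa> = min v 1"
    have \<kappa>: "0 < \<kappa>" using vp by (simp add: \<kappa>_def)
    have yz: "y \<in> V 0" "z \<in> V 0" "0 < cond v y z" using step(2) by (auto simp: edges_def)
    have edge: "\<bar>f y - f z\<bar> \<le> sqrt (2 / \<kappa>) * sqrt (L u 0 f f)" if u: "v \<le> u" for u f
    proof -
      have "\<kappa> \<le> cond u y z"
        using yz(3) u by (auto simp: family_conductance_def \<kappa>_def split: if_splits)
      then have "\<kappa> * (f y - f z)\<^sup>2 \<le> cond u y z * (f y - f z)\<^sup>2" by (rule mult_right_mono) simp
      also have "\<dots> \<le> 2 * L u 0 f f"
        unfolding L_0 using vp u by (intro edge_le_energy finite_V yz cond_nonneg) auto
      finally have "(f y - f z)\<^sup>2 \<le> 2 / \<kappa> * L u 0 f f" using \<kappa> by (simp add: field_simps)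
      then have "sqrt ((f y - f z)\<^sup>2) \<le> sqrt (2 / \<kappa> * L u 0 f f)" by (rule real_sqrt_le_mono)
      then show ?thesis unfolding real_sqrt_mult by simp
    qed
    show ?case
    proof (intro exI[of _ "K + sqrt (2 / \<kappa>)"] conjI allI impI)
      show "\<bar>f x - f z\<bar> \<le> (K + sqrt (2 / \<kappa>)) * sqrt (L u 0 f f)" if "v \<le> u" for u f
        using K(2)[OF that, of f] edge[OF that, of f] by (simp add: distrib_right)
    qed (use K(1) \<kappa> in simp)
  qed
qed

lemma bound_0: "\<exists>K\<ge>0. \<forall>u\<ge>v. \<forall>f. \<forall>x\<in>V 0. \<forall>y\<in>V 0. \<bar>f x - f y\<bar> \<le> K * sqrt (L u 0 f f)"
proof -
  have "\<forall>p\<in>V 0 \<times> V 0. \<exists>K\<ge>0. \<forall>u\<ge>v. \<forall>f. \<bar>f (fst p) - f (snd p)\<bar> \<le> K * sqrt (L u 0 f f)"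
    using pair_bound_0 by auto
  then obtain k where k: "\<And>p. p \<in> V 0 \<times> V 0 \<Longrightarrow> 0 \<le> k p"
      "\<And>p u f. \<lbrakk>p \<in> V 0 \<times> V 0; v \<le> u\<rbrakk> \<Longrightarrow> \<bar>f (fst p) - f (snd p)\<bar> \<le> k p * sqrt (L u 0 f f)"
    by metis
  have "\<bar>f x - f y\<bar> \<le> sum k (V 0 \<times> V 0) * sqrt (L u 0 f f)"
    if "v \<le> u" "x \<in> V 0" "y \<in> V 0" for u f x y
  proof -
    have "k (x, y) \<le> sum k (V 0 \<times> V 0)"
      using that k(1) finite_V by (intro member_le_sum) auto
    then have "k (x, y) * sqrt (L u 0 f f) \<le> sum k (V 0 \<times> V 0) * sqrt (L u 0 f f)"
      using L_nonneg[OF above_v(1)[OF that(1)]] by (intro mult_right_mono) auto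
    then show ?thesis using k(2)[of "(x, y)" u f] that by auto
  qed
  then show ?thesis using k(1) by (intro exI[of _ "sum k (V 0 \<times> V 0)"]) (auto intro: sum_nonneg)
qed

text \<open>Two first-level cells are joined by a chain of cells with common vertices, since \<open>F\<close> is
  connected.\<close>

lemma bound_1:
  assumes p: "p \<in> V 0"
  shows "\<exists>K\<ge>0. \<forall>u\<ge>v. \<forall>f. \<forall>i\<in>{1..N}. \<bar>f (\<psi> i p) - f p\<bar> \<le> K * sqrt (L u (Suc 0) f f)"
proof -
  obtain K0 where K0: "0 \<le> K0"
      "\<And>u f x y. \<lbrakk>v \<le> u; x \<in> V 0; y \<in> V 0\<rbrakk> \<Longrightarrow> \<bar>f x - f y\<bar> \<le> K0 * sqrt (L u 0 f f)"
    using bound_0 by blast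
  define C where "C = K0 * sqrt contraction"
  have C: "0 \<le> C" using K0(1) contraction(1) by (simp add: C_def)
  have cell: "\<bar>f (\<psi> i x) - f (\<psi> i y)\<bar> \<le> C * sqrt (L u (Suc 0) f f)"
    if "v \<le> u" "i \<in> {1..N}" "x \<in> V 0" "y \<in> V 0" for u i x y f
  proof -
    have "\<bar>f (\<psi> i x) - f (\<psi> i y)\<bar> \<le> K0 * sqrt (L (ai u) 0 (f \<circ> \<psi> i) (f \<circ> \<psi> i))"
      using K0(2)[OF above_v(2)[OF that(1)] that(3,4), of "f \<circ> \<psi> i"] by simp
    also have "\<dots> \<le> K0 * (sqrt contraction * sqrt (L u (Suc 0) f f))"
      by (intro mult_left_mono component_sqrt that K0(1))
    finally show ?thesis by (simp add: C_def mult.assoc)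
  qed
  obtain j q where j: "j \<in> {1..N}" "q \<in> V 0" "p = \<psi> j q"
    using p V_mono_Suc[of 0] unfolding V_Suc by blast
  let ?E = "{(i, j). i \<in> {1..N} \<and> j \<in> {1..N} \<and> \<psi> i ` F \<inter> \<psi> j ` F \<noteq> {}}"
  have "\<exists>K\<ge>0. \<forall>u\<ge>v. \<forall>f. \<bar>f (\<psi> i p) - f p\<bar> \<le> K * sqrt (L u (Suc 0) f f)"
    if i: "i \<in> {1..N}" for i
  proof -
    have "(j, i) \<in> ?E\<^sup>*" by (rule cells_connected[OF connected_F j(1) i])
    then show ?thesis
    proof (induction rule: rtrancl_induct)
      case base
      show ?case using cell[OF _ j(1) p j(2)] C by (intro exI[of _ C]) (auto simp: j(3)[symmetric])
    next
      case (step i k)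
      then obtain K where K: "0 \<le> K"
          "\<And>u f. v \<le> u \<Longrightarrow> \<bar>f (\<psi> i p) - f p\<bar> \<le> K * sqrt (L u (Suc 0) f f)" by blast
      show ?case
      proof (cases "i = k")
        case True then show ?thesis using K by blast
      next
        case False
        obtain x y where xy: "x \<in> F" "y \<in> F" "\<psi> i x = \<psi> k y" using step(2) by blast
        have ik: "i \<in> {1..N}" "k \<in> {1..N}" using step(2) by auto
        have x: "x \<in> V 0" using overlap[of i "[]" k x y] xy ik False by simp
        have y: "y \<in> V 0" using overlap[of k "[]" i y x] xy ik False by simp
        show ?thesis
        proof (intro exI[of _ "K + 2 * C"] conjI allI impI)
          show "\<bar>f (\<psi> k p) - f p\<bar> \<le> (K + 2 * C) * sqrt (L u (Suc 0) f f)" if u: "v \<le> u" for u f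
          proof -
            have "\<bar>f (\<psi> k p) - f p\<bar> \<le> \<bar>f (\<psi> i p) - f p\<bar> + \<bar>f (\<psi> i x) - f (\<psi> i p)\<bar>
                + \<bar>f (\<psi> k p) - f (\<psi> k y)\<bar>" using xy(3) by simp
            also have "\<dots> \<le> K * sqrt (L u (Suc 0) f f) + C * sqrt (L u (Suc 0) f f)
                + C * sqrt (L u (Suc 0) f f)"
              by (intro add_mono K(2) cell u ik x y p)
            finally show ?thesis by (simp add: algebra_simps)
          qed
        qed (use K(1) C in simp)
      qed
    qed
  qed
  then obtain k where k: "\<And>i. i \<in> {1..N} \<Longrightarrow> 0 \<le> k i"
      "\<And>i u f. \<lbrakk>i \<in> {1..N}; v \<le> u\<rbrakk> \<Longrightarrow> \<bar>f (\<psi> i p) - f p\<bar> \<le> k i * sqrt (L u (Suc 0) f f)"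
    by metis
  have "\<bar>f (\<psi> i p) - f p\<bar> \<le> sum k {1..N} * sqrt (L u (Suc 0) f f)"
    if "v \<le> u" "i \<in> {1..N}" for u f i
  proof -
    have "k i \<le> sum k {1..N}" using that k(1) by (intro member_le_sum) auto
    then have "k i * sqrt (L u (Suc 0) f f) \<le> sum k {1..N} * sqrt (L u (Suc 0) f f)"
      using L_nonneg[OF above_v(1)[OF that(1)]] by (intro mult_right_mono) auto
    then show ?thesis using k(2)[OF that(2,1), of f] by linarith
  qed
  then show ?thesis using k(1) by (intro exI[of _ "sum k {1..N}"]) (auto intro: sum_nonneg)
qed

text \<open>Every vertex is reached from a fixed base point \<open>p\<close> by first moving to the copy of \<open>p\<close> in its
  first-level cell and then moving inside the cell, where distances are contracted.  The resulting
  recursion for the constants is a geometric series.\<close>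

lemma oscillation:
  "\<exists>K>0. \<forall>n. \<forall>u\<ge>v. \<forall>f. \<forall>x\<in>V n. \<forall>y\<in>V n. \<bar>f x - f y\<bar> \<le> K * sqrt (L u n f f)"
proof -
  obtain p where p: "p \<in> V 0" using V0_ne by blast
  obtain K0 where K0: "0 \<le> K0"
      "\<And>u f x y. \<lbrakk>v \<le> u; x \<in> V 0; y \<in> V 0\<rbrakk> \<Longrightarrow> \<bar>f x - f y\<bar> \<le> K0 * sqrt (L u 0 f f)"
    using bound_0 by blast
  obtain K1 where K1: "0 \<le> K1"
      "\<And>u f i. \<lbrakk>v \<le> u; i \<in> {1..N}\<rbrakk> \<Longrightarrow> \<bar>f (\<psi> i p) - f p\<bar> \<le> K1 * sqrt (L u (Suc 0) f f)"
    using bound_1[OF p] by blast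
  define s where "s = sqrt contraction"
  have s: "0 \<le> s" "s < 1" using contraction(1,2) by (auto simp: s_def)
  \<comment> \<open>Moving one level down turns a constant \<open>K\<close> into \<open>K * s + K1\<close>; this choice absorbs that.\<close>
  define K where "K = K0 + K1 / (1 - s)"
  have K: "0 \<le> K" "K0 \<le> K" "K * s + K1 \<le> K"
  proof -
    have *: "0 \<le> K1 / (1 - s)" using K1(1) s by simp
    then show "0 \<le> K" "K0 \<le> K" using K0(1) by (simp_all add: K_def)
    have "K * (1 - s) = K0 * (1 - s) + K1" using s by (simp add: K_def field_simps)
    moreover have "0 \<le> K0 * (1 - s)" using K0(1) s by simp
    ultimately show "K * s + K1 \<le> K" by (simp add: algebra_simps)
  qed
  have base: "\<bar>f x - f p\<bar> \<le> K * sqrt (L u n f f)" if "v \<le> u" "x \<in> V n" for n u f x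
    using that
  proof (induction n arbitrary: u f x)
    case 0
    have "\<bar>f x - f p\<bar> \<le> K0 * sqrt (L u 0 f f)" by (rule K0(2)[OF 0 p])
    also have "\<dots> \<le> K * sqrt (L u 0 f f)"
      using K(2) L_nonneg[OF above_v(1)[OF 0(1)]] by (intro mult_right_mono) auto
    finally show ?case .
  next
    case (Suc n)
    then obtain i y where i: "i \<in> {1..N}" "y \<in> V n" "x = \<psi> i y" unfolding V_Suc by blast
    let ?S = "sqrt (L u (Suc n) f f)"
    have vm: "vm < u" by (rule above_v(1)[OF Suc.prems(1)])
    have "\<bar>f (\<psi> i y) - f (\<psi> i p)\<bar> \<le> K * sqrt (L (ai u) n (f \<circ> \<psi> i) (f \<circ> \<psi> i))"
      using Suc.IH[OF above_v(2)[OF Suc.prems(1)] i(2), of "f \<circ> \<psi> i"] by (simp add: comp_def)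
    also have "\<dots> \<le> K * (s * ?S)"
      unfolding s_def by (intro mult_left_mono component_sqrt Suc.prems i K)
    finally have 1: "\<bar>f (\<psi> i y) - f (\<psi> i p)\<bar> \<le> K * s * ?S" by (simp add: mult.assoc)
    have "\<bar>f (\<psi> i p) - f p\<bar> \<le> K1 * sqrt (L u (Suc 0) f f)" by (rule K1(2)[OF Suc.prems(1) i(1)])
    also have "\<dots> \<le> K1 * ?S" by (intro mult_left_mono real_sqrt_le_mono L_mono vm K1(1)) simp
    finally have "\<bar>f x - f p\<bar> \<le> (K * s + K1) * ?S" using 1 i(3) by (simp add: distrib_right)
    also have "\<dots> \<le> K * ?S" using K(3) L_nonneg[OF vm] by (intro mult_right_mono) auto
    finally show ?case .
  qed
  have "\<bar>f x - f y\<bar> \<le> (2 * K + 1) * sqrt (L u n f f)" if "v \<le> u" "x \<in> V n" "y \<in> V n" for n u f x y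
  proof -
    have "0 \<le> sqrt (L u n f f)" using L_nonneg[OF above_v(1)[OF that(1)]] by simp
    then show ?thesis
      using base[OF that(1,2), of f] base[OF that(1,3), of f]
      unfolding distrib_right mult.assoc by linarith
  qed
  then show ?thesis using K(1) by (intro exI[of _ "2 * K + 1"]) auto
qed

text \<open>One constant for all levels and all parameters \<open>u \<ge> v\<close>; its square bounds the resistances.\<close>

definition osc :: real where
  "osc = (SOME K. K > 0 \<and> (\<forall>n. \<forall>u\<ge>v. \<forall>f. \<forall>x\<in>V n. \<forall>y\<in>V n. \<bar>f x - f y\<bar> \<le> K * sqrt (L u n f f)))"

lemma osc_pos: "0 < osc"
  and osc: "\<lbrakk>v \<le> u; x \<in> V n; y \<in> V n\<rbrakk> \<Longrightarrow> \<bar>f x - f y\<bar> \<le> osc * sqrt (L u n f f)"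
  using someI_ex[OF oscillation] unfolding osc_def by blast+

text \<open>Each letter of the word passes to a copy, at the cost of one factor \<open>sqrt contraction\<close>.\<close>

lemma cell_oscillation:
  "\<lbrakk>v \<le> u; set l \<subseteq> {1..N}; x \<in> V n; y \<in> V n\<rbrakk> \<Longrightarrow>
    \<bar>f (wm l x) - f (wm l y)\<bar> \<le> osc * sqrt contraction ^ length l * sqrt (L u (length l + n) f f)"
proof (induction l arbitrary: u f)
  case Nil
  then show ?case using osc by simp
next
  case (Cons i l)
  have "\<bar>f (wm (i # l) x) - f (wm (i # l) y)\<bar> \<le>
      osc * sqrt contraction ^ length l * sqrt (L (ai u) (length l + n) (f \<circ> \<psi> i) (f \<circ> \<psi> i))"
    using Cons.IH[of "ai u" "f \<circ> \<psi> i"] Cons.prems above_v(2) by (simp add: comp_def)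
  also have "\<dots> \<le> osc * sqrt contraction ^ length l *
      (sqrt contraction * sqrt (L u (Suc (length l + n)) f f))"
    using Cons.prems osc_pos contraction(1) by (intro mult_left_mono component_sqrt) auto
  finally show ?case by (simp add: algebra_simps)
qed

text \<open>Close vertices lie in equal or adjacent small cells.  Adjacent cells share a vertex, through which
  the two cell oscillations are added.\<close>

lemma modulus:
  assumes "0 < \<epsilon>"
  shows "\<exists>\<delta>>0. \<forall>m. \<forall>x\<in>V m. \<forall>y\<in>V m. dist x y < \<delta> \<longrightarrow>
    (\<forall>f M. (\<forall>n. L v n f f \<le> M) \<longrightarrow> (f x - f y)\<^sup>2 \<le> \<epsilon> * M)"
proof -
  define s where "s = sqrt contraction"
  have s: "0 \<le> s" "s < 1" using contraction(1,2) by (auto simp: s_def)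
  obtain n where n: "s ^ n < sqrt \<epsilon> / (2 * osc)"
    using real_arch_pow_inv[of "sqrt \<epsilon> / (2 * osc)" s] s osc_pos assms by auto
  obtain \<delta> where \<delta>: "0 < \<delta>" and adj: "\<And>x y l l'. \<lbrakk>x \<in> F; y \<in> F; dist x y < \<delta>; length l = n; length l' = n;
      set l \<subseteq> {1..N}; set l' \<subseteq> {1..N}; x \<in> wm l ` F; y \<in> wm l' ` F\<rbrakk> \<Longrightarrow> wm l ` F \<inter> wm l' ` F \<noteq> {}"
    using adjacent_cells[of n] by blast
  have "(f x - f y)\<^sup>2 \<le> \<epsilon> * M"
    if x: "x \<in> V m" and y: "y \<in> V m" and d: "dist x y < \<delta>" and M: "\<And>n. L v n f f \<le> M" for m x y f M
  proof -
    have M0: "0 \<le> M" using M[of 0] L_nonneg[OF v, of 0 f] by linarith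
    have "x \<in> V (n + m)" "y \<in> V (n + m)" using x y V_mono[of m "n + m"] by auto
    then obtain l x' l' y' where l: "length l = n" "set l \<subseteq> {1..N}" "x' \<in> V m" "x = wm l x'"
      and l': "length l' = n" "set l' \<subseteq> {1..N}" "y' \<in> V m" "y = wm l' y'"
      using V_decompose by metis
    have F: "x' \<in> F" "y' \<in> F" using l(3) l'(3) V_sub by blast+
    have cell: "\<bar>f (wm k a) - f (wm k b)\<bar> \<le> osc * s ^ n * sqrt M"
      if "length k = n" "set k \<subseteq> {1..N}" "a \<in> V m" "b \<in> V m" for k a b
    proof -
      have "\<bar>f (wm k a) - f (wm k b)\<bar> \<le> osc * s ^ n * sqrt (L v (n + m) f f)"
        using cell_oscillation[OF order_refl that(2-4), of f] that(1) by (simp add: s_def)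
      also have "\<dots> \<le> osc * s ^ n * sqrt M"
        using osc_pos s M by (intro mult_left_mono real_sqrt_le_mono) auto
      finally show ?thesis .
    qed
    have nn: "0 \<le> osc * s ^ n * sqrt M" using osc_pos s M0 by simp
    have "\<bar>f x - f y\<bar> \<le> 2 * (osc * s ^ n * sqrt M)"
    proof (cases "l = l'")
      case True
      then show ?thesis using cell[OF l(1,2,3) l'(3)] l(4) l'(4) nn by simp
    next
      case False
      obtain a b where ab: "a \<in> F" "b \<in> F" "wm l a = wm l' b"
        using adj[of x y l l'] l l' d F wm_in by blast
      have "a \<in> V 0" by (rule overlap_words[OF _ False l(2) l'(2) ab]) (simp add: l(1) l'(1))
      moreover have "b \<in> V 0"
        by (rule overlap_words[OF _ False[symmetric] l'(2) l(2) ab(2,1) ab(3)[symmetric]])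
          (simp add: l(1) l'(1))
      ultimately have "a \<in> V m" "b \<in> V m" using V_mono[of 0 m] by auto
      then have "\<bar>f (wm l x') - f (wm l a)\<bar> \<le> osc * s ^ n * sqrt M"
          "\<bar>f (wm l' b) - f (wm l' y')\<bar> \<le> osc * s ^ n * sqrt M"
        using cell l l' by blast+
      then show ?thesis using ab(3) l(4) l'(4) by simp
    qed
    also have "\<dots> \<le> sqrt \<epsilon> * sqrt M"
    proof -
      have "2 * osc * s ^ n \<le> sqrt \<epsilon>" using n osc_pos by (simp add: field_simps)
      from mult_right_mono[OF this, of "sqrt M"] M0 show ?thesis by (simp add: mult.assoc)
    qed
    finally have "\<bar>f x - f y\<bar> \<le> sqrt (\<epsilon> * M)" by (simp add: real_sqrt_mult)
    from power_mono[OF this, of 2] show ?thesis using assms M0 by simp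
  qed
  then show ?thesis using \<delta> by blast
qed

subsection \<open>The limit\<close>

text \<open>A fixed choice of edge weights, which presents the level forms at the parameter \<open>v\<close> as nested
  forms.\<close>

definition level_conductance :: "nat \<Rightarrow> 'a \<Rightarrow> 'a \<Rightarrow> real" where
  "level_conductance n = (SOME b. (\<forall>x y. 0 \<le> b x y) \<and> L v n = finite_form (V n) b \<and>
    (\<forall>x y. b x y \<noteq> 0 \<longrightarrow> (\<exists>l. length l = n \<and> set l \<subseteq> {1..N} \<and> x \<in> wm l ` F \<and> y \<in> wm l ` F)))"

lemma level_conductance: "0 \<le> level_conductance n x y" "L v n = finite_form (V n) (level_conductance n)"
  "level_conductance n x y \<noteq> 0 \<Longrightarrow> \<exists>l. length l = n \<and> set l \<subseteq> {1..N} \<and> x \<in> wm l ` F \<and> y \<in> wm l ` F"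
  using someI_ex[OF L_conductances[OF v, of n]] unfolding level_conductance_def by blast+

sublocale limit: nested_forms F V level_conductance
  by unfold_locales (use compact_F V_sub level_conductance(1) L_mono_Suc[OF v] level_conductance(2) in auto)

lemma limit_Q: "limit.Q n = L v n" by (simp add: limit.Q_def level_conductance(2))

lemma limit_domain_eq: "limit.dom = limit_domain F N \<psi> r A B \<rho> \<alpha> v"
  by (simp add: limit.dom_def limit_domain_def limit_Q)

lemma limit_form_eq: "limit.lim_form = limit_form F N \<psi> r A B \<rho> \<alpha> v"
  by (simp add: fun_eq_iff limit.lim_form_def limit_form_def limit.energy_def limit_energy_def limit_Q)

lemma L_le_energy: "f \<in> limit.dom \<Longrightarrow> L v n f f \<le> limit.energy f"
  using limit.Q_le_energy[of f n] by (simp add: limit_Q)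

abbreviation "Vs \<equiv> (\<Union>n. V n)"

lemma closure_Vs: "closure Vs = F"
proof
  show "closure Vs \<subseteq> F" using V_sub compact_F by (intro closure_minimal compact_imp_closed) auto
  show "F \<subseteq> closure Vs" using vertices_dense[OF V0_ne] by (simp add: subset_iff closure_approachable)
qed

lemma common_level: "x \<in> Vs \<Longrightarrow> y \<in> Vs \<Longrightarrow> \<exists>m. x \<in> V m \<and> y \<in> V m"
  using V_mono by (metis UN_iff max.cobounded1 max.cobounded2 subsetD)

text \<open>The bound on vertices extends to \<open>F\<close> by density of the vertices, in one variable after the other.\<close>

lemma limit_bound:
  assumes f: "f \<in> limit.dom" and x: "x \<in> F" and y: "y \<in> F"
  shows "(f x - f y)\<^sup>2 \<le> osc\<^sup>2 * limit.energy f"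
proof -
  have c: "continuous_on F f" by (rule limit.dom_continuous[OF f])
  have 1: "(f a - f b)\<^sup>2 \<le> osc\<^sup>2 * limit.energy f" if ab: "a \<in> Vs" "b \<in> Vs" for a b
  proof -
    obtain m where m: "a \<in> V m" "b \<in> V m" using common_level[OF ab] by blast
    have "\<bar>f a - f b\<bar> \<le> osc * sqrt (limit.energy f)"
      using osc[OF order_refl m, of f] osc_pos L_le_energy[OF f, of m]
      by (meson less_imp_le mult_left_mono order_trans real_sqrt_le_mono)
    from power_mono[OF this, of 2] show ?thesis
      using limit.energy_nonneg[OF f] by (simp add: power_mult_distrib)
  qed
  have 2: "(f a - f y)\<^sup>2 \<le> osc\<^sup>2 * limit.energy f" if "a \<in> Vs" for a
    by (rule continuous_le_on_closure[of Vs "\<lambda>b. (f a - f b)\<^sup>2"])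
      (use 1[OF that] y c in \<open>auto simp: closure_Vs intro!: continuous_intros\<close>)
  show ?thesis
    by (rule continuous_le_on_closure[of Vs "\<lambda>a. (f a - f y)\<^sup>2"])
      (use 2 x c in \<open>auto simp: closure_Vs intro!: continuous_intros\<close>)
qed

text \<open>Two close points are limits of vertices that are eventually equally close.\<close>

lemma limit_equicontinuous:
  assumes "0 < \<epsilon>"
  shows "\<exists>\<delta>>0. \<forall>x\<in>F. \<forall>y\<in>F. dist x y < \<delta> \<longrightarrow>
    (\<forall>f\<in>limit.dom. (f x - f y)\<^sup>2 \<le> \<epsilon> * limit.energy f)"
proof -
  obtain \<delta> where \<delta>: "0 < \<delta>" "\<And>m x y f M. \<lbrakk>x \<in> V m; y \<in> V m; dist x y < \<delta>; \<And>n. L v n f f \<le> M\<rbrakk>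
      \<Longrightarrow> (f x - f y)\<^sup>2 \<le> \<epsilon> * M"
    using modulus[OF assms] by blast
  have "(f x - f y)\<^sup>2 \<le> \<epsilon> * limit.energy f"
    if x: "x \<in> F" and y: "y \<in> F" and d: "dist x y < \<delta>" and f: "f \<in> limit.dom" for x y f
  proof -
    have c: "continuous_on F f" by (rule limit.dom_continuous[OF f])
    have "x \<in> closure Vs" "y \<in> closure Vs" using x y by (simp_all add: closure_Vs)
    then obtain a b where a: "\<And>k. a k \<in> Vs" "a \<longlonglongrightarrow> x" and b: "\<And>k. b k \<in> Vs" "b \<longlonglongrightarrow> y"
      unfolding closure_sequential by blast
    have "Vs \<subseteq> F" using V_sub by blast
    then have aF: "a k \<in> F" and bF: "b k \<in> F" for k using a(1) b(1) by blast+
    have "(\<lambda>k. f (a k)) \<longlonglongrightarrow> f x"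
      by (rule continuous_on_tendsto_compose[OF c a(2) x]) (simp add: aF)
    moreover have "(\<lambda>k. f (b k)) \<longlonglongrightarrow> f y"
      by (rule continuous_on_tendsto_compose[OF c b(2) y]) (simp add: bF)
    ultimately have "(\<lambda>k. (f (a k) - f (b k))\<^sup>2) \<longlonglongrightarrow> (f x - f y)\<^sup>2" by (intro tendsto_intros)
    moreover have "eventually (\<lambda>k. dist (a k) (b k) < \<delta>) sequentially"
      using tendsto_dist[OF a(2) b(2)] d by (rule order_tendstoD(2))
    then have "eventually (\<lambda>k. (f (a k) - f (b k))\<^sup>2 \<le> \<epsilon> * limit.energy f) sequentially"
    proof eventually_elim
      case (elim k)
      obtain m where m: "a k \<in> V m" "b k \<in> V m" using common_level[OF a(1) b(1)] by blast
      show ?case by (rule \<delta>(2)[OF m elim L_le_energy[OF f]])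
    qed
    ultimately show ?thesis by (rule tendsto_upperbound) simp
  qed
  then show ?thesis using \<delta>(1) by blast
qed

text \<open>The harmonic extension of the values of \<open>h\<close> on \<open>V n\<close> has finite energy, so it is uniformly
  continuous on the vertices and extends to \<open>F\<close>.  By the maximum principle on cells it differs from
  \<open>h\<close> at most by the oscillation of \<open>h\<close> over \<open>n\<close>-cells.\<close>

lemma limit_dense:
  assumes h: "continuous_on F h" and \<epsilon>: "0 < \<epsilon>"
  shows "\<exists>g\<in>limit.dom. \<forall>x\<in>F. \<bar>h x - g x\<bar> < \<epsilon>"
proof -
  obtain \<delta> where \<delta>: "0 < \<delta>" "\<And>x y. \<lbrakk>x \<in> F; y \<in> F; dist x y < \<delta>\<rbrakk> \<Longrightarrow> dist (h x) (h y) < \<epsilon> / 2"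
    using compact_uniformly_continuous[OF h compact_F] \<epsilon> unfolding uniformly_continuous_on_def
    by (metis half_gt_zero dist_commute)
  obtain n where n: "\<And>l x y. \<lbrakk>n \<le> length l; set l \<subseteq> {1..N}; x \<in> F; y \<in> F\<rbrakk>
      \<Longrightarrow> dist (wm l x) (wm l y) < \<delta>"
    using small_cells[OF \<delta>(1)] by blast
  obtain f where f_L: "\<And>k. L v (n + k) f f = L v n h h"
    and f_bound: "\<And>l k x. \<lbrakk>length l = n; set l \<subseteq> {1..N}; x \<in> V k\<rbrakk> \<Longrightarrow>
      \<exists>y\<in>V 0. \<exists>z\<in>V 0. h (wm l y) \<le> f (wm l x) \<and> f (wm l x) \<le> h (wm l z)"
    using harmonic_extension[of n h] by blast
  \<comment> \<open>The extension has this energy at all levels from \<open>n\<close> on, hence at most this energy before.\<close>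
  define M where "M = L v n h h"
  have M: "L v k f f \<le> M" for k
    using L_mono[OF v, of k "n + k" f] f_L[of k] by (simp add: M_def)
  have M0: "0 \<le> M" unfolding M_def by (rule L_nonneg[OF v])
  have close: "\<bar>h x - f x\<bar> \<le> \<epsilon> / 2" if x: "x \<in> Vs" for x
  proof -
    obtain m where "x \<in> V m" using x by blast
    then have "x \<in> V (n + m)" using V_mono[of m "n + m"] by auto
    then obtain l x' where l: "length l = n" "set l \<subseteq> {1..N}" "x' \<in> V m" "x = wm l x'"
      using V_decompose by blast
    then obtain y z where yz: "y \<in> V 0" "z \<in> V 0" "h (wm l y) \<le> f x" "f x \<le> h (wm l z)"
      using f_bound[of l x' m] by blast
    have F: "x' \<in> F" "y \<in> F" "z \<in> F" using l(3) yz(1,2) V_sub by blast+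
    have "dist (h (wm l x')) (h (wm l w)) < \<epsilon> / 2" if "w \<in> F" for w
      using l(1,2) F that by (intro \<delta>(2) wm_in n) auto
    from this[OF F(2)] this[OF F(3)] show ?thesis
      using yz(3,4) unfolding dist_real_def l(4) by linarith
  qed
  have "uniformly_continuous_on Vs f"
    unfolding uniformly_continuous_on_def
  proof (intro allI impI)
    fix e :: real assume e: "0 < e"
    have "0 < e\<^sup>2 / (M + 1)" using e M0 by simp
    then obtain d where d: "0 < d" "\<And>m x y. \<lbrakk>x \<in> V m; y \<in> V m; dist x y < d\<rbrakk>
        \<Longrightarrow> (f x - f y)\<^sup>2 \<le> e\<^sup>2 / (M + 1) * M"
      using modulus M by metis
    have "dist (f x') (f x) < e" if x: "x \<in> Vs" "x' \<in> Vs" and dist: "dist x' x < d" for x x'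
    proof -
      obtain m where "x \<in> V m" "x' \<in> V m" using common_level[OF x] by blast
      then have "(f x' - f x)\<^sup>2 \<le> e\<^sup>2 / (M + 1) * M" using d(2) dist by blast
      also have "\<dots> < e\<^sup>2" using e M0 by (simp add: field_simps)
      finally show ?thesis using e power2_less_imp_less[of "\<bar>f x' - f x\<bar>" e]
        by (simp add: dist_real_def)
    qed
    then show "\<exists>d>0. \<forall>x\<in>Vs. \<forall>x'\<in>Vs. dist x' x < d \<longrightarrow> dist (f x') (f x) < e" using d(1) by blast
  qed
  then obtain g where g: "uniformly_continuous_on (closure Vs) g" "\<And>x. x \<in> Vs \<Longrightarrow> f x = g x"
    using uniformly_continuous_on_extension_on_closure[of Vs f] by metis
  have gc: "continuous_on F g"
    using uniformly_continuous_imp_continuous[OF g(1)] by (simp add: closure_Vs)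
  have "g \<in> limit.dom"
  proof (rule limit.domI[OF gc])
    have "L v k g g = L v k f f" for k by (rule L_cong[OF v], rule g(2)[symmetric]) blast
    then show "limit.Q k g g \<le> M" for k using M by (simp add: limit_Q)
  qed
  moreover have "\<bar>h x - g x\<bar> < \<epsilon>" if "x \<in> F" for x
  proof -
    have "\<bar>h x - g x\<bar> \<le> \<epsilon> / 2"
      by (rule continuous_le_on_closure[of Vs "\<lambda>x. \<bar>h x - g x\<bar>"])
        (use that close g(2) h gc in \<open>auto simp: closure_Vs intro!: continuous_intros\<close>)
    then show ?thesis using \<epsilon> by simp
  qed
  ultimately show ?thesis by blast
qed

sublocale limit: resistance_limit F V level_conductance "osc\<^sup>2"
  by unfold_locales (rule limit_bound limit_equicontinuous limit_dense; assumption)+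

text \<open>Edges of level \<open>n\<close> lie inside cells of level \<open>n\<close>.\<close>

lemma limit_short_edges:
  assumes "0 < \<epsilon>"
  shows "\<exists>n0. \<forall>n\<ge>n0. \<forall>x y. level_conductance n x y \<noteq> 0 \<longrightarrow> dist x y < \<epsilon>"
proof -
  obtain n0 where n0: "\<And>l x y. \<lbrakk>n0 \<le> length l; set l \<subseteq> {1..N}; x \<in> F; y \<in> F\<rbrakk>
      \<Longrightarrow> dist (wm l x) (wm l y) < \<epsilon>"
    using small_cells[OF assms] by blast
  have "dist x y < \<epsilon>" if n: "n \<ge> n0" and xy: "level_conductance n x y \<noteq> 0" for n x y
  proof -
    obtain l x' y' where "length l = n" "set l \<subseteq> {1..N}" "x' \<in> F" "y' \<in> F" "x = wm l x'" "y = wm l y'"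
      using level_conductance(3)[OF xy] by blast
    then show ?thesis using n0 n by simp
  qed
  then show ?thesis by blast
qed

end

theorem theorem3p12:
  fixes F :: "'a::metric_space set" and N :: nat and \<psi> :: "nat \<Rightarrow> 'a \<Rightarrow> 'a"
    and \<theta> r :: "nat \<Rightarrow> real" and A B :: "('a \<times> 'a) set" and \<rho> \<alpha> :: "real \<Rightarrow> real" and v :: real
  assumes "generalized_pcfss F N \<psi>"
    and "connected F"
    and "\<forall>i\<in>{1..N}. 0 < \<theta> i \<and> \<theta> i < 1"
    and "(\<Sum>i=1..N. \<theta> i) = 1"
    and "\<forall>i\<in>{1..N}. 0 < r i"
    and "iterable_family F N \<psi> r A B \<rho> \<alpha>"
    and "v_min N r \<rho> \<alpha> < v"
  defines "\<mu> \<equiv> bernoulli_measure F N \<psi> \<theta>"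
    and "E \<equiv> limit_form F N \<psi> r A B \<rho> \<alpha> v"
    and "D \<equiv> limit_domain F N \<psi> r A B \<rho> \<alpha> v"
  shows "regular_dirichlet_form \<mu> E D \<and> local_form \<mu> E D \<and> irreducible_form \<mu> E D \<and>
    has_resistance_metric F E D \<and>
    Metric_space.mtopology F (resistance_dist F E D) = top_of_set F"
proof -
  interpret bernoulli F N \<psi> \<theta>
    by unfold_locales (use assms(1,3,4) in auto)
  have it: "one_parameter_family F N \<psi> r A B \<rho> \<alpha>" "rational_on_positives \<rho>" "rational_on_positives \<alpha>"
      "\<exists>u\<ge>0. bdd_above ((\<lambda>v. inverse (\<rho> v)) ` {u<..}) \<and>
        max_weight N r * (SUP v\<in>{u<..}. inverse (\<rho> v)) < 1"
      "filterlim \<alpha> at_top at_top" "\<exists>\<beta>>1. ((\<lambda>v. \<alpha> v / v) \<longlongrightarrow> 1 / \<beta>) at_top"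
    using assms(6) unfolding iterable_family_def by blast+
  obtain \<beta> where \<beta>: "1 < \<beta>" "((\<lambda>v. \<alpha> v / v) \<longlongrightarrow> 1 / \<beta>) at_top" using it(6) by blast
  have N: "1 \<le> N"
  proof (rule ccontr)
    assume "\<not> 1 \<le> N"
    then have "{1..N} = {}" by simp
    then show False using F_eq F_ne by simp
  qed
  have pos: "\<And>v. 0 < v \<Longrightarrow> 0 < \<rho> v" using it(1) unfolding one_parameter_family_def by blast
  interpret iterated_forms F N \<psi> r \<rho> \<alpha> \<beta> A B v
    by unfold_locales (use N assms it pos \<beta> in auto)
  interpret dirichlet_limit F V level_conductance "osc\<^sup>2" "bernoulli_measure F N \<psi> \<theta>"
    by (intro dirichlet_limit.intro dirichlet_limit_axioms.intro limit.resistance_limit_axioms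
        sets_bernoulli prob_bernoulli full_support_bernoulli limit_short_edges)
  show ?thesis
    unfolding \<mu>_def E_def D_def limit_domain_eq[symmetric] limit_form_eq[symmetric]
    using regular local irreducible limit.has_resistance_metric limit.resistance_topology by blast
qed

end
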